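(* Let $\Lambda,\Delta$ be two independent uniformly random partitions of $n$, and let $Q(n)=\mathbb P(\Lambda\succeq\Delta)$, where $\Lambda\succeq\Delta$ means $\sum_{j=1}^i\Delta_j\le\sum_{j=1}^i\Lambda_j$ for all $i\ge1$. Then for all sufficiently large $n$, \[ Q(n)\le \exp\left(-\frac{0.11\log n}{\log\log n}\right). \]
   Context: A partition of $n$ is a weakly decreasing sequence $\lambda_1\ge\lambda_2\ge\cdots$ of positive integers summing to $n$; $\lambda_j:=0$ for $j$ larger than the number of parts. The relation $\succeq$ is the dominance order on partitions of $n$. *)

theory Defs
  imports "HOL-Probability.Probability"
begin

definition partitions :: "nat \<Rightarrow> nat list set" where
  "partitions n = {xs. sorted_wrt (\<ge>) xs \<and> (\<forall>x\<in>set xs. x > 0) \<and> sum_list xs = n}"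

text \<open>Parts are indexed from 1, and \<open>\<lambda>\<^sub>j = 0\<close> beyond the last part.\<close>

definition part :: "nat list \<Rightarrow> nat \<Rightarrow> nat" where
  "part xs j = (if 1 \<le> j \<and> j \<le> length xs then xs ! (j - 1) else 0)"

definition dominates :: "nat list \<Rightarrow> nat list \<Rightarrow> bool" (infix "\<succeq>" 50) where
  "xs \<succeq> ys \<longleftrightarrow> (\<forall>i\<ge>1. (\<Sum>j=1..i. part ys j) \<le> (\<Sum>j=1..i. part xs j))"

text \<open>\<open>pmf_of_set\<close> is the uniform distribution only on a finite nonempty set.\<close>

lemma finite_partitions: "finite (partitions n)"
proof (rule finite_subset)
  show "partitions n \<subseteq> {xs. set xs \<subseteq> {0..n} \<and> length xs \<le> n}"
  proof
    fix xs assume "xs \<in> partitions n"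
    then have pos: "\<forall>x\<in>set xs. x > 0" and sum: "sum_list xs = n"
      by (auto simp: partitions_def)
    have "length xs \<le> sum_list xs"
      using pos by (induction xs) auto
    moreover have "x \<le> n" if "x \<in> set xs" for x
      using member_le_sum_list[OF that] sum by simp
    ultimately show "xs \<in> {xs. set xs \<subseteq> {0..n} \<and> length xs \<le> n}"
      using sum by auto
  qed
  show "finite {xs. set xs \<subseteq> {0..n} \<and> length xs \<le> n}"
    by (rule finite_lists_length_le) simp
qed

lemma partitions_nonempty: "partitions n \<noteq> {}"
proof -
  have "(if n = 0 then [] else [n]) \<in> partitions n"
    by (simp add: partitions_def)
  then show ?thesis by blast
qed

definition Q :: "nat \<Rightarrow> real" where
  "Q n = measure_pmf.prob
     (pair_pmf (pmf_of_set (partitions n)) (pmf_of_set (partitions n)))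
     {(\<Lambda>, \<Delta>). \<Lambda> \<succeq> \<Delta>}"

end

(*
  Give every part size s independent geometric multiplicities with ratio q^s, where q = exp (-u) and u
  of order 1 / sqrt n makes the expected weight equal to n; conditioning two copies on weight n yields two
  independent uniform partitions. Dominance forces, for every t, the weighted difference of the two
  multiplicity vectors with weights min s t to be at most 0. Along scales t that grow by a factor
  (log n)^(2.2), this difference is governed, with probability 1 - O(n^(-4)), by the sizes s close to t in
  the multiplicative sense. So about 0.2 log n / log log n independent symmetric variables have to be
  essentially nonpositive, which costs a factor close to 1/2 each.

  The conditioning is harmless because of a local limit comparison: the weight of the sizes outside the
  blocks hits no value with probability larger than exp (C sqrt (log n)) times the probability that the
  total weight is n. It comes from replacing a part s by s + h with h of order sqrt n.
*)
theory Submission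
  imports Defs "HOL-Real_Asymp.Real_Asymp"
begin

section \<open>Independent geometric multiplicities\<close>

text \<open>The obstacle is the conditioning: both weights equal \<open>n\<close> with a probability
  that is polynomially small in \<open>n\<close>, so a failure event survives division by it only if
  it is smaller by a further power of \<open>n\<close>. This forces deviations with
  \<open>H = 4 * ln n\<close> in the exponent. The neighbouring scales then disturb a block by a
  relative amount of order \<open>sqrt (H / G)\<close>, which is small only if \<open>G\<close>
  exceeds \<open>ln n\<close> by a growing factor; hence \<open>G\<close> close to
  \<open>ln n powr 1.1\<close>, and a ratio \<open>G\<^sup>2\<close> between consecutive blocks. For
  the main event such a division would be too expensive. There the sizes outside the blocks must
  still hit their required totals, and comparing this probability with that of total weight
  \<open>n\<close> costs only the exponential of a multiple of \<open>sqrt (ln n)\<close>, which is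
  negligible against the claimed bound. All blocks lie below \<open>h\<close>, about
  \<open>1 / u\<close>, whereas the exchange of parts uses the sizes between \<open>h\<close> and
  \<open>3 * h\<close> and the size 1; taking out the blocks does not disturb it. Within a block a
  multiplicity has variance about \<open>1 / (s * u)\<^sup>2\<close>, so every size
  \<open>s \<le> t\<close> contributes about the same amount \<open>1 / u\<^sup>2\<close> to the
  variance of the weighted difference.\<close>

text \<open>An index \<open>(s, b)\<close> carries the number of parts of size \<open>s\<close> in the partition \<open>\<Lambda>\<close> if \<open>b\<close>
  holds and in \<open>\<Delta>\<close> otherwise.\<close>

definition geo :: "real \<Rightarrow> (nat \<times> bool) set \<Rightarrow> (nat \<times> bool \<Rightarrow> nat) pmf" where
  "geo q A = Pi_pmf A 0 (\<lambda>i. geometric_pmf (1 - q ^ fst i))"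

definition weight :: "(nat \<times> bool) set \<Rightarrow> (nat \<times> bool \<Rightarrow> nat) \<Rightarrow> nat" where
  "weight A f = (\<Sum>i\<in>A. fst i * f i)"

definition wprob :: "real \<Rightarrow> (nat \<times> bool) set \<Rightarrow> nat \<Rightarrow> real" where
  "wprob q A N = measure_pmf.prob (geo q A) {f. weight A f = N}"

lemma pmf_geometric_power:
  assumes "0 < q" "q < 1" "1 \<le> (s::nat)"
  shows "pmf (geometric_pmf (1 - q ^ s)) k = q ^ (s * k) * (1 - q ^ s)"
proof -
  have "q ^ s < 1" "0 < q ^ s" using assms by (auto simp: power_less_one_iff)
  then show ?thesis by (simp add: power_mult)
qed

text \<open>\<open>Pi_pmf\<close> charges only functions that take the default value 0 off
  \<open>A\<close>, so an event may be altered on all other functions. This turns weight events into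
  finite sets.\<close>

lemma geo_cong_support:
  assumes "finite A" and "\<And>f. (\<And>i. i \<notin> A \<Longrightarrow> f i = 0) \<Longrightarrow> P f \<longleftrightarrow> P' f"
  shows "measure_pmf.prob (geo q A) {f. P f} = measure_pmf.prob (geo q A) {f. P' f}"
  by (rule measure_prob_cong_0) (use assms in \<open>auto simp: geo_def pmf_Pi\<close>)

text \<open>The mass depends on \<open>f\<close> only through its weight. Hence all configurations
  of a given weight are equally likely, which is the source of the uniform distribution on
  partitions.\<close>

lemma pmf_geo:
  assumes "finite A" "0 < q" "q < 1" "\<And>i. i \<in> A \<Longrightarrow> 1 \<le> fst i" "\<And>i. i \<notin> A \<Longrightarrow> f i = 0"
  shows "pmf (geo q A) f = q ^ weight A f * (\<Prod>i\<in>A. 1 - q ^ fst i)"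
proof -
  have "pmf (geo q A) f = (\<Prod>i\<in>A. q ^ (fst i * f i) * (1 - q ^ fst i))"
    using assms by (simp add: geo_def pmf_Pi' pmf_geometric_power cong: prod.cong)
  then show ?thesis
    by (simp add: prod.distrib weight_def power_sum)
qed

text \<open>Vanishing off \<open>A\<close> is what makes the set finite: \<open>weight\<close> does
  not see the other coordinates.\<close>

definition level :: "(nat \<times> bool) set \<Rightarrow> nat \<Rightarrow> (nat \<times> bool \<Rightarrow> nat) set" where
  "level A N = {f. (\<forall>i. i \<notin> A \<longrightarrow> f i = 0) \<and> weight A f = N}"

lemma finite_level:
  assumes "finite A" "\<And>i. i \<in> A \<Longrightarrow> 1 \<le> fst i"
  shows "finite (level A N)"
proof (rule finite_subset)
  show "level A N \<subseteq> {f. \<forall>i. (i \<in> A \<longrightarrow> f i \<in> {..N}) \<and> (i \<notin> A \<longrightarrow> f i = 0)}"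
  proof safe
    fix f a b assume f: "f \<in> level A N" and i: "(a, b) \<in> A"
    have "f (a, b) \<le> fst (a, b) * f (a, b)" using assms(2)[OF i] by simp
    also have "\<dots> \<le> weight A f"
      unfolding weight_def by (rule member_le_sum) (use i assms in auto)
    finally show "f (a, b) \<le> N" using f by (simp add: level_def)
  qed (auto simp: level_def)
qed (use assms in \<open>intro finite_set_of_finite_funs; simp\<close>)

text \<open>Probabilities at a fixed weight are cardinalities times a constant, so bijections
  between level sets become identities between probabilities.\<close>

lemma prob_level:
  assumes "finite A" "0 < q" "q < 1" "\<And>i. i \<in> A \<Longrightarrow> 1 \<le> fst i"
  shows "measure_pmf.prob (geo q A) {f. weight A f = N \<and> P f} =
    real (card {f \<in> level A N. P f}) * (q ^ N * (\<Prod>i\<in>A. 1 - q ^ fst i))"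
proof -
  have "measure_pmf.prob (geo q A) {f. weight A f = N \<and> P f} =
      measure_pmf.prob (geo q A) {f \<in> level A N. P f}"
    unfolding level_def using geo_cong_support[OF assms(1),
      of "\<lambda>f. weight A f = N \<and> P f" "\<lambda>f. f \<in> level A N \<and> P f"]
    by (auto simp: level_def)
  also have "\<dots> = (\<Sum>f\<in>{f \<in> level A N. P f}. pmf (geo q A) f)"
    using finite_level[OF assms(1,4)] by (intro measure_measure_pmf_finite) auto
  also have "\<dots> = (\<Sum>f\<in>{f \<in> level A N. P f}. q ^ N * (\<Prod>i\<in>A. 1 - q ^ fst i))"
    by (intro sum.cong refl, subst pmf_geo) (use assms in \<open>auto simp: level_def\<close>)
  finally show ?thesis by simp
qed

lemma weight_upd:
  assumes "finite A" "i \<in> A"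
  shows "weight A (f(i := x)) + fst i * f i = weight A f + fst i * x"
proof -
  have "weight A g = fst i * g i + (\<Sum>j\<in>A - {i}. fst j * g j)" for g
    unfolding weight_def using assms by (rule sum.remove)
  from this[of f] this[of "f(i := x)"] show ?thesis by simp
qed

text \<open>Inserting one copy of the part \<open>i\<close> is a bijection of level sets; it raises
  the weight by \<open>fst i\<close>, which changes the mass by the factor
  \<open>q ^ fst i\<close>.\<close>

lemma prob_part_present:
  assumes "finite A" "0 < q" "q < 1" "\<And>j. j \<in> A \<Longrightarrow> 1 \<le> fst j" and i: "i \<in> A"
  shows "measure_pmf.prob (geo q A) {f. weight A f = N + fst i \<and> 1 \<le> f i} =
    q ^ fst i * wprob q A N"
proof -
  have "bij_betw (\<lambda>f. f(i := f i + 1)) (level A N) {f \<in> level A (N + fst i). 1 \<le> f i}"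
  proof (rule bij_betwI[where g = "\<lambda>f. f(i := f i - 1)"])
    show "(\<lambda>f. f(i := f i + 1)) \<in> level A N \<rightarrow> {f \<in> level A (N + fst i). 1 \<le> f i}"
    proof
      fix f assume "f \<in> level A N"
      with weight_upd[OF assms(1) i, of f "f i + 1"] i
      show "f(i := f i + 1) \<in> {f \<in> level A (N + fst i). 1 \<le> f i}" by (auto simp: level_def)
    qed
    show "(\<lambda>f. f(i := f i - 1)) \<in> {f \<in> level A (N + fst i). 1 \<le> f i} \<rightarrow> level A N"
    proof
      fix f assume f: "f \<in> {f \<in> level A (N + fst i). 1 \<le> f i}"
      then have "fst i * f i = fst i * (f i - 1) + fst i"
        by (cases "f i") auto
      with weight_upd[OF assms(1) i, of f "f i - 1"] f i
      show "f(i := f i - 1) \<in> level A N" by (auto simp: level_def)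
    qed
  qed auto
  then have "card (level A N) = card {f \<in> level A (N + fst i). 1 \<le> f i}"
    by (rule bij_betw_same_card)
  with prob_level[OF assms(1-4), of "N + fst i" "\<lambda>f. 1 \<le> f i"]
    prob_level[OF assms(1-4), of N "\<lambda>_. True"]
  show ?thesis by (simp add: wprob_def power_add)
qed

lemma weight_ge:
  assumes "finite A" "i \<in> A" "1 \<le> f i"
  shows "fst i \<le> weight A f"
proof -
  have "fst i \<le> fst i * f i" using assms by simp
  also have "\<dots> \<le> weight A f"
    unfolding weight_def by (rule member_le_sum) (use assms in auto)
  finally show ?thesis .
qed

text \<open>Both sides are obtained by deleting one part, of size \<open>fst i'\<close> and \<open>fst i\<close> respectively.\<close>

lemma prob_part_exchange:
  assumes "finite A" "0 < q" "q < 1" "\<And>j. j \<in> A \<Longrightarrow> 1 \<le> fst j"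
    and "i \<in> A" "i' \<in> A" and D: "fst i' = fst i + D"
  shows "measure_pmf.prob (geo q A) {f. weight A f = N + D \<and> 1 \<le> f i'} =
    q ^ D * measure_pmf.prob (geo q A) {f. weight A f = N \<and> 1 \<le> f i}"
proof (cases "fst i \<le> N")
  case True
  then obtain M where M: "N = M + fst i" by (metis add.commute le_Suc_ex)
  have "N + D = M + fst i'" using M D by simp
  then show ?thesis
    using prob_part_present[OF assms(1-4) \<open>i \<in> A\<close>, of M]
      prob_part_present[OF assms(1-4) \<open>i' \<in> A\<close>, of M] M D
    by (simp add: power_add add.assoc mult_ac)
next
  case False
  have 1: "{f. weight A f = N \<and> 1 \<le> f i} = {}"
    using weight_ge[OF assms(1) \<open>i \<in> A\<close>] False by fastforce
  have 2: "{f. weight A f = N + D \<and> 1 \<le> f i'} = {}"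
    using weight_ge[OF assms(1) \<open>i' \<in> A\<close>] False D by fastforce
  show ?thesis unfolding 1 2 by simp
qed

text \<open>A part of size 1 fills any gap one unit at a time, at the cost of a factor
  \<open>q\<close> per unit. This works only upwards, which shapes \<open>far_down\<close>.\<close>

lemma wprob_add_ge:
  assumes "finite A" "0 < q" "q < 1" "\<And>j. j \<in> A \<Longrightarrow> 1 \<le> fst j" and "(1, b) \<in> A"
  shows "q ^ k * wprob q A N \<le> wprob q A (N + k)"
proof (induction k)
  case (Suc k)
  have "q ^ Suc k * wprob q A N \<le> q * wprob q A (N + k)"
    using Suc assms by (simp add: mult.assoc)
  also have "\<dots> = measure_pmf.prob (geo q A) {f. weight A f = N + k + 1 \<and> 1 \<le> f (1, b)}"
    using prob_part_present[OF assms(1-4,5), of "N + k"] by simp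
  also have "\<dots> \<le> wprob q A (N + Suc k)"
    unfolding wprob_def by (intro measure_pmf.finite_measure_mono) auto
  finally show ?case .
qed simp

section \<open>Concentration of the number of part sizes that occur\<close>

lemma prob_geometric_ge1:
  assumes "0 < q" "q < 1" "1 \<le> (s::nat)"
  shows "measure_pmf.prob (geometric_pmf (1 - q ^ s)) {k. 1 \<le> k} = q ^ s"
proof -
  have "{k::nat. 1 \<le> k} = - {0}" by auto
  then have "measure_pmf.prob (geometric_pmf (1 - q ^ s)) {k. 1 \<le> k} = 
    1 - pmf (geometric_pmf (1 - q ^ s)) 0"
    using measure_pmf.prob_compl[of "{0::nat}" "geometric_pmf (1 - q ^ s)"]
    by (simp add: Compl_eq_Diff_UNIV pmf.rep_eq)
  with pmf_geometric_power[OF assms, of 0] show ?thesis by simp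
qed

text \<open>Sizes are counted without multiplicity: the summands are then bounded by 1, as
  Hoeffding's inequality requires, and each is 1 with probability \<open>q ^ fst i\<close>.\<close>

definition occ :: "(nat \<times> bool) set \<Rightarrow> (nat \<times> bool \<Rightarrow> nat) \<Rightarrow> real" where
  "occ J f = (\<Sum>i\<in>J. of_bool (1 \<le> f i))"

lemma occ_concentration:
  fixes z :: real
  assumes "finite A" "0 < q" "q < 1" "\<And>j. j \<in> A \<Longrightarrow> 1 \<le> fst j" "J \<subseteq> A" "J \<noteq> {}" "0 \<le> z"
  defines "m \<equiv> \<Sum>i\<in>J. q ^ fst i"
  shows "measure_pmf.prob (geo q A) {f. occ J f \<ge> m + z} \<le> exp (- 2 * z\<^sup>2 / card J)" (is ?A)
    and "measure_pmf.prob (geo q A) {f. occ J f \<le> m - z} \<le> exp (- 2 * z\<^sup>2 / card J)" (is ?B)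
proof -
  have J: "finite J" using assms finite_subset by blast
  have comp: "map_pmf (\<lambda>f. f i) (geo q A) = geometric_pmf (1 - q ^ fst i)" if "i \<in> J" for i
    unfolding geo_def using Pi_pmf_component[OF assms(1)] assms(5) that by (metis subsetD)
  have ind: "prob_space.indep_vars (measure_pmf (geo q A)) (\<lambda>_. borel)
      (\<lambda>i f. of_bool (1 \<le> f i) :: real) J"
    using prob_space.indep_vars_compose2[OF measure_pmf.prob_space_axioms
      prob_space.indep_vars_subset[OF measure_pmf.prob_space_axioms
        indep_vars_Pi_pmf[OF assms(1), of 0 "\<lambda>i. geometric_pmf (1 - q ^ fst i)"] assms(5)],
      of "\<lambda>_ n. of_bool (1 \<le> n)" "\<lambda>_. borel"]
    by (simp add: geo_def)
  have ex: "measure_pmf.expectation (geo q A) (\<lambda>f. of_bool (1 \<le> f i) :: real) = q ^ fst i"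
    if "i \<in> J" for i
  proof -
    have "measure_pmf.expectation (geo q A) (\<lambda>f. of_bool (1 \<le> f i) :: real) =
      measure_pmf.expectation (map_pmf (\<lambda>f. f i) (geo q A)) (\<lambda>k. of_bool (1 \<le> k))"
      by simp
    also have "\<dots> = measure_pmf.expectation (geometric_pmf (1 - q ^ fst i)) (indicator {k. 1 \<le> k})"
      unfolding comp[OF that] by (intro Bochner_Integration.integral_cong) (auto simp: indicator_def)
    also have "\<dots> = q ^ fst i"
      using prob_geometric_ge1[OF assms(2,3) assms(4)[OF subsetD[OF assms(5) that]]] by simp
    finally show ?thesis .
  qed
  interpret Hoeffding_ineq "measure_pmf (geo q A)" J "\<lambda>i f. of_bool (1 \<le> f i)" "\<lambda>_. 0" "\<lambda>_. 1" m
  proof unfold_locales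
    show "m \<equiv> \<Sum>i\<in>J. measure_pmf.expectation (geo q A) (\<lambda>f. of_bool (1 \<le> f i))"
      unfolding m_def by (intro eq_reflection sum.cong refl ex[symmetric])
  qed (use J ind in auto)
  have "0 < card J" using J assms by (simp add: card_gt_0_iff)
  with Hoeffding_ineq_ge[OF \<open>0 \<le> z\<close>] Hoeffding_ineq_le[OF \<open>0 \<le> z\<close>] show ?A ?B
    by (simp_all add: occ_def)
qed

section \<open>Exchanging parts of sizes \<open>s\<close> and \<open>s + h\<close>\<close>

lemma sum_prob_present:
  assumes "finite J"
  shows "(\<Sum>i\<in>J. measure_pmf.prob (geo q A) {f. weight A f = N \<and> 1 \<le> f i}) =
    measure_pmf.expectation (geo q A) (\<lambda>f. occ J f * indicator {f. weight A f = N} f)"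
proof -
  have "occ J f * indicator {f. weight A f = N} f =
      (\<Sum>i\<in>J. indicator {f. weight A f = N \<and> 1 \<le> f i} f :: real)" for f
    unfolding occ_def sum_distrib_right by (intro sum.cong) (auto simp: indicator_def)
  then show ?thesis
    by (simp add: Bochner_Integration.integral_sum measure_pmf.integrable_const_bound[where B = 1])
qed

lemma occ_bounds: "0 \<le> occ J f" "occ J f \<le> card J"
  unfolding occ_def using sum_bounded_above[of J "\<lambda>i. of_bool (1 \<le> f i)" "1::real"]
  by (auto intro!: sum_nonneg)

lemma sum_times_singleton: "(\<Sum>i\<in>S \<times> {b}. g (fst i)) = (\<Sum>s\<in>S. g s)"
  by (rule sum.reindex_bij_witness[of _ "\<lambda>s. (s, b)" fst]) auto

text \<open>By \<open>sum_prob_present\<close> the sum is the expectation of \<open>occ J\<close> on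
  the event of weight \<open>N\<close>. Each one-sided deviation of \<open>occ J\<close> from its
  mean \<open>m\<close> by \<open>z\<close> has probability at most \<open>er\<close>, and it
  contributes at most \<open>card J * er\<close> to the upper bound and \<open>m * er\<close> to the
  lower one.\<close>

lemma sum_prob_present_bounds:
  fixes z m er :: real
  assumes "finite A" "0 < q" "q < 1" "\<And>j. j \<in> A \<Longrightarrow> 1 \<le> fst j" "J \<subseteq> A" "J \<noteq> {}" "0 \<le> z"
  defines "m \<equiv> \<Sum>i\<in>J. q ^ fst i" and "er \<equiv> exp (- 2 * z\<^sup>2 / card J)"
  shows "(\<Sum>i\<in>J. measure_pmf.prob (geo q A) {f. weight A f = N \<and> 1 \<le> f i}) \<le>
      (m + z) * wprob q A N + card J * er" (is ?A)
    and "(m - z) * wprob q A N - m * er \<le>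
      (\<Sum>i\<in>J. measure_pmf.prob (geo q A) {f. weight A f = N \<and> 1 \<le> f i})" (is ?B)
proof -
  have J: "finite J" using assms finite_subset by blast
  have m: "0 \<le> m" using assms by (auto simp: m_def intro!: sum_nonneg)
  note conc = occ_concentration[OF assms(1-7), folded m_def er_def]
  note int = measure_pmf.integrable_const_bound[where B = "real (card J)"]
  have int: "integrable (geo q A) (\<lambda>f. occ J f * indicator {f. weight A f = N} f)"
    by (intro int AE_I2) (use occ_bounds[of J] in \<open>auto simp: indicator_def\<close>)
  have ind: "integrable (geo q A) (indicator X :: _ \<Rightarrow> real)" for X
    by (intro measure_pmf.integrable_const_bound[where B = 1]) auto
  have "measure_pmf.expectation (geo q A) (\<lambda>f. occ J f * indicator {f. weight A f = N} f)
    \<le> measure_pmf.expectation (geo q A) (\<lambda>f. (m + z) * indicator {f. weight A f = N} f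
        + real (card J) * indicator {f. occ J f \<ge> m + z} f)"
  proof (intro integral_mono int)
    fix f show "occ J f * indicator {f. weight A f = N} f
      \<le> (m + z) * indicator {f. weight A f = N} f + real (card J) * indicator {f. occ J f \<ge> m + z} f"
      using occ_bounds[of J f] m \<open>0 \<le> z\<close> by (auto simp: indicator_def)
  qed (intro Bochner_Integration.integrable_add integrable_mult_right ind)
  also have "\<dots> = (m + z) * wprob q A N + card J * measure_pmf.prob (geo q A) {f. occ J f \<ge> m + z}"
    by (subst Bochner_Integration.integral_add)
       (auto simp: wprob_def intro!: integrable_mult_right ind)
  also have "\<dots> \<le> (m + z) * wprob q A N + card J * er"
    using conc(1) by (intro add_mono mult_left_mono order_refl) auto
  finally show ?A unfolding sum_prob_present[OF J] .
  have "(m - z) * wprob q A N - m * er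
      \<le> (m - z) * wprob q A N - m * measure_pmf.prob (geo q A) {f. occ J f \<le> m - z}"
    using conc(2) m by (intro diff_mono mult_left_mono order_refl) auto
  also have "\<dots> = measure_pmf.expectation (geo q A) (\<lambda>f. (m - z) * indicator {f. weight A f = N} f
        - m * indicator {f. occ J f \<le> m - z} f)"
    by (subst Bochner_Integration.integral_diff)
       (auto simp: wprob_def intro!: integrable_mult_right ind)
  also have "\<dots> \<le> measure_pmf.expectation (geo q A) (\<lambda>f. occ J f * indicator {f. weight A f = N} f)"
  proof (intro integral_mono int)
    fix f show "(m - z) * indicator {f. weight A f = N} f - m * indicator {f. occ J f \<le> m - z} f
      \<le> occ J f * indicator {f. weight A f = N} f"
      using occ_bounds[of J f] m \<open>0 \<le> z\<close> by (auto simp: indicator_def)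
  qed (intro Bochner_Integration.integrable_diff integrable_mult_right ind)
  finally show ?B unfolding sum_prob_present[OF J] .
qed

lemma wprob_nonneg: "0 \<le> wprob q A N"
  by (simp add: wprob_def)

lemma sum_wprob:
  assumes "finite X"
  shows "(\<Sum>N\<in>X. wprob q A N) = measure_pmf.prob (geo q A) {f. weight A f \<in> X}"
proof -
  have "{f. weight A f \<in> X} = (\<Union>N\<in>X. {f. weight A f = N})" by auto
  then show ?thesis
    unfolding wprob_def
    by (subst measure_pmf.finite_measure_finite_Union[symmetric])
       (use assms in \<open>auto simp: disjoint_family_on_def\<close>)
qed

text \<open>Write \<open>f N\<close> for the probability that the weight is \<open>N\<close>. Counting the replaceable parts in two ways
  compares \<open>f N\<close> with \<open>f (N + h)\<close>, because the number of such parts is almost constant; so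
  \<open>f\<close> varies slowly along steps of length \<open>h\<close>. Inside a step the part size 1 controls the
  decrease of \<open>f\<close>. Here \<open>z\<close> is the deviation allowed for the number of replaceable parts.\<close>

locale smooth_family =
  fixes q :: real and A :: "(nat \<times> bool) set" and b :: bool and h :: nat and z :: real
  assumes fin: "finite A" and q0: "0 < q" and q1: "q < 1"
    and pos: "\<And>j. j \<in> A \<Longrightarrow> 1 \<le> fst j"
    and one: "(1, b) \<in> A" and h: "1 \<le> h" and sub: "{h<..3 * h} \<times> {b} \<subseteq> A"
    and z: "0 \<le> z" "z \<le> h * q ^ (3 * h)"
begin

definition m :: real where "m = (\<Sum>s\<in>{2*h<..3*h}. q ^ s)"
definition err :: real where "err = exp (- 2 * z\<^sup>2 / h)"
text \<open>One step of length \<open>h\<close> costs the factor \<open>\<rho>\<close>, from the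
  fluctuation of the number of replaceable parts, and the additive loss \<open>\<delta>\<close>,
  from the Hoeffding error.\<close>

definition \<rho> :: real where "\<rho> = (m - z) / (m + z)"
definition \<delta> :: real where "\<delta> = 2 * h * err / (m + z)"

lemma m_bounds: "h * q ^ (3 * h) \<le> m" "m \<le> h"
proof -
  have "(\<Sum>s\<in>{2*h<..3*h}. q ^ (3*h)) \<le> m"
    unfolding m_def using q0 q1 by (intro sum_mono power_decreasing) auto
  then show "h * q ^ (3 * h) \<le> m" by simp
  have "m \<le> (\<Sum>s\<in>{2*h<..3*h}. 1)"
    unfolding m_def using q0 q1 by (intro sum_mono power_le_one) auto
  then show "m \<le> h" by simp
qed

lemma m_pos: "0 < m"
proof -
  have "0 < h * q ^ (3 * h)" using h q0 by simp
  then show ?thesis using m_bounds by linarith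
qed

lemma rho: "0 \<le> \<rho>" "\<rho> \<le> 1"
  using m_pos m_bounds z unfolding \<rho>_def by auto

lemma delta: "0 \<le> \<delta>"
  using m_pos z by (simp add: \<delta>_def err_def)

text \<open>The shift by \<open>h\<close> matches one window of sizes with the next, and
  \<open>prob_part_exchange\<close> applies to each matched pair with the same factor
  \<open>q ^ h\<close>.\<close>

lemma exchange:
  "(\<Sum>i\<in>{2*h<..3*h} \<times> {b}. measure_pmf.prob (geo q A) {f. weight A f = N + h \<and> 1 \<le> f i}) =
   q ^ h * (\<Sum>i\<in>{h<..2*h} \<times> {b}. measure_pmf.prob (geo q A) {f. weight A f = N \<and> 1 \<le> f i})"
proof -
  have bij: "bij_betw (\<lambda>i. (fst i + h, b)) ({h<..2*h} \<times> {b}) ({2*h<..3*h} \<times> {b})"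
    by (rule bij_betwI[where g = "\<lambda>i. (fst i - h, b)"]) auto
  have "(\<Sum>i\<in>{2*h<..3*h} \<times> {b}. measure_pmf.prob (geo q A) {f. weight A f = N + h \<and> 1 \<le> f i}) =
    (\<Sum>i\<in>{h<..2*h} \<times> {b}. measure_pmf.prob (geo q A) {f. weight A f = N + h \<and> 1 \<le> f (fst i + h, b)})"
    by (rule sum.reindex_bij_betw[OF bij, symmetric])
  also have "\<dots> = (\<Sum>i\<in>{h<..2*h} \<times> {b}. q ^ h * measure_pmf.prob (geo q A) {f. weight A f = N \<and> 1 \<le> f i})"
    by (intro sum.cong refl prob_part_exchange fin q0 q1 pos) (use sub in auto)
  finally show ?thesis by (simp add: sum_distrib_left)
qed

text \<open>The expected numbers of sizes present in the two windows differ by exactly the factor of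
  \<open>exchange\<close>, so this factor cancels and \<open>\<rho>\<close> can be close to
  1.\<close>

lemma sum_lower: "q ^ h * (\<Sum>i\<in>{h<..2*h} \<times> {b}. q ^ fst i) = m"
proof -
  have bij: "bij_betw (\<lambda>s. s + h) {h<..2*h} {2*h<..3*h}"
    by (rule bij_betwI[where g = "\<lambda>i. i - h"]) auto
  have "m = (\<Sum>s\<in>{h<..2*h}. q ^ (s + h))"
    unfolding m_def by (rule sum.reindex_bij_betw[OF bij, symmetric])
  also have "\<dots> = q ^ h * (\<Sum>s\<in>{h<..2*h}. q ^ s)"
    by (simp add: sum_distrib_left power_add mult.commute)
  also have "(\<Sum>s\<in>{h<..2*h}. q ^ s) = (\<Sum>i\<in>{h<..2*h} \<times> {b}. q ^ fst i)"
    by (rule sum_times_singleton[symmetric])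
  finally show ?thesis by simp
qed

text \<open>\<open>X\<close> is nearly \<open>m0\<close> times the probability at \<open>N\<close>,
  and \<open>Y\<close> nearly \<open>m\<close> times the one at \<open>N + h\<close>. Since
  \<open>Y = q ^ h * X\<close> and \<open>q ^ h * m0 = m\<close>, the two probabilities agree up to
  the relative fluctuation \<open>z / m\<close>; the two claims bound \<open>X\<close> and
  \<open>Y\<close> in opposite directions.\<close>

lemma step_up: "\<rho> * wprob q A N - \<delta> \<le> wprob q A (N + h)"
  and step_down: "\<rho> * wprob q A (N + h) - \<delta> \<le> wprob q A N"
proof -
  define J J' where "J = {h<..2*h} \<times> {b}" and "J' = {2*h<..3*h} \<times> {b}"
  have cards: "card J = h" "card J' = h" by (auto simp: J_def J'_def card_cartesian_product)
  have ne: "J \<noteq> {}" "J' \<noteq> {}" using cards h by auto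
  have subs: "J \<subseteq> A" "J' \<subseteq> A" using sub by (auto simp: J_def J'_def)
  define m0 where "m0 = (\<Sum>i\<in>J. q ^ fst i)"
  have m0: "q ^ h * m0 = m" using sum_lower by (simp add: m0_def J_def)
  have m': "(\<Sum>i\<in>J'. q ^ fst i) = m"
    unfolding m_def J'_def by (rule sum_times_singleton)
  define X Y where "X = (\<Sum>i\<in>J. measure_pmf.prob (geo q A) {f. weight A f = N \<and> 1 \<le> f i})"
    and "Y = (\<Sum>i\<in>J'. measure_pmf.prob (geo q A) {f. weight A f = N + h \<and> 1 \<le> f i})"
  have XY: "Y = q ^ h * X" using exchange[of N] by (simp add: X_def Y_def J_def J'_def)
  note B = sum_prob_present_bounds[OF fin q0 q1 pos subs(1) ne(1) z(1), of N,
      folded m0_def X_def, unfolded cards, folded err_def]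
  note B' = sum_prob_present_bounds[OF fin q0 q1 pos subs(2) ne(2) z(1), of "N + h",
      unfolded m' cards, folded err_def Y_def]
  have qh: "0 \<le> q ^ h" "q ^ h \<le> 1" using q0 q1 by (auto intro: power_le_one)
  have e: "0 \<le> err" by (simp add: err_def)
  have mh: "m * err \<le> h * err" using m_bounds e by (intro mult_right_mono) auto
  have qz: "q ^ h * z \<le> z" using qh z by (simp add: mult_left_le_one_le)
  have "(m - z) * wprob q A N - m * err \<le> (m - q ^ h * z) * wprob q A N - m * err"
    using qz wprob_nonneg[of q A N] by (intro diff_right_mono mult_right_mono) auto
  also have "\<dots> = q ^ h * ((m0 - z) * wprob q A N - m0 * err)"
    by (simp add: m0[symmetric] algebra_simps)
  also have "\<dots> \<le> Y" unfolding XY by (intro mult_left_mono B qh)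
  finally have "(m - z) * wprob q A N \<le> (m + z) * wprob q A (N + h) + 2 * (h * err)"
    using B'(1) mh by linarith
  then have "((m - z) * wprob q A N - 2 * (h * err)) / (m + z) \<le> wprob q A (N + h)"
    using m_pos z by (subst pos_divide_le_eq) (simp_all add: algebra_simps)
  then show "\<rho> * wprob q A N - \<delta> \<le> wprob q A (N + h)"
    by (simp add: \<rho>_def \<delta>_def diff_divide_eq_iff diff_divide_distrib[of _ _ "m + z"] mult.assoc left_diff_distrib)
  have "Y \<le> q ^ h * ((m0 + z) * wprob q A N + h * err)"
    unfolding XY by (intro mult_left_mono B qh)
  also have "\<dots> = (m + q ^ h * z) * wprob q A N + q ^ h * (h * err)"
    by (simp add: m0[symmetric] algebra_simps)
  also have "\<dots> \<le> (m + z) * wprob q A N + 1 * (h * err)"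
    using qz qh wprob_nonneg[of q A N] e by (intro add_mono mult_right_mono) auto
  finally have "(m - z) * wprob q A (N + h) \<le> (m + z) * wprob q A N + 2 * (h * err)"
    using B'(2) mh by linarith
  then have "((m - z) * wprob q A (N + h) - 2 * (h * err)) / (m + z) \<le> wprob q A N"
    using m_pos z by (subst pos_divide_le_eq) (simp_all add: algebra_simps)
  then show "\<rho> * wprob q A (N + h) - \<delta> \<le> wprob q A N"
    by (simp add: \<rho>_def \<delta>_def diff_divide_eq_iff diff_divide_distrib[of _ _ "m + z"] mult.assoc left_diff_distrib)
qed

text \<open>As \<open>\<rho>\<close> is at most 1, earlier additive losses are not amplified and
  simply add up.\<close>

lemma iterate:
  fixes g :: "nat \<Rightarrow> real"
  assumes "\<And>j. j < k \<Longrightarrow> \<rho> * g j - \<delta> \<le> g (Suc j)"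
  shows "\<rho> ^ k * g 0 - k * \<delta> \<le> g k"
  using assms
proof (induction k)
  case (Suc k)
  have "\<rho> ^ Suc k * g 0 - Suc k * \<delta> \<le> \<rho> * (\<rho> ^ k * g 0 - k * \<delta>) - \<delta>"
    using mult_right_mono[OF rho(2), of "k * \<delta>"] delta by (simp add: algebra_simps)
  also have "\<dots> \<le> \<rho> * g k - \<delta>"
    using Suc rho by (intro diff_right_mono mult_left_mono) auto
  also have "\<dots> \<le> g (Suc k)" using Suc.prems by simp
  finally show ?case .
qed simp

text \<open>Makes the bound uniform: the number \<open>j\<close> of long steps and the number
  \<open>r\<close> of unit steps are replaced by their maxima \<open>k\<close> and
  \<open>h\<close>.\<close>

lemma drop_bound:
  assumes "j \<le> k" "0 \<le> v" "\<rho> ^ j * v - j * \<delta> \<le> w" "0 \<le> w" "q ^ r * w \<le> x" "r \<le> h"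
  shows "q ^ h * (\<rho> ^ k * v - k * \<delta>) \<le> x"
proof -
  have "\<rho> ^ k * v - k * \<delta> \<le> \<rho> ^ j * v - j * \<delta>"
    using assms rho delta by (intro diff_mono mult_right_mono power_decreasing) auto
  then have "q ^ h * (\<rho> ^ k * v - k * \<delta>) \<le> q ^ h * w"
    using assms(3) q0 by (intro mult_left_mono) auto
  also have "\<dots> \<le> q ^ r * w"
    using assms q0 q1 by (intro mult_right_mono power_decreasing) auto
  finally show ?thesis using assms(5) by simp
qed

text \<open>Cover \<open>x\<close> by \<open>x div h\<close> steps of length \<open>h\<close> and
  bridge the remainder with parts of size 1.\<close>

lemma far_up:
  assumes "x < k * h"
  shows "q ^ h * (\<rho> ^ k * wprob q A N - k * \<delta>) \<le> wprob q A (N + x)"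
proof (rule drop_bound)
  show "x div h \<le> k" using assms by (simp add: less_mult_imp_div_less less_imp_le)
  show "\<rho> ^ (x div h) * wprob q A N - (x div h) * \<delta> \<le> wprob q A (N + x div h * h)"
    using iterate[of "x div h" "\<lambda>j. wprob q A (N + j * h)"] step_up[of "N + _ * h"]
    by (simp add: algebra_simps)
  show "q ^ (x mod h) * wprob q A (N + x div h * h) \<le> wprob q A (N + x)"
    using wprob_add_ge[OF fin q0 q1 pos one, of "x mod h" "N + x div h * h"] by (simp add: add.assoc)
  show "x mod h \<le> h" using h by (simp add: less_imp_le)
qed (rule wprob_nonneg)+

lemma far_down:
  assumes "x < k * h" "k * h \<le> n"
  shows "q ^ h * (\<rho> ^ k * wprob q A (n + x) - k * \<delta>) \<le> wprob q A n"
proof -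
  \<comment> \<open>Unit steps only go upwards, so the descent from \<open>n + x\<close> overshoots:
    one long step more than fits into \<open>x\<close> leads to some \<open>M\<close> at most
    \<open>n\<close>, and parts of size 1 climb back to \<open>n\<close>.\<close>
  define j where "j = Suc (x div h)"
  have jk: "j \<le> k" using assms by (simp add: j_def less_mult_imp_div_less Suc_leI)
  have "j * h \<le> n" using jk assms(2) by (meson dual_order.trans mult_le_mono1)
  then obtain M where M: "n + x = M + j * h" by (metis add.commute le_Suc_ex trans_le_add1)
  have xj: "x = (j - 1) * h + x mod h" by (simp add: j_def)
  have "x mod h < h" using h by simp
  have jh: "j * h = (j - 1) * h + h" by (simp add: j_def)
  have n: "n = M + (h - x mod h)" using M xj jh \<open>x mod h < h\<close> by linarith
  have "\<rho> * wprob q A (M + (j - i) * h) - \<delta> \<le> wprob q A (M + (j - Suc i) * h)" if "i < j" for i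
  proof -
    have "j - i = Suc (j - Suc i)" using that by simp
    then show ?thesis using step_down[of "M + (j - Suc i) * h"] by (simp add: algebra_simps)
  qed
  from iterate[of j "\<lambda>i. wprob q A (M + (j - i) * h)", OF this]
  have "\<rho> ^ j * wprob q A (n + x) - j * \<delta> \<le> wprob q A M" unfolding M by simp
  moreover have "q ^ (h - x mod h) * wprob q A M \<le> wprob q A n"
    using wprob_add_ge[OF fin q0 q1 pos one, of "h - x mod h" M] n by simp
  ultimately show ?thesis
    using drop_bound[OF jk] wprob_nonneg by simp
qed

text \<open>A large value at \<open>N\<close> forces comparable values at all \<open>k * h\<close>
  points from \<open>N\<close> on, and these sum to at most 1.\<close>

lemma wprob_sup_bound:
  assumes "1 \<le> k"
  shows "\<rho> ^ k * wprob q A N \<le> 1 / (k * h * q ^ h) + k * \<delta>"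
proof -
  have "(\<Sum>x\<in>{..<k*h}. q ^ h * (\<rho> ^ k * wprob q A N - k * \<delta>)) \<le> (\<Sum>x\<in>{..<k*h}. wprob q A (N + x))"
    by (intro sum_mono far_up) auto
  also have "\<dots> = (\<Sum>y\<in>(+) N ` {..<k*h}. wprob q A y)"
    by (subst sum.reindex) auto
  also have "\<dots> \<le> 1" by (subst sum_wprob) auto
  finally have "k * h * q ^ h * (\<rho> ^ k * wprob q A N - k * \<delta>) \<le> 1"
    by (simp add: mult.assoc)
  then have "\<rho> ^ k * wprob q A N - k * \<delta> \<le> 1 / (k * h * q ^ h)"
    using assms h q0 by (subst pos_le_divide_eq) (auto simp: mult_ac)
  then show ?thesis by simp
qed

text \<open>Every point of the window around \<open>n\<close> passes a share of its mass to
  \<open>n\<close>, so the value at \<open>n\<close> is at least a share of the average over the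
  window.\<close>

lemma wprob_lower_bound:
  assumes "k * h \<le> n" "1 \<le> k"
  shows "q ^ h * (\<rho> ^ k * measure_pmf.prob (geo q A) {f. \<bar>real (weight A f) - real n\<bar> < k * h} - 2 * real k ^ 2 * h * \<delta>)
     \<le> 2 * k * h * wprob q A n"
proof -
  define W where "W = {n - k*h <..< n + k*h}"
  have cW: "card W = 2 * (k * h) - 1" using assms h by (simp add: W_def)
  have cW': "real (card W) \<le> 2 * k * h" unfolding cW by (simp flip: of_nat_mult add: of_nat_diff)
  have "q ^ h * (\<rho> ^ k * wprob q A N - k * \<delta>) \<le> wprob q A n" if N: "N \<in> W" for N
  proof (cases "N \<le> n")
    case True
    have "q ^ h * (\<rho> ^ k * wprob q A N - k * \<delta>) \<le> wprob q A (N + (n - N))"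
      by (rule far_up) (use N assms True in \<open>auto simp: W_def\<close>)
    then show ?thesis using True by simp
  next
    case False
    have "q ^ h * (\<rho> ^ k * wprob q A (n + (N - n)) - k * \<delta>) \<le> wprob q A n"
      by (rule far_down) (use N assms False in \<open>auto simp: W_def\<close>)
    then show ?thesis using False by simp
  qed
  then have "(\<Sum>N\<in>W. q ^ h * (\<rho> ^ k * wprob q A N - k * \<delta>)) \<le> (\<Sum>N\<in>W. wprob q A n)"
    by (rule sum_mono)
  then have "q ^ h * (\<rho> ^ k * (\<Sum>N\<in>W. wprob q A N) - card W * (k * \<delta>)) \<le> card W * wprob q A n"
    by (simp add: sum_distrib_left[symmetric] sum_subtractf)
  also have "\<dots> \<le> 2 * k * h * wprob q A n"
    by (intro mult_right_mono cW' wprob_nonneg)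
  also have "(\<Sum>N\<in>W. wprob q A N) =
      measure_pmf.prob (geo q A) {f. \<bar>real (weight A f) - real n\<bar> < k * h}"
  proof -
    have "x \<in> W \<longleftrightarrow> \<bar>real x - real n\<bar> < k * h" for x
      using assms(1) unfolding W_def by (simp flip: of_nat_mult add: abs_less_iff) linarith
    then show ?thesis by (subst sum_wprob) (auto simp: W_def)
  qed
  finally have "q ^ h * (\<rho> ^ k * measure_pmf.prob (geo q A) {f. \<bar>real (weight A f) - real n\<bar> < k * h}
      - card W * (k * \<delta>)) \<le> 2 * k * h * wprob q A n" .
  moreover have "card W * (k * \<delta>) \<le> 2 * real k ^ 2 * h * \<delta>"
    using mult_right_mono[OF cW', of "k * \<delta>"] delta by (simp add: power2_eq_square mult_ac)
  then have "q ^ h * (\<rho> ^ k * p - 2 * real k ^ 2 * h * \<delta>) \<le> q ^ h * (\<rho> ^ k * p - card W * (k * \<delta>))" for p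
    using q0 by (intro mult_left_mono) auto
  ultimately show ?thesis by (meson order_trans)
qed

end

section \<open>Generating functions and tail bounds\<close>

lemma geometric_expectation:
  fixes F :: "nat \<Rightarrow> 'c::{real_normed_field, banach, second_countable_topology}"
  assumes "0 < p" "p \<le> 1" and sm: "summable (\<lambda>k. (1 - p) ^ k * norm (F k))"
  shows "integrable (geometric_pmf p) F"
    and "(\<lambda>k. of_real ((1 - p) ^ k * p) * F k) sums measure_pmf.expectation (geometric_pmf p) F"
proof -
  have "summable (\<lambda>k. norm (((1 - p) ^ k * p) *\<^sub>R F k))"
    using summable_mult[OF sm, of p] assms by (simp add: mult_ac)
  then have int: "integrable (count_space UNIV) (\<lambda>k. pmf (geometric_pmf p) k *\<^sub>R F k)"
    unfolding integrable_count_space_nat_iff using assms by simp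
  then show "integrable (geometric_pmf p) F"
    unfolding measure_pmf_eq_density by (subst integrable_density) auto
  have "measure_pmf.expectation (geometric_pmf p) F =
      (\<integral>k. pmf (geometric_pmf p) k *\<^sub>R F k \<partial>count_space UNIV)"
    unfolding measure_pmf_eq_density by (subst integral_density) auto
  then show "(\<lambda>k. of_real ((1 - p) ^ k * p) * F k) sums measure_pmf.expectation (geometric_pmf p) F"
    using sums_integral_count_space_nat[OF int] assms by (simp add: scaleR_conv_of_real)
qed

text \<open>The codomain is general because the formula serves twice: with real arguments for
  exponential moments and with \<open>cis\<close> for characteristic functions.\<close>

lemma geometric_pgf:
  fixes z :: "'c::{real_normed_field, banach, second_countable_topology}"
  assumes "0 < p" "p \<le> 1" "(1 - p) * norm z < 1"
  shows "integrable (geometric_pmf p) (\<lambda>k. z ^ k)"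
    and "measure_pmf.expectation (geometric_pmf p) (\<lambda>k. z ^ k) = of_real p / (1 - of_real (1 - p) * z)"
proof -
  have nz: "norm (of_real (1 - p) * z) = (1 - p) * norm z"
    using assms by (simp add: norm_mult del: of_real_diff)
  have "summable (\<lambda>k. ((1 - p) * norm z) ^ k)"
    using assms by (intro summable_geometric) (simp add: abs_mult)
  then have "summable (\<lambda>k. (1 - p) ^ k * norm (z ^ k))"
    by (simp add: power_mult_distrib norm_power)
  note * = geometric_expectation[OF assms(1,2) this]
  from *(1) show "integrable (geometric_pmf p) (\<lambda>k. z ^ k)" .
  have "(\<lambda>k. of_real p * (of_real (1 - p) * z) ^ k) sums (of_real p * (1 / (1 - of_real (1 - p) * z)))"
    using assms nz by (intro sums_mult geometric_sums) simp
  also have "(\<lambda>k. of_real p * (of_real (1 - p) * z) ^ k) = (\<lambda>k. of_real ((1 - p) ^ k * p) * z ^ k)"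
    by (simp add: power_mult_distrib mult_ac)
  finally show "measure_pmf.expectation (geometric_pmf p) (\<lambda>k. z ^ k) = of_real p / (1 - of_real (1 - p) * z)"
    using *(2) sums_unique2 by force
qed

lemma geo_expectation_prod:
  fixes F :: "nat \<times> bool \<Rightarrow> nat \<Rightarrow> 'c::{real_normed_field, banach, second_countable_topology}"
  assumes "finite A" "\<And>i. i \<in> A \<Longrightarrow> integrable (geometric_pmf (1 - q ^ fst i)) (F i)"
  shows "integrable (geo q A) (\<lambda>f. \<Prod>i\<in>A. F i (f i))"
    and "measure_pmf.expectation (geo q A) (\<lambda>f. \<Prod>i\<in>A. F i (f i)) =
      (\<Prod>i\<in>A. measure_pmf.expectation (geometric_pmf (1 - q ^ fst i)) (F i))"
proof -
  have comp: "map_pmf (\<lambda>f. f i) (geo q A) = geometric_pmf (1 - q ^ fst i)" if "i \<in> A" for i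
    unfolding geo_def using Pi_pmf_component[OF assms(1)] that by metis
  have ind: "prob_space.indep_vars (measure_pmf (geo q A)) (\<lambda>_. borel) (\<lambda>i f. F i (f i)) A"
    using prob_space.indep_vars_compose2[OF measure_pmf.prob_space_axioms
        indep_vars_Pi_pmf[OF assms(1), of 0 "\<lambda>i. geometric_pmf (1 - q ^ fst i)"],
      of F "\<lambda>_. borel"]
    by (simp add: geo_def)
  have int: "integrable (geo q A) (\<lambda>f. F i (f i))" if "i \<in> A" for i
    using assms(2)[OF that] unfolding comp[OF that, symmetric] by (simp add: integrable_map_pmf_eq)
  show "integrable (geo q A) (\<lambda>f. \<Prod>i\<in>A. F i (f i))"
    by (rule prob_space.indep_vars_integrable[OF measure_pmf.prob_space_axioms assms(1) ind int])
  have "measure_pmf.expectation (geo q A) (\<lambda>f. \<Prod>i\<in>A. F i (f i)) =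
      (\<Prod>i\<in>A. measure_pmf.expectation (geo q A) (\<lambda>f. F i (f i)))"
    by (rule prob_space.indep_vars_lebesgue_integral[OF measure_pmf.prob_space_axioms assms(1) ind int])
  also have "\<dots> = (\<Prod>i\<in>A. measure_pmf.expectation (map_pmf (\<lambda>f. f i) (geo q A)) (F i))"
    by simp
  finally show "measure_pmf.expectation (geo q A) (\<lambda>f. \<Prod>i\<in>A. F i (f i)) =
      (\<Prod>i\<in>A. measure_pmf.expectation (geometric_pmf (1 - q ^ fst i)) (F i))"
    by (simp add: comp cong: prod.cong)
qed

text \<open>The variance of a geometric variable with success probability \<open>1 - q ^ s\<close>,
  that is, of the multiplicity of \<open>s\<close>.\<close>

definition geom_var :: "real \<Rightarrow> nat \<Rightarrow> real" where
  "geom_var q s = q ^ s / (1 - q ^ s)\<^sup>2"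

definition wdiff :: "nat set \<Rightarrow> (nat \<Rightarrow> real) \<Rightarrow> (nat \<times> bool \<Rightarrow> nat) \<Rightarrow> real" where
  "wdiff S w f = (\<Sum>s\<in>S. w s * (real (f (s, True)) - real (f (s, False))))"

text \<open>The generating functions at \<open>z\<close> and \<open>inverse z\<close> multiply to
  that of a difference of two independent copies; the product depends on \<open>x\<close> only
  through the variance \<open>x / (1 - x)\<^sup>2\<close>.\<close>

lemma pair_pgf_eq:
  fixes z x :: "'c::{real_normed_field, banach, second_countable_topology}"
  assumes "z \<noteq> 0" "x \<noteq> 1"
  shows "(1 - x) / (1 - x * z) * ((1 - x) / (1 - x * inverse z)) =
     1 / (1 - x / (1 - x)\<^sup>2 * (z + inverse z - 2))"
proof -
  have "(1 - x) / (1 - x * z) * ((1 - x) / (1 - x * inverse z)) =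
      (1 - x)\<^sup>2 / ((1 - x * z) * (1 - x * inverse z))"
    by (simp add: power2_eq_square)
  also have "(1 - x * z) * (1 - x * inverse z) = (1 - x)\<^sup>2 * (1 - x / (1 - x)\<^sup>2 * (z + inverse z - 2))"
  proof -
    have "(1 - x)\<^sup>2 * (1 - x / (1 - x)\<^sup>2 * (z + inverse z - 2)) = (1 - x)\<^sup>2 - x * (z + inverse z - 2)"
      using assms by (simp add: right_diff_distrib)
    moreover have "(1 - x * z) * (1 - x * inverse z) = (1 - x)\<^sup>2 - x * (z + inverse z - 2)"
      using assms by (simp add: field_simps power2_eq_square)
    ultimately show ?thesis by simp
  qed
  finally show ?thesis using assms by simp
qed

lemma prod_times_bool:
  "finite S \<Longrightarrow> (\<Prod>i\<in>S \<times> UNIV. g i) = (\<Prod>s\<in>S. g (s, True) * g (s, False))"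
  using prod.cartesian_product[of "\<lambda>s b. g (s, b)" "UNIV :: bool set" S]
  by (simp add: UNIV_bool mult.commute)

lemma geo_pgf_diff:
  fixes z :: "nat \<Rightarrow> 'c::{real_normed_field, banach, second_countable_topology}"
  assumes "finite S" "0 < q" "q < 1" "\<And>s. s \<in> S \<Longrightarrow> 1 \<le> s"
    and z0: "\<And>s. s \<in> S \<Longrightarrow> z s \<noteq> 0"
    and z: "\<And>s. s \<in> S \<Longrightarrow> q ^ s * norm (z s) < 1" "\<And>s. s \<in> S \<Longrightarrow> q ^ s * norm (inverse (z s)) < 1"
  defines "G \<equiv> \<lambda>f. \<Prod>s\<in>S. z s ^ f (s, True) * inverse (z s) ^ f (s, False)"
  shows "integrable (geo q (S \<times> UNIV)) G"
    and "measure_pmf.expectation (geo q (S \<times> UNIV)) G =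
       (\<Prod>s\<in>S. 1 / (1 - of_real (geom_var q s) * (z s + inverse (z s) - 2)))"
proof -
  define F where "F = (\<lambda>i k. (if snd i then z (fst i) else inverse (z (fst i))) ^ k)"
  have G: "G = (\<lambda>f. \<Prod>i\<in>S \<times> UNIV. F i (f i))"
    unfolding G_def F_def prod_times_bool[OF assms(1)] by simp
  have q: "0 < 1 - q ^ s" "1 - q ^ s \<le> 1" if "s \<in> S" for s
    using assms(2,3) assms(4)[OF that] by (auto simp: power_less_one_iff)
  have F: "integrable (geometric_pmf (1 - q ^ fst i)) (F i)"
    "measure_pmf.expectation (geometric_pmf (1 - q ^ fst i)) (F i) =
       of_real (1 - q ^ fst i) / (1 - of_real (q ^ fst i) * (if snd i then z (fst i) else inverse (z (fst i))))"
    if "i \<in> S \<times> UNIV" for i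
    using geometric_pgf[of "1 - q ^ fst i" "if snd i then z (fst i) else inverse (z (fst i))"]
      q[of "fst i"] z[of "fst i"] that unfolding F_def by auto
  show "integrable (geo q (S \<times> UNIV)) G"
    unfolding G using assms(1) F by (intro geo_expectation_prod) auto
  have "measure_pmf.expectation (geo q (S \<times> UNIV)) G = (\<Prod>i\<in>S \<times> UNIV.
       of_real (1 - q ^ fst i) / (1 - of_real (q ^ fst i) * (if snd i then z (fst i) else inverse (z (fst i)))))"
    unfolding G using assms(1) F by (subst geo_expectation_prod) (auto intro!: prod.cong)
  also have "\<dots> = (\<Prod>s\<in>S. of_real (1 - q ^ s) / (1 - of_real (q ^ s) * z s) *
      (of_real (1 - q ^ s) / (1 - of_real (q ^ s) * inverse (z s))))"
    unfolding prod_times_bool[OF assms(1)] by simp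
  also have "\<dots> = (\<Prod>s\<in>S. 1 / (1 - of_real (geom_var q s) * (z s + inverse (z s) - 2)))"
  proof (intro prod.cong refl)
    fix s assume s: "s \<in> S"
    have "of_real (q ^ s) \<noteq> (1::'c)" using q[OF s] by (metis less_numeral_extra(3) diff_self of_real_eq_1_iff)
    from pair_pgf_eq[OF z0[OF s] this]
    show "of_real (1 - q ^ s) / (1 - of_real (q ^ s) * z s) *
      (of_real (1 - q ^ s) / (1 - of_real (q ^ s) * inverse (z s))) =
      1 / (1 - of_real (geom_var q s) * (z s + inverse (z s) - 2))"
      by (simp add: geom_var_def)
  qed
  finally show "measure_pmf.expectation (geo q (S \<times> UNIV)) G =
       (\<Prod>s\<in>S. 1 / (1 - of_real (geom_var q s) * (z s + inverse (z s) - 2)))" .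
qed

section \<open>Chernoff bound for the weighted difference\<close>

lemma exp_le_quadratic:
  fixes x :: real
  assumes "\<bar>x\<bar> \<le> 1"
  shows "exp x \<le> 1 + x + x\<^sup>2"
proof (cases "0 \<le> x")
  case True then show ?thesis using exp_bound assms by simp
next
  case False
  define y where "y = - x"
  have y: "0 \<le> y" "y \<le> 1" using False assms by (auto simp: y_def)
  \<comment> \<open>The product equals \<open>1 + y ^ 3\<close>.\<close>
  have "1 \<le> (1 + y) * (1 - y + y\<^sup>2)" using y by (simp add: algebra_simps power2_eq_square)
  also have "\<dots> \<le> exp y * (1 - y + y\<^sup>2)"
  proof (intro mult_right_mono)
    have "0 \<le> (y - 1/2)\<^sup>2" by simp
    then show "0 \<le> 1 - y + y\<^sup>2" by (simp add: power2_eq_square algebra_simps)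
  qed simp
  finally have "exp (-y) * 1 \<le> exp (-y) * (exp y * (1 - y + y\<^sup>2))" by (intro mult_left_mono) auto
  then show ?thesis by (simp add: y_def flip: mult.assoc exp_add)
qed

lemma exp_sum_le:
  fixes x :: real
  assumes "\<bar>x\<bar> \<le> 1"
  shows "exp x + inverse (exp x) - 2 \<le> 2 * x\<^sup>2" "0 \<le> exp x + inverse (exp x) - 2"
proof -
  show "exp x + inverse (exp x) - 2 \<le> 2 * x\<^sup>2"
    using exp_le_quadratic[OF assms] exp_le_quadratic[of "-x"] assms by (simp add: exp_minus)
  show "0 \<le> exp x + inverse (exp x) - 2"
    using exp_ge_add_one_self[of x] exp_ge_add_one_self[of "-x"] unfolding exp_minus by linarith
qed

lemma inverse_le_exp:
  fixes v :: real assumes "0 \<le> v" "v \<le> 1 / 2" shows "1 / (1 - v) \<le> exp (2 * v)"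
proof -
  have "1 \<le> (1 + 2 * v) * (1 - v)"
    using mult_nonneg_nonneg[of v "1 - 2 * v"] assms by (simp add: algebra_simps)
  also have "\<dots> \<le> exp (2 * v) * (1 - v)"
    using assms by (intro mult_right_mono) auto
  finally show ?thesis using assms by (simp add: field_simps)
qed

text \<open>Chernoff's method with tilt \<open>l\<close>. With \<open>z s = exp (l * w s)\<close>,
  the conditions \<open>w1\<close> and \<open>w2\<close> keep
  \<open>v = geom_var q s * (z s + inverse (z s) - 2)\<close> at most 1/2, so that each factor
  \<open>1 / (1 - v)\<close> is at most \<open>exp (2 * v)\<close> and the exponents sum to at most
  \<open>4 * l\<^sup>2 * V\<close>.\<close>

lemma wdiff_tail:
  fixes w :: "nat \<Rightarrow> real"
  assumes "finite S" "0 < q" "q < 1" "\<And>s. s \<in> S \<Longrightarrow> 1 \<le> s" and l: "0 < l"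
    and w1: "\<And>s. s \<in> S \<Longrightarrow> \<bar>l * w s\<bar> \<le> 1"
    and w2: "\<And>s. s \<in> S \<Longrightarrow> geom_var q s * (l * w s)\<^sup>2 \<le> 1 / 4"
    and V: "(\<Sum>s\<in>S. geom_var q s * (w s)\<^sup>2) \<le> V"
  shows "measure_pmf.prob (geo q (S \<times> UNIV)) {f. y \<le> wdiff S w f} \<le> exp (4 * l\<^sup>2 * V - l * y)"
proof -
  define z where "z = (\<lambda>s. exp (l * w s))"
  have vr: "0 \<le> geom_var q s" for s using assms by (simp add: geom_var_def)
  have v: "0 \<le> geom_var q s * (z s + inverse (z s) - 2)"
    "geom_var q s * (z s + inverse (z s) - 2) \<le> 2 * (geom_var q s * (l * w s)\<^sup>2)" if "s \<in> S" for s
    using exp_sum_le[OF w1[OF that]] vr[of s]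
      mult_left_mono[of "z s + inverse (z s) - 2" "2 * (l * w s)\<^sup>2" "geom_var q s"] by (auto simp: z_def)
  have fact: "q ^ s * z s < 1 \<and> q ^ s * inverse (z s) < 1" if s: "s \<in> S" for s
  proof -
    have q: "0 < q ^ s" "q ^ s < 1" using assms(2,3) assms(4)[OF s] by (auto simp: power_less_one_iff)
    have zp: "0 < z s" by (simp add: z_def)
    have "geom_var q s * (z s + inverse (z s) - 2) \<le> 1 / 2" using v[OF s] w2[OF s] by linarith
    then have *: "q ^ s * (z s + inverse (z s) - 2) \<le> (1 - q ^ s)\<^sup>2 / 2"
      using q by (simp add: geom_var_def field_simps)
    have "(1 - q ^ s * z s) * (1 - q ^ s * inverse (z s)) =
        (1 - q ^ s)\<^sup>2 - q ^ s * (z s + inverse (z s) - 2)"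
      using zp by (simp add: field_simps power2_eq_square)
    moreover have "0 < (1 - q ^ s)\<^sup>2" using q by simp
    ultimately have pos: "0 < (1 - q ^ s * z s) * (1 - q ^ s * inverse (z s))" using * by linarith
    \<comment> \<open>The two factors have a positive product; once their sum is positive too, both
      are positive, so both generating functions converge.\<close>
    have "(1 - q ^ s)\<^sup>2 \<le> 1 - q ^ s"
      using q by (simp add: power2_eq_square mult_left_le_one_le)
    with * q have "0 < (1 - q ^ s * z s) + (1 - q ^ s * inverse (z s))"
      by (simp add: algebra_simps)
    with pos show ?thesis by (auto simp: zero_less_mult_iff)
  qed
  define G where "G = (\<lambda>f::nat \<times> bool \<Rightarrow> nat. \<Prod>s\<in>S. z s ^ f (s, True) * inverse (z s) ^ f (s, False))"
  note pgf = geo_pgf_diff[OF assms(1-4), of z, folded G_def]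
  have int: "integrable (geo q (S \<times> UNIV)) G"
    by (rule pgf(1)) (use fact in \<open>auto simp: z_def\<close>)
  have G: "G f = exp (l * wdiff S w f)" for f
  proof -
    have "G f = (\<Prod>s\<in>S. exp (l * (w s * (real (f (s, True)) - real (f (s, False))))))"
      unfolding G_def z_def exp_minus[symmetric] exp_of_nat_mult[symmetric] exp_add[symmetric]
      by (intro prod.cong refl) (simp add: algebra_simps)
    then show ?thesis
      unfolding wdiff_def sum_distrib_left using exp_sum[OF assms(1)] by metis
  qed
  have "measure_pmf.expectation (geo q (S \<times> UNIV)) G =
       (\<Prod>s\<in>S. 1 / (1 - geom_var q s * (z s + inverse (z s) - 2)))"
    by (subst pgf(2)) (use fact in \<open>auto simp: z_def\<close>)
  also have "\<dots> \<le> (\<Prod>s\<in>S. exp (4 * l\<^sup>2 * (geom_var q s * (w s)\<^sup>2)))"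
  proof (intro prod_mono conjI)
    fix s assume s: "s \<in> S"
    have h: "geom_var q s * (z s + inverse (z s) - 2) \<le> 1 / 2" using v[OF s] w2[OF s] by linarith
    then show "0 \<le> 1 / (1 - geom_var q s * (z s + inverse (z s) - 2))" by simp
    have "1 / (1 - geom_var q s * (z s + inverse (z s) - 2)) \<le> exp (2 * (geom_var q s * (z s + inverse (z s) - 2)))"
      by (rule inverse_le_exp[OF v(1)[OF s] h])
    also have "\<dots> \<le> exp (4 * l\<^sup>2 * (geom_var q s * (w s)\<^sup>2))"
      unfolding exp_le_cancel_iff using mult_left_mono[OF v(2)[OF s], of 2]
      by (simp add: power_mult_distrib mult_ac)
    finally show "1 / (1 - geom_var q s * (z s + inverse (z s) - 2)) \<le> exp (4 * l\<^sup>2 * (geom_var q s * (w s)\<^sup>2))" .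
  qed
  also have "\<dots> = exp (4 * l\<^sup>2 * (\<Sum>s\<in>S. geom_var q s * (w s)\<^sup>2))"
    by (simp add: exp_sum[OF assms(1)] sum_distrib_left)
  also have "\<dots> \<le> exp (4 * l\<^sup>2 * V)" using V by (simp add: mult_left_mono)
  finally have E: "measure_pmf.expectation (geo q (S \<times> UNIV)) G \<le> exp (4 * l\<^sup>2 * V)" .
  have "{f. y \<le> wdiff S w f} = {f. exp (l * y) \<le> G f}" using l by (simp add: G)
  then have "measure_pmf.prob (geo q (S \<times> UNIV)) {f. y \<le> wdiff S w f} \<le>
      measure_pmf.expectation (geo q (S \<times> UNIV)) G / exp (l * y)"
    using integral_Markov_inequality_measure[OF int, of UNIV "exp (l * y)"] by (simp add: G[abs_def])
  also have "\<dots> \<le> exp (4 * l\<^sup>2 * V) / exp (l * y)" using E by (intro divide_right_mono) auto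
  finally show ?thesis by (simp add: exp_diff)
qed

section \<open>Anticoncentration of a block\<close>

lemma cos_bounds_near_zero:
  fixes x :: real
  assumes "\<bar>x\<bar> \<le> 1"
  shows "1 / 2 \<le> cos x" "x\<^sup>2 / 4 \<le> 1 - cos x"
proof -
  have c: "cos x = 1 - 2 * (sin (x / 2))\<^sup>2" using cos_double_sin[of "x / 2"] by simp
  have "\<bar>sin (x / 2)\<bar> \<le> 1 / 2" using abs_sin_x_le_abs_x[of "x / 2"] assms by simp
  then have "\<bar>sin (x / 2)\<bar>\<^sup>2 \<le> (1 / 2)\<^sup>2" by (intro power_mono) auto
  then show "1 / 2 \<le> cos x" using c by (simp add: power2_eq_square)
  have "\<bar>sin (x / 2) - (\<Sum>m<3. sin_coeff m * (x / 2) ^ m)\<bar> \<le> inverse (fact 3) * \<bar>x / 2\<bar> ^ 3"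
    by (rule Maclaurin_sin_bound)
  then have "\<bar>sin (x / 2) - x / 2\<bar> \<le> \<bar>x / 2\<bar> ^ 3 / 6"
    by (simp add: eval_nat_numeral sin_coeff_def)
  also have "\<bar>x / 2\<bar> ^ 3 \<le> \<bar>x / 2\<bar> * 1"
    unfolding power3_eq_cube mult.assoc using assms by (intro mult_left_mono mult_le_one) auto
  finally have "\<bar>x / 2\<bar> * (5 / 6) \<le> \<bar>sin (x / 2)\<bar>" by linarith
  then have "(\<bar>x / 2\<bar> * (5 / 6))\<^sup>2 \<le> \<bar>sin (x / 2)\<bar>\<^sup>2" by (intro power_mono) auto
  then have "x\<^sup>2 * (25 / 144) \<le> (sin (x / 2))\<^sup>2" by (simp add: power_mult_distrib power_divide)
  \<comment> \<open>The identity \<open>c\<close> doubles this to the required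
    \<open>x\<^sup>2 / 4\<close>.\<close>
  moreover have "x\<^sup>2 * (18 / 144) \<le> x\<^sup>2 * (25 / 144)" by (intro mult_left_mono) auto
  ultimately show "x\<^sup>2 / 4 \<le> 1 - cos x" unfolding c by linarith
qed

text \<open>On the unit circle \<open>z + inverse z\<close> is twice a cosine, so the characteristic
  function of the difference is real.\<close>

lemma expectation_cos_wdiff:
  assumes "finite S" "0 < q" "q < 1" "\<And>s. s \<in> S \<Longrightarrow> 1 \<le> s"
  shows "measure_pmf.expectation (geo q (S \<times> UNIV)) (\<lambda>f. cos (a * wdiff S w f)) =
    (\<Prod>s\<in>S. 1 / (1 + 2 * geom_var q s * (1 - cos (a * w s))))"
proof -
  define z where "z = (\<lambda>s. cis (a * w s))"
  define G where "G = (\<lambda>f::nat \<times> bool \<Rightarrow> nat. \<Prod>s\<in>S. z s ^ f (s, True) * inverse (z s) ^ f (s, False))"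
  have q: "q ^ s < 1" if "s \<in> S" for s
    using assms(2,3) assms(4)[OF that] by (auto simp: power_less_one_iff)
  note pgf = geo_pgf_diff[OF assms(1-4), of z, folded G_def]
  have int: "integrable (geo q (S \<times> UNIV)) G"
    by (rule pgf(1)) (use q assms in \<open>auto simp: z_def norm_inverse\<close>)
  have G: "G f = cis (a * wdiff S w f)" for f
  proof -
    have "G f = (\<Prod>s\<in>S. cis (a * (w s * (real (f (s, True)) - real (f (s, False))))))"
      unfolding G_def z_def cis_inverse Complex.DeMoivre cis_mult
      by (intro prod.cong refl) (simp add: algebra_simps)
    also have "\<dots> = cis (a * wdiff S w f)"
      unfolding wdiff_def sum_distrib_left using assms(1)
      by (induction S rule: finite_induct) (auto simp: cis_mult)
    finally show ?thesis .
  qed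
  have "measure_pmf.expectation (geo q (S \<times> UNIV)) (\<lambda>f. cos (a * wdiff S w f)) =
      Re (measure_pmf.expectation (geo q (S \<times> UNIV)) G)"
    using integral_Re[OF int] by (simp add: G)
  also have "measure_pmf.expectation (geo q (S \<times> UNIV)) G =
       (\<Prod>s\<in>S. 1 / (1 - of_real (geom_var q s) * (z s + inverse (z s) - 2)))"
    by (subst pgf(2)) (use q assms in \<open>auto simp: z_def norm_inverse\<close>)
  also have "\<dots> = of_real (\<Prod>s\<in>S. 1 / (1 + 2 * geom_var q s * (1 - cos (a * w s))))"
    unfolding of_real_prod
  proof (intro prod.cong refl)
    fix s
    have "z s + inverse (z s) - 2 = of_real (2 * (cos (a * w s) - 1))"
      by (simp add: z_def cis_inverse complex_eq_iff)
    then have "1 - of_real (geom_var q s) * (z s + inverse (z s) - 2) =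
        complex_of_real (1 + 2 * geom_var q s * (1 - cos (a * w s)))"
      by (simp add: algebra_simps)
    then show "1 / (1 - of_real (geom_var q s) * (z s + inverse (z s) - 2)) =
        complex_of_real (1 / (1 + 2 * geom_var q s * (1 - cos (a * w s))))"
      by simp
  qed
  finally show ?thesis by (simp only: Re_complex_of_real)
qed

text \<open>The double sum is the squared modulus of the sum of \<open>cis (j * y)\<close>; hence
  the kernel is nonnegative.\<close>

lemma trig_square_sum:
  fixes y :: real and J :: nat
  shows "(\<Sum>j<J. \<Sum>k<J. cos ((real j - real k) * y)) = (\<Sum>j<J. cos (j * y))\<^sup>2 + (\<Sum>j<J. sin (j * y))\<^sup>2"
  by (simp add: power2_eq_square sum_product left_diff_distrib cos_diff sum.distrib)

text \<open>The Fejer-type kernel \<open>\<Sum>\<^sub>j\<^sub>k cos ((j - k) \<theta> y)\<close> is nonnegative everywhere and at least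
  \<open>J\<^sup>2 / 2\<close> on \<open>\<bar>y\<bar> \<le> e\<close>, so its expectation bounds the probability of that interval.\<close>

lemma small_ball:
  fixes J :: nat and e \<theta> \<kappa> :: real
  assumes "finite S" "0 < q" "q < 1" "\<And>s. s \<in> S \<Longrightarrow> 1 \<le> s"
    and J: "1 \<le> J" and th: "0 < \<theta>" "J * \<theta> * e \<le> 1"
    and \<kappa>: "\<And>a. \<theta> \<le> \<bar>a\<bar> \<Longrightarrow> \<bar>a\<bar> \<le> J * \<theta> \<Longrightarrow>
        (\<Prod>s\<in>S. 1 / (1 + 2 * geom_var q s * (1 - cos (a * w s)))) \<le> \<kappa>" and "0 \<le> \<kappa>"
  shows "measure_pmf.prob (geo q (S \<times> UNIV)) {f. \<bar>wdiff S w f\<bar> \<le> e} \<le> 2 / J + 2 * \<kappa>"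
proof -
  define g where "g = (\<lambda>y. \<Sum>j<J. \<Sum>k<J. cos ((real j - real k) * (\<theta> * y)))"
  have g0: "0 \<le> g y" for y
    unfolding g_def trig_square_sum by simp
  have g1: "real J ^ 2 / 2 \<le> g y" if "\<bar>y\<bar> \<le> e" for y
  proof -
    have "(1/2) \<le> cos ((real j - real k) * (\<theta> * y))" if "j < J" "k < J" for j k :: nat
    proof (rule cos_bounds_near_zero)
      have "\<bar>(real j - real k) * (\<theta> * y)\<bar> = \<bar>real j - real k\<bar> * (\<theta> * \<bar>y\<bar>)"
        using th by (simp add: abs_mult)
      also have "\<dots> \<le> J * (\<theta> * e)"
        using th that \<open>\<bar>y\<bar> \<le> e\<close> by (intro mult_mono) auto
      finally show "\<bar>(real j - real k) * (\<theta> * y)\<bar> \<le> 1" using th by simp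
    qed
    then have "(\<Sum>j<J. \<Sum>k<J. 1/2) \<le> g y" unfolding g_def by (intro sum_mono) auto
    then show ?thesis by (simp add: power2_eq_square)
  qed
  have ic: "integrable (geo q (S \<times> UNIV)) (\<lambda>f. cos (a * wdiff S w f))" for a
    by (rule measure_pmf.integrable_const_bound[where B = 1]) auto
  have ig: "integrable (geo q (S \<times> UNIV)) (\<lambda>f. g (wdiff S w f))"
    unfolding g_def mult.assoc[symmetric] by (intro Bochner_Integration.integrable_sum ic)
  have "(real J ^ 2 / 2) * measure_pmf.prob (geo q (S \<times> UNIV)) {f. \<bar>wdiff S w f\<bar> \<le> e}
     = measure_pmf.expectation (geo q (S \<times> UNIV)) (\<lambda>f. (real J ^ 2 / 2) * indicator {f. \<bar>wdiff S w f\<bar> \<le> e} f)"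
    by simp
  also have "\<dots> \<le> measure_pmf.expectation (geo q (S \<times> UNIV)) (\<lambda>f. g (wdiff S w f))"
    by (intro integral_mono ig integrable_mult_right measure_pmf.integrable_const_bound[where B = 1])
       (use g0 g1 in \<open>auto simp: indicator_def\<close>)
  also have "\<dots> = (\<Sum>j<J. \<Sum>k<J. measure_pmf.expectation (geo q (S \<times> UNIV))
      (\<lambda>f. cos (((real j - real k) * \<theta>) * wdiff S w f)))"
    unfolding g_def mult.assoc[symmetric]
    by (simp add: Bochner_Integration.integral_sum Bochner_Integration.integrable_sum ic)
  \<comment> \<open>Diagonal terms equal 1. Off the diagonal the frequency has modulus between
    \<open>\<theta>\<close> and \<open>J * \<theta>\<close>, where \<open>\<kappa>\<close> bounds
    the characteristic function.\<close>
  also have "\<dots> \<le> (\<Sum>j<J. \<Sum>k<J. (if j = k then 1 else 0) + \<kappa>)"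
  proof (intro sum_mono)
    fix j k assume jk: "j \<in> {..<J}" "k \<in> {..<J}"
    show "measure_pmf.expectation (geo q (S \<times> UNIV))
      (\<lambda>f. cos (((real j - real k) * \<theta>) * wdiff S w f)) \<le> (if j = k then 1 else 0) + \<kappa>"
    proof (cases "j = k")
      case False
      then have "1 \<le> \<bar>real j - real k\<bar>" by linarith
      moreover have "\<bar>real j - real k\<bar> \<le> J" using jk by auto
      ultimately have "\<theta> \<le> \<bar>(real j - real k) * \<theta>\<bar>" "\<bar>(real j - real k) * \<theta>\<bar> \<le> J * \<theta>"
        using th by (auto simp: abs_mult mult_le_cancel_right1 intro!: mult_right_mono)
      then show ?thesis
        using \<kappa> False by (subst expectation_cos_wdiff[OF assms(1-4)]) auto
    qed (use \<open>0 \<le> \<kappa>\<close> in simp)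
  qed
  also have "\<dots> = J + J * J * \<kappa>"
    by (simp add: sum.distrib sum.delta' algebra_simps)
  finally have "measure_pmf.prob (geo q (S \<times> UNIV)) {f. \<bar>wdiff S w f\<bar> \<le> e} \<le> (J + J * J * \<kappa>) / (real J ^ 2 / 2)"
    using J by (subst pos_le_divide_eq) (auto simp: mult.commute)
  also have "\<dots> = 2 / J + 2 * \<kappa>"
    using J by (simp add: field_simps power2_eq_square)
  finally show ?thesis .
qed

text \<open>Exchanging the two partitions preserves the distribution but negates every
  \<open>wdiff\<close>; this symmetry is behind the factor 1/2 per block.\<close>

lemma geo_swap:
  assumes "finite S" "0 < q" "q < 1" "\<And>s. s \<in> S \<Longrightarrow> 1 \<le> s"
  shows "map_pmf (\<lambda>f i. f (fst i, \<not> snd i)) (geo q (S \<times> UNIV)) = geo q (S \<times> UNIV)"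
proof (rule pmf_eqI)
  fix f
  let ?h = "\<lambda>(f :: nat \<times> bool \<Rightarrow> nat) i. f (fst i, \<not> snd i)"
  have inj: "inj ?h"
  proof (rule injI)
    fix f g assume "?h f = ?h g"
    then have "?h (?h f) = ?h (?h g)" by (rule arg_cong)
    then show "f = g" by simp
  qed
  have "pmf (map_pmf ?h (geo q (S \<times> UNIV))) (?h (?h f)) = pmf (geo q (S \<times> UNIV)) (?h f)"
    by (rule pmf_map_inj'[OF inj])
  also have "\<dots> = pmf (geo q (S \<times> UNIV)) f"
  proof -
    have "(\<forall>i. i \<notin> S \<times> UNIV \<longrightarrow> f (fst i, \<not> snd i) = 0) \<longleftrightarrow> (\<forall>i. i \<notin> S \<times> UNIV \<longrightarrow> f i = 0)"
      by (simp add: split_paired_all all_bool_eq) blast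
    note supp = this
    have "finite (S \<times> (UNIV :: bool set))" using assms(1) by simp
    note pmf = pmf_Pi[OF this]
    have "pmf (geo q (S \<times> UNIV)) (?h f) = (if \<forall>i. i \<notin> S \<times> UNIV \<longrightarrow> f (fst i, \<not> snd i) = 0
        then \<Prod>i\<in>S \<times> UNIV. pmf (geometric_pmf (1 - q ^ fst i)) (f (fst i, \<not> snd i)) else 0)"
      unfolding geo_def pmf by (rule refl)
    also have "\<dots> = pmf (geo q (S \<times> UNIV)) f"
      unfolding geo_def pmf supp prod_times_bool[OF assms(1)] by (simp only: fst_conv snd_conv mult.commute not_True_eq_False not_False_eq_True)
    finally show ?thesis .
  qed
  finally show "pmf (map_pmf ?h (geo q (S \<times> UNIV))) f = pmf (geo q (S \<times> UNIV)) f" by simp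
qed

lemma wdiff_upper_half:
  assumes "finite S" "0 < q" "q < 1" "\<And>s. s \<in> S \<Longrightarrow> 1 \<le> s" "0 \<le> e"
  shows "measure_pmf.prob (geo q (S \<times> UNIV)) {f. wdiff S w f \<le> e} =
     1 / 2 + measure_pmf.prob (geo q (S \<times> UNIV)) {f. \<bar>wdiff S w f\<bar> \<le> e} / 2"
proof -
  let ?P = "measure_pmf.prob (geo q (S \<times> UNIV))"
  have "?P {f. wdiff S w f < - e} = measure_pmf.prob (map_pmf (\<lambda>f i. f (fst i, \<not> snd i)) (geo q (S \<times> UNIV))) {f. wdiff S w f < - e}"
    using geo_swap[OF assms(1-4)] by simp
  also have "\<dots> = ?P {f. e < wdiff S w f}"
  proof -
    have "wdiff S w (\<lambda>i. f (fst i, \<not> snd i)) = - wdiff S w f" for f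
      unfolding wdiff_def sum_negf[symmetric] by (intro sum.cong) (auto simp: algebra_simps)
    then show ?thesis by (simp add: vimage_def)
  qed
  finally have sym: "?P {f. wdiff S w f < - e} = ?P {f. e < wdiff S w f}" .
  have "?P {f. wdiff S w f \<le> e} = ?P ({f. wdiff S w f < - e} \<union> {f. \<bar>wdiff S w f\<bar> \<le> e})"
    using \<open>0 \<le> e\<close> by (intro arg_cong[where f = ?P]) auto
  also have "\<dots> = ?P {f. wdiff S w f < - e} + ?P {f. \<bar>wdiff S w f\<bar> \<le> e}"
    by (intro measure_pmf.finite_measure_Union) auto
  finally have 1: "?P {f. wdiff S w f \<le> e} = ?P {f. wdiff S w f < - e} + ?P {f. \<bar>wdiff S w f\<bar> \<le> e}" .
  have "UNIV - {f. wdiff S w f \<le> e} = {f. e < wdiff S w f}" by auto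
  then have "?P {f. e < wdiff S w f} = 1 - ?P {f. wdiff S w f \<le> e}"
    using measure_pmf.prob_compl[of "{f. wdiff S w f \<le> e}" "geo q (S \<times> UNIV)"] by simp
  with 1 sym show ?thesis by simp
qed

section \<open>Variances in terms of \<open>s * u\<close>, and one block\<close>

lemma geom_var_eq:
  assumes "0 < u" "1 \<le> s"
  shows "geom_var (exp (- u)) s = 1 / (exp (s * u) + inverse (exp (s * u)) - 2)"
proof -
  define y where "y = s * u"
  have x: "exp (- u) ^ s = exp (- y)" by (simp add: y_def exp_of_nat_mult[symmetric])
  have "geom_var (exp (- u)) s = 1 / ((1 - exp (- y))\<^sup>2 / exp (- y))"
    unfolding geom_var_def x by simp
  also have "(1 - exp (- y))\<^sup>2 / exp (- y) = exp y + inverse (exp y) - 2"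
    by (simp add: exp_minus field_simps power2_eq_square)
  finally show ?thesis by (simp add: y_def)
qed

lemma geom_var_bounds:
  assumes "0 < u" "1 \<le> s"
  shows "geom_var (exp (- u)) s \<le> 1 / (s * u)\<^sup>2"
    and "s * u \<le> 1 \<Longrightarrow> 1 / (2 * (s * u)\<^sup>2) \<le> geom_var (exp (- u)) s"
proof -
  define y where "y = s * u"
  have y: "0 < y" using assms by (simp add: y_def)
  have vr: "geom_var (exp (- u)) s = 1 / (exp y + inverse (exp y) - 2)"
    unfolding y_def by (rule geom_var_eq) fact+
  \<comment> \<open>The reciprocal variance is the square of \<open>2 * sinh (y / 2)\<close>, which
    is at least \<open>y\<close>.\<close>
  have sq: "exp y + inverse (exp y) - 2 = (exp (y / 2) - inverse (exp (y / 2)))\<^sup>2"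
  proof -
    have "exp y = exp (y / 2) * exp (y / 2)" by (simp flip: exp_add)
    then show ?thesis by (simp add: power2_eq_square algebra_simps)
  qed
  have "y \<le> exp (y / 2) - inverse (exp (y / 2))"
    using real_le_x_sinh[of "y / 2"] y by simp
  then have low: "y\<^sup>2 \<le> exp y + inverse (exp y) - 2"
    unfolding sq using y by (intro power_mono) auto
  have y2: "0 < y\<^sup>2" using y by simp
  have pos: "0 < exp y + inverse (exp y) - 2" using low y2 by linarith
  show "geom_var (exp (- u)) s \<le> 1 / (s * u)\<^sup>2"
    unfolding vr y_def[symmetric] by (intro divide_left_mono mult_pos_pos low pos y2) auto
  assume "s * u \<le> 1"
  then have "exp y + inverse (exp y) - 2 \<le> 2 * y\<^sup>2"
    using exp_sum_le(1)[of y] y by (simp add: y_def)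
  then show "1 / (2 * (s * u)\<^sup>2) \<le> geom_var (exp (- u)) s"
    unfolding vr y_def[symmetric] by (intro divide_left_mono mult_pos_pos pos) (use y2 in auto)
qed

text \<open>By symmetry a small ball bound suffices. For \<open>s \<le> t\<close> the variance is
  about \<open>1 / (s * u)\<^sup>2\<close> and \<open>1 - cos (a * s)\<close> is about
  \<open>(a * s)\<^sup>2\<close>, so \<open>s\<close> cancels: every size in \<open>{r<..t}\<close>
  damps the characteristic function by at least the same factor \<open>1 / (1 + v)\<close>.\<close>

lemma block_half:
  fixes u e :: real and r t R J :: nat
  assumes u: "0 < u" and r: "r < t" "t \<le> R" and tu: "t * u \<le> 1" and te: "t \<le> e" and J: "1 \<le> J"
  shows "measure_pmf.prob (geo (exp (- u)) ({r<..R} \<times> UNIV)) {f. wdiff {r<..R} (\<lambda>s. min s t) f \<le> e}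
     \<le> 1 / 2 + 1 / J + 4 * (u * J * e)\<^sup>2 / (real t - real r)"
proof -
  let ?q = "exp (- u)"
  have e: "0 < e" using te r by (metis gr_implies_not0 linorder_neqE_nat of_nat_0_less_iff order_less_le_trans)
  \<comment> \<open>The largest frequency \<open>J * \<theta>\<close> is \<open>1 / e\<close>; as
    \<open>t \<le> e\<close>, all phases \<open>a * s\<close> with \<open>s \<le> t\<close> have
    modulus at most 1.\<close>
  define \<theta> where "\<theta> = 1 / (J * e)"
  define \<kappa> where "\<kappa> = 4 * (u * J * e)\<^sup>2 / (real t - real r)"
  have th: "0 < \<theta>" "J * \<theta> * e \<le> 1" using e J by (auto simp: \<theta>_def)
  have vr: "0 \<le> geom_var ?q s" for s by (simp add: geom_var_def)
  have "measure_pmf.prob (geo ?q ({r<..R} \<times> UNIV)) {f. \<bar>wdiff {r<..R} (\<lambda>s. min s t) f\<bar> \<le> e} \<le> 2 / J + 2 * \<kappa>"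
  proof (rule small_ball[OF _ _ _ _ J th])
    show "0 \<le> \<kappa>" using r by (simp add: \<kappa>_def)
    fix a assume a: "\<theta> \<le> \<bar>a\<bar>" "\<bar>a\<bar> \<le> J * \<theta>"
    define v where "v = \<theta>\<^sup>2 / (4 * u\<^sup>2)"
    have v0: "0 < v" using th u by (simp add: v_def)
    let ?p = "\<lambda>s. 1 / (1 + 2 * geom_var ?q s * (1 - cos (a * real (min s t))))"
    have "0 \<le> 2 * geom_var ?q s * (1 - cos (a * real (min s t)))" for s
      using vr[of s] by (intro mult_nonneg_nonneg) auto
    then have le1: "?p s \<le> 1" "0 \<le> ?p s" for s
      by (smt (verit) divide_le_eq_1_pos, smt (verit) divide_nonneg_nonneg)
    have "(\<Prod>s\<in>{r<..R}. ?p s) = (\<Prod>s\<in>{r<..t}. ?p s) * (\<Prod>s\<in>{t<..R}. ?p s)"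
      using r by (subst prod.union_disjoint[symmetric]) (auto intro: arg_cong2[where f = prod])
    \<comment> \<open>The sizes above \<open>t\<close> are dropped.\<close>
    also have "\<dots> \<le> (\<Prod>s\<in>{r<..t}. ?p s) * 1"
      by (intro mult_left_mono prod_le_1 prod_nonneg ballI conjI le1)
    also have "(\<Prod>s\<in>{r<..t}. ?p s) \<le> (\<Prod>s\<in>{r<..t}. 1 / (1 + v))"
    proof (intro prod_mono conjI le1)
      fix s assume s: "s \<in> {r<..t}"
      have "s * u \<le> t * u" using s u by (intro mult_right_mono) auto
      then have vs: "1 / (2 * (s * u)\<^sup>2) \<le> geom_var ?q s" using s tu by (intro geom_var_bounds(2) u) auto
      have "\<bar>a * s\<bar> \<le> (J * \<theta>) * t"
        unfolding abs_mult using a s by (intro mult_mono) auto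
      also have "\<dots> \<le> 1" using te e J by (simp add: \<theta>_def field_simps)
      finally have "(a * s)\<^sup>2 / 4 \<le> 1 - cos (a * s)" by (rule cos_bounds_near_zero)
      moreover have "\<theta>\<^sup>2 * (real s)\<^sup>2 \<le> (a * s)\<^sup>2"
        using a th power_mono[of \<theta> "\<bar>a\<bar>" 2] by (simp add: power_mult_distrib mult_right_mono)
      ultimately have cs: "\<theta>\<^sup>2 * (real s)\<^sup>2 / 4 \<le> 1 - cos (a * s)" by simp
      have "v = 2 * (1 / (2 * (s * u)\<^sup>2) * (\<theta>\<^sup>2 * (real s)\<^sup>2 / 4))"
        using s u by (simp add: v_def field_simps power_mult_distrib)
      also have "\<dots> \<le> 2 * (geom_var ?q s * (1 - cos (a * s)))"
        using vs cs vr by (intro mult_left_mono mult_mono) auto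
      finally show "?p s \<le> 1 / (1 + v)" using s v0 by (intro divide_left_mono) (auto simp: mult_ac)
    qed
    also have "\<dots> = 1 / (1 + v) ^ (t - r)" by (simp add: power_divide)
    also have "\<dots> \<le> 1 / ((t - r) * v)"
    proof (intro divide_left_mono)
      have "1 + (t - r) * v \<le> (1 + v) ^ (t - r)" using v0 by (intro Bernoulli_inequality) simp
      then show "(t - r) * v \<le> (1 + v) ^ (t - r)" by simp
    qed (use v0 r in auto)
    also have "\<dots> = \<kappa>"
      using r e J u by (simp add: \<kappa>_def v_def \<theta>_def field_simps of_nat_diff power2_eq_square)
    finally show "(\<Prod>s\<in>{r<..R}. ?p s) \<le> \<kappa>" by simp
  qed (use u in auto)
  moreover have "measure_pmf.prob (geo ?q ({r<..R} \<times> UNIV)) {f. wdiff {r<..R} (\<lambda>s. min s t) f \<le> e} =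
    1 / 2 + measure_pmf.prob (geo ?q ({r<..R} \<times> UNIV)) {f. \<bar>wdiff {r<..R} (\<lambda>s. min s t) f\<bar> \<le> e} / 2"
    by (rule wdiff_upper_half) (use u e in auto)
  ultimately show ?thesis by (simp add: \<kappa>_def)
qed

section \<open>Tails of the sizes outside a block\<close>

lemma sum_inverse_squares_tail:
  "(\<Sum>s\<in>{R<..n}. 1 / (real s)\<^sup>2) \<le> 1 / R" if "1 \<le> R"
proof -
  \<comment> \<open>Telescoping sum; the maximum covers the empty range.\<close>
  have "(\<Sum>s\<in>{R<..n}. 1 / (real s)\<^sup>2) \<le> 1 / R - 1 / (max R n)"
  proof (induction n)
    case (Suc n)
    show ?case
    proof (cases "R \<le> n")
      case True
      then have "{R<..Suc n} = insert (Suc n) {R<..n}" by auto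
      then have "(\<Sum>s\<in>{R<..Suc n}. 1 / (real s)\<^sup>2) \<le> 1 / R - 1 / n + 1 / (real (Suc n))\<^sup>2"
        using Suc True by (simp add: max_def)
      also have "1 / (real (Suc n))\<^sup>2 \<le> 1 / n - 1 / Suc n"
      proof -
        have "1 / real n - 1 / Suc n = 1 / (real n * Suc n)" using True that by (simp add: field_simps)
        moreover have "real n * Suc n \<le> (real (Suc n))\<^sup>2" by (simp add: power2_eq_square)
        ultimately show ?thesis using True that by (simp add: frac_le)
      qed
      finally show ?thesis using True by (simp add: max_def)
    next
      case False
      then have "{R<..Suc n} = {}" by auto
      then show ?thesis using False that by (auto simp: max_def frac_le)
    qed
  qed (use that in \<open>simp add: max_def\<close>)
  also have "\<dots> \<le> 1 / R" by simp
  finally show ?thesis .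
qed

lemma wdiff_uminus: "wdiff S (\<lambda>s. - w s) f = - wdiff S w f"
  by (simp add: wdiff_def sum_negf)

text \<open>The weight \<open>s\<close> cancels the \<open>s\<close> in the variance, so each of the
  at most \<open>r\<close> sizes contributes at most \<open>1 / u\<^sup>2\<close>. The weights are
  negated to read a lower tail off \<open>wdiff_tail\<close>.\<close>

lemma low_tail:
  fixes u H :: real and r n :: nat
  assumes u: "0 < u" and H: "0 < H" "H \<le> r" and ur: "u * sqrt (r * H) \<le> 2"
  shows "measure_pmf.prob (geo (exp (- u)) ({1..n} \<times> UNIV))
    {f. wdiff {1..n} (\<lambda>s. if s \<le> r then s else 0) f \<le> - (4 * sqrt (r * H) / u)} \<le> exp (- H)"
proof -
  have r: "0 < real r" using H by linarith
  \<comment> \<open>For \<open>V = r / u\<^sup>2\<close> and \<open>y = 4 * sqrt (r * H) / u\<close>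
    this is \<open>y / (8 * V)\<close>, the minimiser of \<open>4 * l\<^sup>2 * V - l * y\<close>,
    with minimum \<open>- H\<close>.\<close>
  define l where "l = u * sqrt (H / r) / 2"
  define w where "w = (\<lambda>s. - real (if s \<le> r then s else 0))"
  have l2: "l\<^sup>2 = u\<^sup>2 * (H / r) / 4" using H r by (simp add: l_def power_mult_distrib power_divide)
  have sq: "sqrt (H / r) * sqrt (r * H) = H" using H r by (simp flip: real_sqrt_mult)
  have sr: "sqrt (H / r) * r = sqrt (r * H)"
  proof -
    have "sqrt (H / r) * r = sqrt (H / r * r\<^sup>2)" unfolding real_sqrt_mult using r by simp
    also have "H / r * r\<^sup>2 = r * H" using r by (simp add: power2_eq_square)
    finally show ?thesis .
  qed
  have vw: "geom_var (exp (- u)) s * (w s)\<^sup>2 \<le> (if s \<le> r then 1 / u\<^sup>2 else 0)" if "1 \<le> s" for s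
  proof -
    have "geom_var (exp (- u)) s * (real s)\<^sup>2 \<le> 1 / (s * u)\<^sup>2 * (real s)\<^sup>2"
      by (intro mult_right_mono geom_var_bounds u that) auto
    then show ?thesis using that u by (auto simp: w_def power_mult_distrib)
  qed
  have "measure_pmf.prob (geo (exp (- u)) ({1..n} \<times> UNIV)) {f. 4 * sqrt (r * H) / u \<le> wdiff {1..n} w f}
     \<le> exp (4 * l\<^sup>2 * (r / u\<^sup>2) - l * (4 * sqrt (r * H) / u))"
  proof (rule wdiff_tail)
    show "0 < l" using u H r by (simp add: l_def)
    fix s assume s: "s \<in> {1..n}"
    have "\<bar>l * w s\<bar> \<le> l * r" unfolding abs_mult using \<open>0 < l\<close>
      by (intro mult_mono) (auto simp: w_def)
    also have "\<dots> = u * sqrt (r * H) / 2" using sr by (simp add: l_def)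
    finally show "\<bar>l * w s\<bar> \<le> 1" using ur by simp
    have "geom_var (exp (- u)) s * (l * w s)\<^sup>2 = l\<^sup>2 * (geom_var (exp (- u)) s * (w s)\<^sup>2)"
      by (simp add: power_mult_distrib)
    also have "\<dots> \<le> l\<^sup>2 * (1 / u\<^sup>2)"
      using vw[of s] s u by (intro mult_left_mono order_trans[OF vw]) auto
    also have "\<dots> \<le> 1 / 4" using u H r by (simp add: l2 field_simps)
    finally show "geom_var (exp (- u)) s * (l * w s)\<^sup>2 \<le> 1 / 4" .
  next
    have "(\<Sum>s\<in>{1..n}. geom_var (exp (- u)) s * (w s)\<^sup>2) \<le> (\<Sum>s\<in>{1..n}. if s \<le> r then 1 / u\<^sup>2 else 0)"
      by (intro sum_mono vw) auto
    also have "\<dots> = card ({1..n} \<inter> {s. s \<le> r}) * (1 / u\<^sup>2)"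
      by (simp add: sum.If_cases)
    also have "\<dots> \<le> r * (1 / u\<^sup>2)"
    proof (intro mult_right_mono)
      have "card ({1..n} \<inter> {s. s \<le> r}) \<le> card {1..r}" by (intro card_mono) auto
      then show "real (card ({1..n} \<inter> {s. s \<le> r})) \<le> real r" by simp
    qed simp
    finally show "(\<Sum>s\<in>{1..n}. geom_var (exp (- u)) s * (w s)\<^sup>2) \<le> r / u\<^sup>2" by simp
  qed (use u in auto)
  also have "4 * l\<^sup>2 * (r / u\<^sup>2) - l * (4 * sqrt (r * H) / u) = - H"
  proof -
    have "l * (4 * sqrt (r * H) / u) = 2 * H" using sq u by (simp add: l_def mult.commute)
    moreover have "4 * l\<^sup>2 * (r / u\<^sup>2) = H" using u r by (simp add: l2)
    ultimately show ?thesis by simp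
  qed
  also have "{f. 4 * sqrt (r * H) / u \<le> wdiff {1..n} w f} =
     {f. wdiff {1..n} (\<lambda>s. if s \<le> r then s else 0) f \<le> - (4 * sqrt (r * H) / u)}"
    unfolding w_def wdiff_uminus by auto
  finally show ?thesis .
qed

text \<open>Here the weight is 1, and the variances, at most \<open>1 / (s * u)\<^sup>2\<close>, sum
  to at most \<open>1 / (u\<^sup>2 * R)\<close> above \<open>R\<close>; \<open>l\<close> is again
  the minimiser.\<close>

lemma high_tail:
  fixes u H :: real and R n :: nat
  assumes u: "0 < u" and H: "0 < H" "H \<le> R" and uR: "u * sqrt (R * H) \<le> 2"
  shows "measure_pmf.prob (geo (exp (- u)) ({1..n} \<times> UNIV))
    {f. wdiff {1..n} (\<lambda>s. if R < s then 1 else 0) f \<le> - (4 * sqrt (H / R) / u)} \<le> exp (- H)"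
proof -
  have R: "0 < real R" using H by linarith
  define l where "l = u * sqrt (R * H) / 2"
  define w where "w = (\<lambda>s. - (if R < s then 1 else 0 :: real))"
  have l2: "l\<^sup>2 = u\<^sup>2 * (R * H) / 4" using H R by (simp add: l_def power_mult_distrib power_divide)
  have sq: "sqrt (R * H) * sqrt (H / R) = H" using H R by (simp flip: real_sqrt_mult)
  have vw: "geom_var (exp (- u)) s * (w s)\<^sup>2 \<le> (if R < s then 1 / u\<^sup>2 * (1 / (real s)\<^sup>2) else 0)" if "1 \<le> s" for s
    using geom_var_bounds(1)[OF u that] that u by (auto simp: w_def power_mult_distrib mult.commute)
  have "measure_pmf.prob (geo (exp (- u)) ({1..n} \<times> UNIV)) {f. 4 * sqrt (H / R) / u \<le> wdiff {1..n} w f}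
     \<le> exp (4 * l\<^sup>2 * (1 / u\<^sup>2 * (1 / R)) - l * (4 * sqrt (H / R) / u))"
  proof (rule wdiff_tail)
    show "0 < l" using u H R by (simp add: l_def)
    fix s assume s: "s \<in> {1..n}"
    show "\<bar>l * w s\<bar> \<le> 1" using uR \<open>0 < l\<close> by (simp add: w_def l_def)
    have "geom_var (exp (- u)) s * (l * w s)\<^sup>2 = l\<^sup>2 * (geom_var (exp (- u)) s * (w s)\<^sup>2)"
      by (simp add: power_mult_distrib)
    also have "\<dots> \<le> l\<^sup>2 * (1 / u\<^sup>2 * (1 / (real R)\<^sup>2))"
    proof (intro mult_left_mono)
      show "geom_var (exp (- u)) s * (w s)\<^sup>2 \<le> 1 / u\<^sup>2 * (1 / (real R)\<^sup>2)"
      proof (cases "R < s")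
        case True
        then have "geom_var (exp (- u)) s * (w s)\<^sup>2 \<le> 1 / u\<^sup>2 * (1 / (real s)\<^sup>2)" using vw[of s] s by auto
        also have "\<dots> \<le> 1 / u\<^sup>2 * (1 / (real R)\<^sup>2)"
          using True R u by (intro mult_left_mono divide_left_mono power_mono) auto
        finally show ?thesis .
      qed (simp add: w_def)
    qed simp
    also have "\<dots> \<le> 1 / 4" unfolding l2 using u H R by (simp add: field_simps power2_eq_square)
    finally show "geom_var (exp (- u)) s * (l * w s)\<^sup>2 \<le> 1 / 4" .
  next
    have "(\<Sum>s\<in>{1..n}. geom_var (exp (- u)) s * (w s)\<^sup>2) \<le>
        (\<Sum>s\<in>{1..n}. if R < s then 1 / u\<^sup>2 * (1 / (real s)\<^sup>2) else 0)"
      by (intro sum_mono vw) auto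
    also have "\<dots> = 1 / u\<^sup>2 * (\<Sum>s\<in>{1..n} \<inter> {s. R < s}. 1 / (real s)\<^sup>2)"
      by (simp add: sum.If_cases sum_distrib_left)
    also have "{1..n} \<inter> {s. R < s} = {R<..n}" by auto
    also have "1 / u\<^sup>2 * (\<Sum>s\<in>{R<..n}. 1 / (real s)\<^sup>2) \<le> 1 / u\<^sup>2 * (1 / R)"
      using R by (intro mult_left_mono sum_inverse_squares_tail) auto
    finally show "(\<Sum>s\<in>{1..n}. geom_var (exp (- u)) s * (w s)\<^sup>2) \<le> 1 / u\<^sup>2 * (1 / R)" .
  qed (use u in auto)
  also have "4 * l\<^sup>2 * (1 / u\<^sup>2 * (1 / R)) - l * (4 * sqrt (H / R) / u) = - H"
  proof -
    have "l * (4 * sqrt (H / R) / u) = 2 * H" using sq u by (simp add: l_def mult.commute)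
    moreover have "4 * l\<^sup>2 * (1 / u\<^sup>2 * (1 / R)) = H" using u R by (simp add: l2)
    ultimately show ?thesis by simp
  qed
  also have "{f. 4 * sqrt (H / R) / u \<le> wdiff {1..n} w f} =
     {f. wdiff {1..n} (\<lambda>s. if R < s then 1 else 0) f \<le> - (4 * sqrt (H / R) / u)}"
    unfolding w_def wdiff_uminus by auto
  finally show ?thesis .
qed

section \<open>Independence of blocks\<close>

text \<open>Fubini: with the coordinates in \<open>A\<close> frozen, \<open>P\<close> is decided and
  \<open>R\<close> has conditional probability at most \<open>c\<close>. Letting \<open>R\<close>
  depend on \<open>A\<close> too is what admits the weight constraints.\<close>

lemma geo_union_bound:
  assumes "finite A" "finite B" "A \<inter> B = {}" "0 \<le> c"
    and P: "\<And>f g. (\<And>i. i \<in> A \<Longrightarrow> f i = g i) \<Longrightarrow> P f \<longleftrightarrow> P g"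
    and R: "\<And>g. measure_pmf.prob (geo q B) {h. R (\<lambda>i. if i \<in> A then g i else h i)} \<le> c"
  shows "measure_pmf.prob (geo q (A \<union> B)) {f. P f \<and> R f} \<le> measure_pmf.prob (geo q A) {f. P f} * c"
proof -
  let ?m = "\<lambda>(f, g) x. if x \<in> A then f x else g x"
  have P': "P (\<lambda>i. if i \<in> A then f i else g i) \<longleftrightarrow> P f" for f g
    by (rule P) simp
  have "emeasure (geo q (A \<union> B)) {f. P f \<and> R f} =
      emeasure (pair_pmf (geo q A) (geo q B)) (?m -` {f. P f \<and> R f})"
    unfolding geo_def Pi_pmf_union[OF assms(1-3)] by simp
  also have "\<dots> = (\<integral>\<^sup>+z. indicator (?m -` {f. P f \<and> R f}) z \<partial>pair_pmf (geo q A) (geo q B))"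
    by (rule nn_integral_indicator[symmetric]) simp
  also have "\<dots> = (\<integral>\<^sup>+x. \<integral>\<^sup>+y. indicator (?m -` {f. P f \<and> R f}) (x, y) \<partial>geo q B \<partial>geo q A)"
    by (rule nn_integral_pair_pmf')
  also have "\<dots> = (\<integral>\<^sup>+x. indicator {f. P f} x *
      emeasure (geo q B) {h. R (\<lambda>i. if i \<in> A then x i else h i)} \<partial>geo q A)"
  proof (intro nn_integral_cong)
    fix x
    have "(\<integral>\<^sup>+y. indicator (?m -` {f. P f \<and> R f}) (x, y) \<partial>geo q B) =
      (\<integral>\<^sup>+y. indicator {f. P f} x * indicator {h. R (\<lambda>i. if i \<in> A then x i else h i)} y \<partial>geo q B)"
      by (intro nn_integral_cong) (auto simp: indicator_def P')
    also have "\<dots> = indicator {f. P f} x * emeasure (geo q B) {h. R (\<lambda>i. if i \<in> A then x i else h i)}"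
      by (subst nn_integral_cmult) auto
    finally show "(\<integral>\<^sup>+y. indicator (?m -` {f. P f \<and> R f}) (x, y) \<partial>geo q B) =
      indicator {f. P f} x * emeasure (geo q B) {h. R (\<lambda>i. if i \<in> A then x i else h i)}" .
  qed
  also have "\<dots> \<le> (\<integral>\<^sup>+x. indicator {f. P f} x * ennreal c \<partial>geo q A)"
    using R by (intro nn_integral_mono mult_left_mono) (auto simp: measure_pmf.emeasure_eq_measure ennreal_leI)
  also have "\<dots> = emeasure (geo q A) {f. P f} * ennreal c"
    by (subst nn_integral_multc) auto
  also have "\<dots> = ennreal (measure_pmf.prob (geo q A) {f. P f} * c)"
    using \<open>0 \<le> c\<close> by (simp add: measure_pmf.emeasure_eq_measure ennreal_mult)
  finally show ?thesis
    using \<open>0 \<le> c\<close> by (simp add: measure_pmf.emeasure_eq_measure ennreal_le_iff)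
qed

lemma weight_cong: "(\<And>i. i \<in> A \<Longrightarrow> f i = g i) \<Longrightarrow> weight A f = weight A g"
  by (simp add: weight_def cong: sum.cong)

lemma wdiff_cong:
  "(\<And>s b. s \<in> S \<Longrightarrow> f (s, b) = g (s, b)) \<Longrightarrow> wdiff S w f = wdiff S w g"
  by (simp add: wdiff_def cong: sum.cong)

lemma prob_two_weights:
  assumes "finite F" "\<And>b N. wprob q (F \<times> {b}) N \<le> c"
  shows "measure_pmf.prob (geo q (F \<times> UNIV)) {f. weight (F \<times> {True}) f = x \<and> weight (F \<times> {False}) f = y} \<le> c\<^sup>2"
proof -
  have c: "0 \<le> c" using assms(2) wprob_nonneg order_trans by blast
  have U: "F \<times> UNIV = F \<times> {True} \<union> F \<times> {False}" by auto
  have "measure_pmf.prob (geo q (F \<times> {True} \<union> F \<times> {False}))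
      {f. weight (F \<times> {True}) f = x \<and> weight (F \<times> {False}) f = y}
    \<le> measure_pmf.prob (geo q (F \<times> {True})) {f. weight (F \<times> {True}) f = x} * c"
  proof (rule geo_union_bound)
    fix g
    have "weight (F \<times> {False}) (\<lambda>i. if i \<in> F \<times> {True} then g i else h i) = weight (F \<times> {False}) h" for h
      by (rule weight_cong) auto
    then show "measure_pmf.prob (geo q (F \<times> {False}))
        {h. weight (F \<times> {False}) (\<lambda>i. if i \<in> F \<times> {True} then g i else h i) = y} \<le> c"
      using assms(2)[of False y] by (simp add: wprob_def)
  next
    fix f g :: "nat \<times> bool \<Rightarrow> nat" assume "\<And>i. i \<in> F \<times> {True} \<Longrightarrow> f i = g i"
    then show "(weight (F \<times> {True}) f = x) = (weight (F \<times> {True}) g = x)"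
      using weight_cong by metis
  qed (use assms(1) c in auto)
  also have "\<dots> \<le> c * c"
    using assms(2)[of True x] c by (intro mult_right_mono) (auto simp: wprob_def)
  finally show ?thesis by (simp add: U power2_eq_square)
qed

lemma prob_blocks:
  fixes r :: "nat \<Rightarrow> nat" and w :: "nat \<Rightarrow> nat \<Rightarrow> real" and e :: "nat \<Rightarrow> real"
  assumes "mono r" "0 \<le> c"
    and c: "\<And>m. m < M \<Longrightarrow> measure_pmf.prob (geo q ({r m<..r (Suc m)} \<times> UNIV))
      {f. wdiff {r m<..r (Suc m)} (w m) f \<le> e m} \<le> c"
  shows "measure_pmf.prob (geo q ({r 0<..r M} \<times> UNIV))
     {f. \<forall>m<M. wdiff {r m<..r (Suc m)} (w m) f \<le> e m} \<le> c ^ M"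
  using c
proof (induction M)
  case (Suc M)
  have le: "r 0 \<le> r M" "r M \<le> r (Suc M)" by (auto intro!: monoD[OF assms(1)])
  have U: "{r 0<..r (Suc M)} \<times> UNIV = {r 0<..r M} \<times> (UNIV :: bool set) \<union> {r M<..r (Suc M)} \<times> UNIV"
    using le by auto
  have "measure_pmf.prob (geo q ({r 0<..r M} \<times> (UNIV :: bool set) \<union> {r M<..r (Suc M)} \<times> UNIV))
     {f. (\<forall>m<M. wdiff {r m<..r (Suc m)} (w m) f \<le> e m) \<and> wdiff {r M<..r (Suc M)} (w M) f \<le> e M}
    \<le> measure_pmf.prob (geo q ({r 0<..r M} \<times> UNIV))
     {f. \<forall>m<M. wdiff {r m<..r (Suc m)} (w m) f \<le> e m} * c"
  proof (rule geo_union_bound)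
    fix f g :: "nat \<times> bool \<Rightarrow> nat" assume fg: "\<And>i. i \<in> {r 0<..r M} \<times> UNIV \<Longrightarrow> f i = g i"
    have "wdiff {r m<..r (Suc m)} (w m) f = wdiff {r m<..r (Suc m)} (w m) g" if "m < M" for m
    proof (rule wdiff_cong)
      fix s b assume "s \<in> {r m<..r (Suc m)}"
      moreover have "r 0 \<le> r m" "r (Suc m) \<le> r M" using that by (auto intro!: monoD[OF assms(1)])
      ultimately show "f (s, b) = g (s, b)" by (intro fg) auto
    qed
    then show "(\<forall>m<M. wdiff {r m<..r (Suc m)} (w m) f \<le> e m) \<longleftrightarrow>
        (\<forall>m<M. wdiff {r m<..r (Suc m)} (w m) g \<le> e m)" by simp
  next
    fix g :: "nat \<times> bool \<Rightarrow> nat"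
    have "wdiff {r M<..r (Suc M)} (w M) (\<lambda>i. if i \<in> {r 0<..r M} \<times> UNIV then g i else h i) =
        wdiff {r M<..r (Suc M)} (w M) h" for h
      by (rule wdiff_cong) auto
    then show "measure_pmf.prob (geo q ({r M<..r (Suc M)} \<times> UNIV))
        {h. wdiff {r M<..r (Suc M)} (w M) (\<lambda>i. if i \<in> {r 0<..r M} \<times> UNIV then g i else h i) \<le> e M} \<le> c"
      using Suc.prems[of M] by simp
  qed (use \<open>0 \<le> c\<close> in auto)
  also have "\<dots> \<le> c ^ M * c"
    using Suc \<open>0 \<le> c\<close> by (intro mult_right_mono) auto
  also have "{f. (\<forall>m<M. wdiff {r m<..r (Suc m)} (w m) f \<le> e m) \<and> wdiff {r M<..r (Suc M)} (w M) f \<le> e M} =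
      {f. \<forall>m<Suc M. wdiff {r m<..r (Suc m)} (w m) f \<le> e m}"
    by (auto simp: less_Suc_eq)
  finally show ?case unfolding U power_Suc2 .
qed simp

text \<open>The block event and the weights are dependent. Once the block coordinates are fixed,
  however, the remaining sizes must hit prescribed totals. These vary with the block, which is why
  \<open>c\<close> has to bound \<open>wprob\<close> at every \<open>N\<close>.\<close>

lemma prob_blocks_and_weights:
  assumes "K \<subseteq> {1..n}"
    and P: "\<And>f g. (\<And>i. i \<in> K \<times> UNIV \<Longrightarrow> f i = g i) \<Longrightarrow> P f \<longleftrightarrow> P g"
    and c: "\<And>b N. wprob q (({1..n} - K) \<times> {b}) N \<le> c"
  shows "measure_pmf.prob (geo q ({1..n} \<times> UNIV))
      {f. P f \<and> weight ({1..n} \<times> {True}) f = n \<and> weight ({1..n} \<times> {False}) f = n}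
    \<le> measure_pmf.prob (geo q (K \<times> UNIV)) {f. P f} * c\<^sup>2"
proof -
  define F where "F = {1..n} - K"
  have fin: "finite K" using assms(1) finite_subset by blast
  have U: "{1..n} \<times> UNIV = K \<times> (UNIV :: bool set) \<union> F \<times> UNIV"
    using assms(1) by (auto simp: F_def)
  show ?thesis unfolding U
  proof (rule geo_union_bound)
    fix g :: "nat \<times> bool \<Rightarrow> nat"
    define k where "k = (\<lambda>b. weight (K \<times> {b}) g)"
    have w: "weight ({1..n} \<times> {b}) (\<lambda>i. if i \<in> K \<times> UNIV then g i else h i) =
        k b + weight (F \<times> {b}) h" for b h
    proof -
      have "{1..n} \<times> {b} = K \<times> {b} \<union> F \<times> {b}" using assms(1) by (auto simp: F_def)
      then have "weight ({1..n} \<times> {b}) f = weight (K \<times> {b}) f + weight (F \<times> {b}) f" for f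
        unfolding weight_def using fin by (subst sum.union_disjoint[symmetric]) (auto simp: F_def)
      moreover have "weight (K \<times> {b}) (\<lambda>i. if i \<in> K \<times> UNIV then g i else h i) = k b"
        unfolding k_def by (rule weight_cong) auto
      moreover have "weight (F \<times> {b}) (\<lambda>i. if i \<in> K \<times> UNIV then g i else h i) = weight (F \<times> {b}) h"
        by (rule weight_cong) (auto simp: F_def)
      ultimately show ?thesis by simp
    qed
    \<comment> \<open>If some \<open>k b\<close> exceeds \<open>n\<close>, the left event is empty,
      so truncated subtraction does no harm to the inclusion.\<close>
    have "measure_pmf.prob (geo q (F \<times> UNIV))
        {h. weight ({1..n} \<times> {True}) (\<lambda>i. if i \<in> K \<times> UNIV then g i else h i) = n \<and>
            weight ({1..n} \<times> {False}) (\<lambda>i. if i \<in> K \<times> UNIV then g i else h i) = n}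
      \<le> measure_pmf.prob (geo q (F \<times> UNIV))
        {h. weight (F \<times> {True}) h = n - k True \<and> weight (F \<times> {False}) h = n - k False}"
      unfolding w by (intro measure_pmf.finite_measure_mono) auto
    also have "\<dots> \<le> c\<^sup>2"
      using prob_two_weights[of F q c] c by (simp add: F_def)
    finally show "measure_pmf.prob (geo q (F \<times> UNIV))
        {h. weight ({1..n} \<times> {True}) (\<lambda>i. if i \<in> K \<times> UNIV then g i else h i) = n \<and>
            weight ({1..n} \<times> {False}) (\<lambda>i. if i \<in> K \<times> UNIV then g i else h i) = n} \<le> c\<^sup>2" .
  next
    fix f g :: "nat \<times> bool \<Rightarrow> nat" assume "\<And>i. i \<in> K \<times> UNIV \<Longrightarrow> f i = g i"
    then show "P f \<longleftrightarrow> P g" by (rule P)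
  qed (use fin in \<open>auto simp: F_def\<close>)
qed

section \<open>Dominance in terms of multiplicities\<close>

lemma sum_part_eq: "(\<Sum>j=1..i. part xs j) = sum_list (take i xs)"
proof (induction i)
  case (Suc i)
  have "part xs (Suc i) = sum_list (drop i (take (Suc i) xs))"
    by (cases "i < length xs") (auto simp: part_def take_Suc_conv_app_nth)
  then show ?case
    using Suc by (cases "i < length xs") (auto simp: part_def take_Suc_conv_app_nth)
qed simp

text \<open>Bound the minimum by \<open>t\<close> on the first \<open>i\<close> parts and by the
  part itself on the others.\<close>

lemma sum_list_min_take_drop:
  fixes xs :: "nat list"
  shows "(\<Sum>x\<leftarrow>xs. min x t) + sum_list (take i xs) \<le> i * t + sum_list xs"
proof -
  have 1: "(\<Sum>x\<leftarrow>take i xs. min x t) \<le> i * t"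
  proof -
    have "(\<Sum>x\<leftarrow>take i xs. min x t) \<le> (\<Sum>x\<leftarrow>take i xs. t)" by (intro sum_list_mono) auto
    also have "\<dots> = length (take i xs) * t" by (simp add: sum_list_triv)
    also have "\<dots> \<le> i * t" by (intro mult_right_mono) auto
    finally show ?thesis .
  qed
  have 2: "(\<Sum>x\<leftarrow>drop i xs. min x t) \<le> sum_list (drop i xs)"
    using sum_list_mono[of "drop i xs" "\<lambda>x. min x t" "\<lambda>x. x"] by simp
  have "(\<Sum>x\<leftarrow>xs. min x t) = (\<Sum>x\<leftarrow>take i xs. min x t) + (\<Sum>x\<leftarrow>drop i xs. min x t)"
    by (simp flip: sum_list_append map_append)
  moreover have "sum_list xs = sum_list (take i xs) + sum_list (drop i xs)"
    by (simp flip: sum_list_append)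
  ultimately show ?thesis using 1 2 by linarith
qed

text \<open>If \<open>i\<close> is the number of parts of \<open>ys\<close> above \<open>t\<close>,
  then \<open>sum_list_min_take_drop\<close> is an equality for \<open>ys\<close>. For
  \<open>xs\<close> it is an inequality, and the \<open>i\<close>-th dominance condition compares
  the two.\<close>

lemma dominates_min:
  assumes "xs \<in> partitions n" "ys \<in> partitions n" "xs \<succeq> ys"
  shows "(\<Sum>x\<leftarrow>xs. min x t) \<le> (\<Sum>y\<leftarrow>ys. min y t)"
proof -
  define a b where "a = takeWhile (\<lambda>y. t < y) ys" and "b = dropWhile (\<lambda>y. t < y) ys"
  define i where "i = length a"
  have ys: "ys = a @ b" by (simp add: a_def b_def)
  have srt: "sorted_wrt (\<ge>) ys" using assms by (simp add: partitions_def)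
  have a: "\<forall>y\<in>set a. t < y" unfolding a_def using set_takeWhileD by fastforce
  have b: "\<forall>y\<in>set b. y \<le> t"
  proof (cases b)
    case (Cons y zs)
    then have "\<not> t < y" unfolding b_def by (metis dropWhile_eq_Cons_conv)
    then show ?thesis using srt unfolding ys Cons by (auto simp: sorted_wrt_append)
  qed simp
  have "(\<Sum>y\<leftarrow>a. min y t) = (\<Sum>y\<leftarrow>a. t)" using a by (intro arg_cong[where f = sum_list] map_cong) auto
  then have A: "(\<Sum>y\<leftarrow>a. min y t) = i * t" by (simp add: sum_list_triv i_def)
  have "(\<Sum>y\<leftarrow>b. min y t) = (\<Sum>y\<leftarrow>b. y)" using b by (intro arg_cong[where f = sum_list] map_cong) auto
  then have B: "(\<Sum>y\<leftarrow>ys. min y t) + sum_list (take i ys) = i * t + sum_list ys"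
    using A by (simp add: ys i_def)
  \<comment> \<open>Dominance is only stated from 1 on; for \<open>i = 0\<close> both sums are
    empty.\<close>
  have "sum_list (take i ys) \<le> sum_list (take i xs)"
    using assms(3) unfolding dominates_def sum_part_eq by (cases "i = 0") auto
  then show ?thesis
    using B sum_list_min_take_drop[where xs = xs and t = t and i = i] assms by (simp add: partitions_def)
qed

definition enc :: "nat list \<times> nat list \<Rightarrow> nat \<times> bool \<Rightarrow> nat" where
  "enc p i = count_list (if snd i then fst p else snd p) (fst i)"

lemma partition_parts:
  assumes "xs \<in> partitions n"
  shows "set xs \<subseteq> {1..n}"
  using assms member_le_sum_list unfolding partitions_def by fastforce

lemma enc_weight:
  assumes "xs \<in> partitions n" "ys \<in> partitions n"
  shows "weight ({1..n} \<times> {b}) (enc (xs, ys)) = n"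
proof -
  let ?zs = "if b then xs else ys"
  have z: "?zs \<in> partitions n" using assms by simp
  have "weight ({1..n} \<times> {b}) (enc (xs, ys)) = (\<Sum>i\<in>{1..n} \<times> {b}. fst i * count_list ?zs (fst i))"
    unfolding weight_def by (intro sum.cong) (auto simp: enc_def)
  also have "\<dots> = (\<Sum>s\<in>{1..n}. s * count_list ?zs s)"
    by (rule sum_times_singleton)
  also have "\<dots> = sum_list ?zs"
    using sum_list_map_eq_sum_count2[OF partition_parts[OF z] finite_atLeastAtMost, of "\<lambda>s. s"] by (simp add: mult.commute)
  also have "\<dots> = n" using z by (simp add: partitions_def)
  finally show ?thesis .
qed

lemma enc_wdiff:
  assumes "xs \<in> partitions n" "ys \<in> partitions n" "xs \<succeq> ys"
  shows "wdiff {1..n} (\<lambda>s. min s t) (enc (xs, ys)) \<le> 0"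
proof -
  have *: "real (\<Sum>x\<leftarrow>zs. min x t) = (\<Sum>s\<in>{1..n}. real (min s t) * count_list zs s)"
    if "zs \<in> partitions n" for zs
    using sum_list_map_eq_sum_count2[OF partition_parts[OF that] finite_atLeastAtMost, of "\<lambda>s. min s t"]
    by (simp add: mult.commute)
  have "wdiff {1..n} (\<lambda>s. min s t) (enc (xs, ys)) = real (\<Sum>x\<leftarrow>xs. min x t) - real (\<Sum>x\<leftarrow>ys. min x t)"
    unfolding *[OF assms(1)] *[OF assms(2)] wdiff_def by (simp add: enc_def right_diff_distrib sum_subtractf)
  then show ?thesis using dominates_min[OF assms, of t] by linarith
qed

lemma partition_eqI:
  assumes "xs \<in> partitions n" "ys \<in> partitions n" "\<And>s. count_list xs s = count_list ys s"
  shows "xs = ys"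
proof -
  have "mset (rev xs) = mset (rev ys)"
    using assms(3) by (intro multiset_eqI) (simp add: count_mset)
  moreover have "sorted (rev xs)" "sorted (rev ys)"
    using assms(1,2) by (auto simp: partitions_def sorted_wrt_rev)
  ultimately have "rev xs = rev ys" by (metis properties_for_sort)
  then show ?thesis by simp
qed

lemma enc_inj: "inj_on enc (partitions n \<times> partitions n)"
proof (rule inj_onI, clarify)
  fix a b c d assume m: "a \<in> partitions n" "b \<in> partitions n" "c \<in> partitions n" "d \<in> partitions n"
    and e: "enc (a, b) = enc (c, d)"
  have "count_list a s = count_list c s" "count_list b s = count_list d s" for s
    using fun_cong[OF e, of "(s, True)"] fun_cong[OF e, of "(s, False)"] by (auto simp: enc_def)
  then show "a = c \<and> b = d" using m partition_eqI by blast
qed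

lemma enc_level:
  assumes "xs \<in> partitions n" "ys \<in> partitions n"
  shows "enc (xs, ys) \<in> level ({1..n} \<times> UNIV) (2 * n)"
proof -
  have "enc (xs, ys) i = 0" if "i \<notin> {1..n} \<times> UNIV" for i
    using partition_parts[OF assms(1)] partition_parts[OF assms(2)] that
    by (cases i) (auto simp: enc_def count_list_0_iff)
  moreover have "weight ({1..n} \<times> UNIV) (enc (xs, ys)) = 2 * n"
  proof -
    have U: "{1..n} \<times> UNIV = {1..n} \<times> {True} \<union> {1..n} \<times> {False}" by auto
    have "weight ({1..n} \<times> UNIV) (enc (xs, ys)) =
        weight ({1..n} \<times> {True}) (enc (xs, ys)) + weight ({1..n} \<times> {False}) (enc (xs, ys))"
      unfolding weight_def U by (subst sum.union_disjoint) auto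
    then show ?thesis unfolding enc_weight[OF assms] by simp
  qed
  ultimately show ?thesis by (simp add: level_def)
qed

text \<open>Every configuration is the multiplicity function of the decreasing list built from it.
  One inequality suffices, because it is used to bound \<open>wprob\<close> from above.\<close>

lemma card_level_le:
  "card (level ({1..n} \<times> {b}) n) \<le> card (partitions n)"
proof -
  let ?g = "\<lambda>xs i. if snd i = b then count_list xs (fst i) else 0"
  have "level ({1..n} \<times> {b}) n \<subseteq> ?g ` partitions n"
  proof
    fix f assume f: "f \<in> level ({1..n} \<times> {b}) n"
    define M where "M = (\<Sum>s\<in>{1..n}. replicate_mset (f (s, b)) s)"
    define xs where "xs = rev (sorted_list_of_multiset M)"
    have cM: "count M s = f (s, b)" for s
    proof -
      have "count M s = (\<Sum>r\<in>{1..n}. if r = s then f (r, b) else 0)"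
        unfolding M_def count_sum by (intro sum.cong) auto
      also have "\<dots> = f (s, b)" using f by (auto simp: level_def)
      finally show ?thesis .
    qed
    have mx: "mset xs = M" by (simp add: xs_def)
    have cnt: "count_list xs s = f (s, b)" for s using cM mx by (metis count_mset)
    have zero: "f i = 0" if "i \<notin> {1..n} \<times> {b}" for i using f that unfolding level_def by blast
    have sub: "set xs \<subseteq> {1..n}"
    proof
      fix s assume "s \<in> set xs"
      then have "f (s, b) \<noteq> 0" using cnt[of s] count_list_0_iff[of xs s] by auto
      then show "s \<in> {1..n}" using zero[of "(s, b)"] by auto
    qed
    have "sum_list xs = (\<Sum>s\<in>{1..n}. s * f (s, b))"
      using sum_list_map_eq_sum_count2[OF sub finite_atLeastAtMost, of "\<lambda>s. s"] cnt by (simp add: mult.commute)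
    also have "\<dots> = weight ({1..n} \<times> {b}) f"
      unfolding weight_def by (rule sum.reindex_bij_witness[of _ fst "\<lambda>s. (s, b)"]) auto
    also have "\<dots> = n" using f by (simp add: level_def)
    finally have "xs \<in> partitions n"
      using sub unfolding partitions_def by (auto simp: xs_def sorted_wrt_rev)
    moreover have "f = ?g xs"
    proof
      fix i show "f i = ?g xs i" using zero[of i] by (cases i) (auto simp: cnt)
    qed
    ultimately show "f \<in> ?g ` partitions n" by blast
  qed
  then show ?thesis
    using finite_partitions by (meson card_image_le card_mono finite_imageI le_trans)
qed

lemma Q_eq_card:
  "Q n = card {p \<in> partitions n \<times> partitions n. fst p \<succeq> snd p} / (card (partitions n))\<^sup>2"
proof -
  have "Q n = measure_pmf.prob (pmf_of_set (partitions n \<times> partitions n)) {(x, y). x \<succeq> y}"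
    unfolding Q_def using finite_partitions partitions_nonempty
    by (intro arg_cong[where f = "\<lambda>M. measure_pmf.prob M _"] pmf_eqI)
       (auto simp: pmf_pair indicator_def card_cartesian_product)
  also have "\<dots> = card ((partitions n \<times> partitions n) \<inter> {(x, y). x \<succeq> y}) / card (partitions n \<times> partitions n)"
    by (rule measure_pmf_of_set) (use finite_partitions partitions_nonempty in auto)
  also have "(partitions n \<times> partitions n) \<inter> {(x, y). x \<succeq> y} = {p \<in> partitions n \<times> partitions n. fst p \<succeq> snd p}"
    by auto
  finally show ?thesis by (simp add: card_cartesian_product power2_eq_square)
qed

text \<open>All pairs of partitions of \<open>n\<close> have the same mass
  \<open>q ^ (2 * n) * c\<^sup>2\<close>, and \<open>enc\<close> embeds the dominating pairs into
  the event on the right. Since only an inequality is claimed, \<open>P\<close> may be any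
  consequence of dominance.\<close>

lemma Q_le_prob:
  assumes q: "0 < q" "q < 1"
    and E: "\<And>f. (\<And>t. wdiff {1..n} (\<lambda>s. min s t) f \<le> 0) \<Longrightarrow> P f"
  shows "Q n * (wprob q ({1..n} \<times> {True}) n * wprob q ({1..n} \<times> {False}) n) \<le>
    measure_pmf.prob (geo q ({1..n} \<times> UNIV))
      {f. P f \<and> weight ({1..n} \<times> {True}) f = n \<and> weight ({1..n} \<times> {False}) f = n}"
proof -
  define N where "N = card (partitions n)"
  define c where "c = (\<Prod>s\<in>{1..n}. 1 - q ^ s)"
  define D where "D = {p \<in> partitions n \<times> partitions n. fst p \<succeq> snd p}"
  have c0: "0 \<le> c" unfolding c_def using q by (intro prod_nonneg) (auto intro: power_le_one)
  have N0: "0 < N" using finite_partitions partitions_nonempty by (simp add: N_def card_gt_0_iff)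
  let ?A = "{1..n} \<times> (UNIV :: bool set)"
  have "(\<Prod>i\<in>{1..n} \<times> {b}. 1 - q ^ fst i) = c" for b :: bool
    unfolding c_def by (rule prod.reindex_bij_witness[of _ "\<lambda>s. (s, b)" fst]) auto
  then have w: "wprob q ({1..n} \<times> {b}) n \<le> N * (q ^ n * c)" for b
    using prob_level[of "{1..n} \<times> {b}" q n "\<lambda>_. True"] card_level_le[of n b] q c0
    by (auto simp: wprob_def N_def intro!: mult_right_mono)
  have "Q n * (wprob q ({1..n} \<times> {True}) n * wprob q ({1..n} \<times> {False}) n) \<le>
      Q n * ((N * (q ^ n * c)) * (N * (q ^ n * c)))"
    using w wprob_nonneg q c0 by (intro mult_left_mono mult_mono) (auto simp: Q_def)
  also have "\<dots> = card D * (q ^ (2 * n) * c\<^sup>2)"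
    using N0 by (simp add: Q_eq_card N_def[symmetric] D_def field_simps power2_eq_square power_add mult_2 mult_2_right)
  also have "real (card D) \<le> card {f \<in> level ?A (2 * n). P f \<and> weight ({1..n} \<times> {True}) f = n \<and> weight ({1..n} \<times> {False}) f = n}"
  proof -
    have "inj_on enc D" using enc_inj by (rule inj_on_subset) (auto simp: D_def)
    then have "card D = card (enc ` D)" by (simp add: card_image)
    also have "\<dots> \<le> card {f \<in> level ?A (2 * n). P f \<and> weight ({1..n} \<times> {True}) f = n \<and> weight ({1..n} \<times> {False}) f = n}"
    proof (rule card_mono)
      show "enc ` D \<subseteq> {f \<in> level ?A (2 * n). P f \<and> weight ({1..n} \<times> {True}) f = n \<and> weight ({1..n} \<times> {False}) f = n}"
        using E enc_level enc_weight enc_wdiff by (auto simp: D_def)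
    qed (use finite_level[of ?A] in auto)
    finally show ?thesis by simp
  qed
  then have "card D * (q ^ (2 * n) * c\<^sup>2) \<le>
     card {f \<in> level ?A (2 * n). P f \<and> weight ({1..n} \<times> {True}) f = n \<and> weight ({1..n} \<times> {False}) f = n} * (q ^ (2 * n) * c\<^sup>2)"
    using q by (intro mult_right_mono) auto
  also have "c\<^sup>2 = (\<Prod>i\<in>?A. 1 - q ^ fst i)"
    by (simp add: c_def prod_times_bool power2_eq_square prod.distrib)
  also have "card {f \<in> level ?A (2 * n). P f \<and> weight ({1..n} \<times> {True}) f = n \<and> weight ({1..n} \<times> {False}) f = n} * (q ^ (2 * n) * (\<Prod>i\<in>?A. 1 - q ^ fst i)) =
    measure_pmf.prob (geo q ?A)
      {f. weight ?A f = 2 * n \<and> P f \<and> weight ({1..n} \<times> {True}) f = n \<and> weight ({1..n} \<times> {False}) f = n}"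
    by (rule prob_level[symmetric]) (use q in auto)
  also have "\<dots> \<le> measure_pmf.prob (geo q ({1..n} \<times> UNIV))
      {f. P f \<and> weight ({1..n} \<times> {True}) f = n \<and> weight ({1..n} \<times> {False}) f = n}"
    by (intro measure_pmf.finite_measure_mono) auto
  finally show ?thesis .
qed

section \<open>Tuning the parameter\<close>

lemma geometric_second_moment:
  assumes "0 < p" "p < 1"
  shows "integrable (geometric_pmf p) (\<lambda>k. real k)"
    and "integrable (geometric_pmf p) (\<lambda>k. (real k)\<^sup>2)"
    and "measure_pmf.expectation (geometric_pmf p) (\<lambda>k. (real k)\<^sup>2) = 2 * (1 - p) / p\<^sup>2 - (1 - p) / p"
proof -
  define x where "x = 1 - p"
  have x: "0 < x" "x < 1" "p = 1 - x" using assms by (auto simp: x_def)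
  have s1: "(\<lambda>k. x ^ k * real k) sums (x / (1 - x)\<^sup>2)"
    using geometric_sums_times_n[of x] x by simp
  have s0: "(\<lambda>k. x ^ k) sums (1 / (1 - x))" using geometric_sums[of x] x by simp
  \<comment> \<open>The Cauchy product of the series for \<open>k\<close> and for 1 has coefficients
    \<open>k * (k + 1) / 2\<close>; the series for the square is a linear combination of it and the
    one for \<open>k\<close>.\<close>
  have "(\<lambda>k. \<Sum>i\<le>k. (x ^ i * real i) * x ^ (k - i)) sums ((\<Sum>k. x ^ k * real k) * (\<Sum>k. x ^ k))"
    by (rule Cauchy_product_sums) (use s0 s1 x in \<open>auto simp: sums_iff abs_mult\<close>)
  also have "(\<lambda>k. \<Sum>i\<le>k. (x ^ i * real i) * x ^ (k - i)) = (\<lambda>k. x ^ k * (real k * (real k + 1) / 2))"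
  proof
    fix k :: nat
    have "(\<Sum>i\<le>k. (x ^ i * real i) * x ^ (k - i)) = (\<Sum>i\<le>k. x ^ k * real i)"
      by (intro sum.cong refl) (simp add: mult_ac flip: power_add)
    also have "\<dots> = x ^ k * (\<Sum>i\<le>k. real i)" by (simp add: sum_distrib_left)
    also have "(\<Sum>i\<le>k. real i) = real k * (real k + 1) / 2"
      by (induction k) (auto simp: field_simps)
    finally show "(\<Sum>i\<le>k. (x ^ i * real i) * x ^ (k - i)) = x ^ k * (real k * (real k + 1) / 2)" .
  qed
  finally have "(\<lambda>k. x ^ k * (real k * (real k + 1) / 2)) sums (x / (1 - x)\<^sup>2 * (1 / (1 - x)))"
    using s0 s1 by (simp add: sums_iff)
  from sums_diff[OF sums_mult[OF this, of 2] s1]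
  have "(\<lambda>k. 2 * (x ^ k * (real k * (real k + 1) / 2)) - x ^ k * real k) sums
      (2 * (x / (1 - x)\<^sup>2 * (1 / (1 - x))) - x / (1 - x)\<^sup>2)" .
  also have "(\<lambda>k. 2 * (x ^ k * (real k * (real k + 1) / 2)) - x ^ k * real k) = (\<lambda>k. x ^ k * (real k)\<^sup>2)"
    by (intro ext) (simp add: field_simps power2_eq_square)
  finally have s2: "(\<lambda>k. x ^ k * (real k)\<^sup>2) sums (2 * (x / (1 - x)\<^sup>2 * (1 / (1 - x))) - x / (1 - x)\<^sup>2)" .
  have "summable (\<lambda>k. (1 - p) ^ k * norm ((real k)\<^sup>2))"
    using s2 by (simp add: sums_iff x_def)
  note g = geometric_expectation[OF assms(1) less_imp_le[OF assms(2)] this]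
  show "integrable (geometric_pmf p) (\<lambda>k. (real k)\<^sup>2)" by (rule g(1))
  show "integrable (geometric_pmf p) (\<lambda>k. real k)"
    using integrable_real_geometric_pmf[of p] assms by simp
  have "(\<lambda>k. p * (x ^ k * (real k)\<^sup>2)) sums (p * (2 * (x / (1 - x)\<^sup>2 * (1 / (1 - x))) - x / (1 - x)\<^sup>2))"
    by (intro sums_mult s2)
  also have "(\<lambda>k. p * (x ^ k * (real k)\<^sup>2)) = (\<lambda>k. of_real ((1 - p) ^ k * p) * (real k)\<^sup>2)"
    by (simp add: x_def mult_ac)
  finally have "measure_pmf.expectation (geometric_pmf p) (\<lambda>k. (real k)\<^sup>2) =
    p * (2 * (x / (1 - x)\<^sup>2 * (1 / (1 - x))) - x / (1 - x)\<^sup>2)"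
    using g(2) sums_unique2 by blast
  also have "\<dots> = 2 * (1 - p) / p\<^sup>2 - (1 - p) / p"
    using assms by (simp add: x_def field_simps power2_eq_square)
  finally show "measure_pmf.expectation (geometric_pmf p) (\<lambda>k. (real k)\<^sup>2) = 2 * (1 - p) / p\<^sup>2 - (1 - p) / p" .
qed

lemma geometric_centered:
  assumes "0 < p" "p < 1"
  defines "c \<equiv> (1 - p) / p"
  shows "integrable (geometric_pmf p) (\<lambda>k. real k - c)"
    and "measure_pmf.expectation (geometric_pmf p) (\<lambda>k. real k - c) = 0"
    and "integrable (geometric_pmf p) (\<lambda>k. (real k - c)\<^sup>2)"
    and "measure_pmf.expectation (geometric_pmf p) (\<lambda>k. (real k - c)\<^sup>2) = (1 - p) / p\<^sup>2"
proof -
  note m = geometric_second_moment[OF assms(1,2)]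
  have e: "measure_pmf.expectation (geometric_pmf p) (\<lambda>k. real k) = c"
    using expectation_geometric_pmf[of p] assms by (simp add: c_def)
  show "integrable (geometric_pmf p) (\<lambda>k. real k - c)" using m by simp
  show "measure_pmf.expectation (geometric_pmf p) (\<lambda>k. real k - c) = 0" using m e by simp
  have sq: "(\<lambda>k. (real k - c)\<^sup>2) = (\<lambda>k. (real k)\<^sup>2 - 2 * c * real k + c\<^sup>2)"
    by (simp add: power2_eq_square algebra_simps)
  show "integrable (geometric_pmf p) (\<lambda>k. (real k - c)\<^sup>2)" unfolding sq using m by simp
  have "measure_pmf.expectation (geometric_pmf p) (\<lambda>k. (real k - c)\<^sup>2) =
    (2 * (1 - p) / p\<^sup>2 - (1 - p) / p) - 2 * c * c + c\<^sup>2"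
    unfolding sq using m e by simp
  also have "\<dots> = (1 - p) / p\<^sup>2"
    using assms(1) by (simp add: c_def field_simps power2_eq_square)
  finally show "measure_pmf.expectation (geometric_pmf p) (\<lambda>k. (real k - c)\<^sup>2) = (1 - p) / p\<^sup>2" .
qed

lemma weight_chebyshev:
  assumes "finite A" "0 < q" "q < 1" and pos: "\<And>i. i \<in> A \<Longrightarrow> 1 \<le> fst i" and W: "0 < W"
  defines "\<mu> \<equiv> (\<Sum>i\<in>A. real (fst i) * (q ^ fst i / (1 - q ^ fst i)))"
  shows "measure_pmf.prob (geo q A) {f. W \<le> \<bar>real (weight A f) - \<mu>\<bar>} \<le>
    (\<Sum>i\<in>A. (real (fst i))\<^sup>2 * geom_var q (fst i)) / W\<^sup>2"
proof -
  define p where "p = (\<lambda>i::nat \<times> bool. 1 - q ^ fst i)"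
  define c where "c = (\<lambda>i. (1 - p i) / p i)"
  have cc: "(1 - p i) / p i = c i" for i by (simp add: c_def)
  have p: "0 < p i" "p i < 1" if "i \<in> A" for i
    using assms(2,3) pos[OF that] by (auto simp: p_def power_less_one_iff)
  have two: "integrable (geo q A) (\<lambda>f. (real (f i) - c i) * (real (f j) - c j)) \<and>
     measure_pmf.expectation (geo q A) (\<lambda>f. (real (f i) - c i) * (real (f j) - c j)) =
       (if i = j then geom_var q (fst i) else 0)" if ij: "i \<in> A" "j \<in> A" for i j
  proof -
    \<comment> \<open>Writes the product of two centred coordinates as a product over all of
      \<open>A\<close>, as \<open>geo_expectation_prod\<close> requires; for \<open>i = j\<close>
      both factors fall on one coordinate and give the square.\<close>
    define F where "F = (\<lambda>k x. (if k = i then real x - c i else 1) * (if k = j then real x - c j else 1))"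
    have F: "(\<Prod>k\<in>A. F k (f k)) = (real (f i) - c i) * (real (f j) - c j)" for f
      unfolding F_def prod.distrib using assms(1) ij by (simp add: prod.delta)
    note g = geometric_centered[OF p[OF ij(1)], unfolded cc] geometric_centered[OF p[OF ij(2)], unfolded cc]
    have int: "integrable (geometric_pmf (1 - q ^ fst k)) (F k)" if "k \<in> A" for k
    proof -
      consider "k = i" "k = j" | "k = i" "k \<noteq> j" | "k \<noteq> i" "k = j" | "k \<noteq> i" "k \<noteq> j" by blast
      then show ?thesis
        using g by cases (auto simp: F_def p_def power2_eq_square)
    qed
    note E = geo_expectation_prod[OF assms(1) int, unfolded F]
    have "(\<Prod>k\<in>A. measure_pmf.expectation (geometric_pmf (1 - q ^ fst k)) (F k)) =
        (if i = j then geom_var q (fst i) else 0)"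
    proof (cases "i = j")
      case True
      have "(\<Prod>k\<in>A. measure_pmf.expectation (geometric_pmf (1 - q ^ fst k)) (F k)) =
         (\<Prod>k\<in>A. if k = i then geom_var q (fst i) else 1)"
        using g(4) True by (intro prod.cong refl) (auto simp: F_def p_def geom_var_def power2_eq_square)
      also have "\<dots> = geom_var q (fst i)" using assms(1) ij by (simp add: prod.delta)
      finally show ?thesis using True by simp
    next
      case False
      have "measure_pmf.expectation (geometric_pmf (1 - q ^ fst i)) (F i) = 0"
        using g(2) False by (auto simp: F_def p_def)
      then show ?thesis using False assms(1) ij by (auto intro!: prod_zero)
    qed
    with E show ?thesis by simp
  qed
  define X where "X = (\<lambda>f::nat \<times> bool \<Rightarrow> nat. real (weight A f) - \<mu>)"
  have X: "X f = (\<Sum>i\<in>A. real (fst i) * (real (f i) - c i))" for f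
    unfolding X_def weight_def \<mu>_def c_def p_def by (simp add: right_diff_distrib sum_subtractf)
  have X2: "(X f)\<^sup>2 = (\<Sum>i\<in>A. \<Sum>j\<in>A. real (fst i) * real (fst j) * ((real (f i) - c i) * (real (f j) - c j)))" for f
    unfolding X power2_eq_square sum_product by (intro sum.cong refl) (simp add: mult_ac)
  have int: "integrable (geo q A) (\<lambda>f. (X f)\<^sup>2)"
    unfolding X2 using two by (intro Bochner_Integration.integrable_sum integrable_mult_right) auto
  have "measure_pmf.expectation (geo q A) (\<lambda>f. (X f)\<^sup>2) =
     (\<Sum>i\<in>A. \<Sum>j\<in>A. real (fst i) * real (fst j) * (if i = j then geom_var q (fst i) else 0))"
    unfolding X2 using two
    by (subst Bochner_Integration.integral_sum; (intro Bochner_Integration.integrable_sum integrable_mult_right)?; simp)+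
  also have "\<dots> = (\<Sum>i\<in>A. (real (fst i))\<^sup>2 * geom_var q (fst i))"
    using assms(1) by (simp add: if_distrib sum.delta power2_eq_square cong: if_cong)
  finally have E: "measure_pmf.expectation (geo q A) (\<lambda>f. (X f)\<^sup>2) = (\<Sum>i\<in>A. (real (fst i))\<^sup>2 * geom_var q (fst i))" .
  have "{f. W \<le> \<bar>X f\<bar>} = {f. W\<^sup>2 \<le> (X f)\<^sup>2}"
    using W by (auto simp: abs_le_square_iff[symmetric])
  then have "measure_pmf.prob (geo q A) {f. W \<le> \<bar>X f\<bar>} \<le> measure_pmf.expectation (geo q A) (\<lambda>f. (X f)\<^sup>2) / W\<^sup>2"
    using integral_Markov_inequality_measure[OF int, of UNIV "W\<^sup>2"] W by simp
  then have "measure_pmf.prob (geo q A) {f. W \<le> \<bar>X f\<bar>} \<le> (\<Sum>i\<in>A. (real (fst i))\<^sup>2 * geom_var q (fst i)) / W\<^sup>2"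
    unfolding E .
  then show ?thesis unfolding X_def .
qed

section \<open>Choosing \<open>u\<close> so that the expected weight is \<open>n\<close>\<close>

lemma exp_diff_ge:
  fixes y :: real
  assumes "0 \<le> y"
  shows "y * exp (y / 2) \<le> exp y - 1"
    and "y\<^sup>2 * exp (y / 2) / 4 \<le> exp y + inverse (exp y) - 2"
proof -
  have e: "y \<le> exp (y / 2) - exp (- (y / 2))" using real_le_x_sinh[of "y / 2"] assms by (simp add: exp_minus)
  have "y * exp (y / 2) \<le> (exp (y / 2) - exp (- (y / 2))) * exp (y / 2)"
    by (intro mult_right_mono e) auto
  also have "\<dots> = exp y - 1" by (simp add: left_diff_distrib flip: exp_add)
  finally show "y * exp (y / 2) \<le> exp y - 1" .
  have e4: "y / 2 \<le> exp (y / 4) - exp (- (y / 4))" using real_le_x_sinh[of "y / 4"] assms by (simp add: exp_minus)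
  \<comment> \<open>A hyperbolic sine at \<open>y / 2\<close> factors through sine and cosine at
    \<open>y / 4\<close>; the cosine keeps the exponential growth that makes the later sums over
    \<open>s\<close> geometric.\<close>
  have "y / 2 * exp (y / 4) \<le> (exp (y / 4) - exp (- (y / 4))) * (exp (y / 4) + exp (- (y / 4)))"
    using assms by (intro mult_mono e4) auto
  also have "\<dots> = exp (y / 2) - exp (- (y / 2))" by (simp add: algebra_simps flip: exp_add)
  finally have "(y / 2 * exp (y / 4))\<^sup>2 \<le> (exp (y / 2) - exp (- (y / 2)))\<^sup>2"
    using assms by (intro power_mono) auto
  moreover have "(exp (y / 4))\<^sup>2 = exp (y / 2)" by (simp add: power2_eq_square flip: exp_add)
  moreover have "(exp (y / 2) - exp (- (y / 2)))\<^sup>2 = exp y + inverse (exp y) - 2"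
    by (simp add: power2_eq_square algebra_simps exp_minus[symmetric] flip: exp_add)
  ultimately show "y\<^sup>2 * exp (y / 2) / 4 \<le> exp y + inverse (exp y) - 2"
    by (simp add: power_mult_distrib power_divide)
qed

lemma sum_exp_le:
  fixes u :: real and n :: nat
  assumes "0 < u"
  shows "(\<Sum>s\<in>{1..n}. exp (- (s * u) / 2)) \<le> 2 / u"
proof -
  define x where "x = exp (- u / 2)"
  have x: "0 < x" "x < 1" using assms by (auto simp: x_def)
  have "(\<Sum>s\<in>{1..n}. exp (- (s * u) / 2)) = (\<Sum>s\<in>{1..n}. x ^ s)"
    by (intro sum.cong refl) (simp add: x_def exp_of_nat_mult[symmetric])
  also have "\<dots> = (x - x ^ Suc n) / (1 - x)"
    using sum_gp[of x 1 n] x by (cases n) auto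
  also have "\<dots> \<le> x / (1 - x)" using x by (intro divide_right_mono) auto
  also have "\<dots> \<le> 2 / u"
  proof -
    have "1 + u / 2 \<le> exp (u / 2)" by (rule exp_ge_add_one_self)
    then have "x * (1 + u / 2) \<le> x * exp (u / 2)" using x by (intro mult_left_mono) auto
    also have "x * exp (u / 2) = 1" by (simp add: x_def flip: exp_add)
    finally have "x * u \<le> 2 * (1 - x)" by (simp add: algebra_simps)
    then show ?thesis using x assms by (simp add: field_simps)
  qed
  finally show ?thesis .
qed

lemma sum_variance_le:
  assumes u: "0 < u"
  shows "(\<Sum>s\<in>{1..n}. (real s)\<^sup>2 * geom_var (exp (- u)) s) \<le> 8 / u ^ 3"
proof -
  have "(\<Sum>s\<in>{1..n}. (real s)\<^sup>2 * geom_var (exp (- u)) s) \<le> (\<Sum>s\<in>{1..n}. 4 / u\<^sup>2 * exp (- (s * u) / 2))"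
  proof (intro sum_mono)
    fix s assume s: "s \<in> {1..n}"
    define y where "y = s * u"
    have y: "0 < y" using s u by (simp add: y_def)
    have "geom_var (exp (- u)) s \<le> 1 / (y\<^sup>2 * exp (y / 2) / 4)"
    proof -
      have d: "0 < y\<^sup>2 * exp (y / 2) / 4" using y by simp
      have e: "y\<^sup>2 * exp (y / 2) / 4 \<le> exp y + inverse (exp y) - 2" by (rule exp_diff_ge(2)) (use y in simp)
      have "geom_var (exp (- u)) s = 1 / (exp y + inverse (exp y) - 2)"
        unfolding y_def by (rule geom_var_eq) (use s u in auto)
      then show ?thesis using frac_le[OF zero_le_one order_refl d e] by simp
    qed
    then have "(real s)\<^sup>2 * geom_var (exp (- u)) s \<le> (real s)\<^sup>2 * (1 / (y\<^sup>2 * exp (y / 2) / 4))"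
      by (intro mult_left_mono) auto
    also have "\<dots> = 4 / u\<^sup>2 * exp (- (s * u) / 2)"
      using s u by (simp add: y_def power_mult_distrib exp_minus field_simps)
    finally show "(real s)\<^sup>2 * geom_var (exp (- u)) s \<le> 4 / u\<^sup>2 * exp (- (s * u) / 2)" .
  qed
  also have "\<dots> \<le> 4 / u\<^sup>2 * (2 / u)"
    unfolding sum_distrib_left[symmetric] using sum_exp_le[OF u] by (intro mult_left_mono) auto
  also have "\<dots> = 8 / u ^ 3" using u by (simp add: power2_eq_square power3_eq_cube)
  finally show ?thesis .
qed

text \<open>The expected weight of one partition for \<open>q = exp (- u)\<close>: the size
  \<open>s\<close> has expected multiplicity \<open>1 / (exp (s * u) - 1)\<close>.\<close>

definition mean :: "nat \<Rightarrow> real \<Rightarrow> real" where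
  "mean n u = (\<Sum>s\<in>{1..n}. real s / (exp (real s * u) - 1))"

lemma mean_le:
  assumes u: "0 < u"
  shows "mean n u \<le> 2 / u\<^sup>2"
proof -
  have "mean n u \<le> (\<Sum>s\<in>{1..n}. 1 / u * exp (- (s * u) / 2))"
    unfolding mean_def
  proof (intro sum_mono)
    fix s assume s: "s \<in> {1..n}"
    define y where "y = s * u"
    have y: "0 < y" using s u by (simp add: y_def)
    have "s / (exp (s * u) - 1) \<le> s / (y * exp (y / 2))"
      using exp_diff_ge(1)[of y] y by (intro divide_left_mono mult_pos_pos) (auto simp flip: y_def)
    also have "\<dots> = 1 / u * exp (- (s * u) / 2)"
      using s u by (simp add: y_def exp_minus field_simps)
    finally show "s / (exp (s * u) - 1) \<le> 1 / u * exp (- (s * u) / 2)" .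
  qed
  also have "\<dots> \<le> 1 / u * (2 / u)"
    unfolding sum_distrib_left[symmetric] using sum_exp_le[OF u] u by (intro mult_left_mono) auto
  finally show ?thesis by (simp add: power2_eq_square)
qed

text \<open>Each size with \<open>s * u \<le> 1\<close> contributes at least
  \<open>1 / (2 * u)\<close>, because \<open>exp y - 1 \<le> 2 * y\<close> on the unit
  interval.\<close>

lemma mean_ge:
  fixes k n :: nat and u :: real
  assumes u: "0 < u" and k: "k \<le> n" "k * u \<le> 1"
  shows "k / (2 * u) \<le> mean n u"
proof -
  have "(\<Sum>s\<in>{1..k}. 1 / (2 * u)) \<le> (\<Sum>s\<in>{1..k}. s / (exp (s * u) - 1))"
  proof (intro sum_mono)
    fix s assume s: "s \<in> {1..k}"
    define y where "y = s * u"
    have "s * u \<le> k * u" using s u by (intro mult_right_mono) auto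
    then have "y \<le> 1" using k unfolding y_def by linarith
    moreover have "0 < y" using s u by (simp add: y_def)
    ultimately have y: "0 < y" "y \<le> 1" by auto
    have "y\<^sup>2 \<le> y" using y by (simp add: power2_eq_square mult_left_le_one_le)
    then have e: "exp y - 1 \<le> 2 * y" using exp_bound[of y] y by simp
    have "1 / (2 * u) = s / (2 * y)" using s u by (simp add: y_def)
    also have "\<dots> \<le> s / (exp y - 1)" using e y by (intro divide_left_mono) auto
    finally show "1 / (2 * u) \<le> s / (exp (s * u) - 1)" by (simp add: y_def)
  qed
  also have "\<dots> \<le> mean n u"
    unfolding mean_def using u k by (intro sum_mono2) (auto intro!: divide_nonneg_nonneg)
  finally show ?thesis by simp
qed

lemma exists_mean:
  assumes n: "8 \<le> n"
  obtains u where "0 < u" "mean n u = n" "u\<^sup>2 \<le> 2 / n" "1 / (4 * n) \<le> u\<^sup>2" "u \<le> 1 / 2"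
proof -
  \<comment> \<open>At \<open>a\<close> the term \<open>s = 1\<close> alone equals \<open>n\<close>;
    at \<open>b\<close> the bound of \<open>mean_le\<close> equals \<open>n\<close>. The
    intermediate value theorem applies between them.\<close>
  define a b where "a = ln (1 + 1 / real n)" and "b = sqrt (2 / n)"
  have n0: "0 < 1 / real n" using n by simp
  have a0: "0 < a" unfolding a_def by (rule ln_gt_zero) (use n0 in linarith)
  have b2: "b\<^sup>2 = 2 / n" by (simp add: b_def)
  have "a \<le> 1 / n" using n unfolding a_def by (intro ln_add_one_self_le_self) auto
  also have "1 / n \<le> b"
  proof (rule power2_le_imp_le)
    show "(1 / real n)\<^sup>2 \<le> b\<^sup>2" unfolding b2 using n by (simp add: field_simps power2_eq_square)
  qed (simp add: b_def)
  finally have ab: "a \<le> b" .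
  have "exp a = 1 + 1 / real n" unfolding a_def using n0 by (intro exp_ln) linarith
  then have "real n = (\<Sum>s\<in>{1::nat}. real s / (exp (real s * a) - 1))" by simp
  also have "\<dots> \<le> mean n a"
    unfolding mean_def using n a0 by (intro sum_mono2) (auto intro!: divide_nonneg_nonneg)
  finally have la: "n \<le> mean n a" .
  have lb: "mean n b \<le> n" using mean_le[of b n] b2 a0 ab n by simp
  have cont: "continuous_on {a..b} (mean n)"
    unfolding mean_def using a0 by (intro continuous_intros) auto
  from IVT2'[OF lb la ab cont] obtain u where u: "a \<le> u" "u \<le> b" "mean n u = n" by auto
  have u0: "0 < u" using a0 u by simp
  have u2: "u\<^sup>2 \<le> 2 / n" unfolding b2[symmetric] using u u0 by (intro power_mono) auto
  also have "2 / real n \<le> (1 / 2)\<^sup>2" using n by (simp add: power2_eq_square field_simps)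
  finally have uh: "u \<le> 1 / 2" by (rule power2_le_imp_le) simp
  \<comment> \<open>The lower bound on \<open>u\<close> comes from \<open>mean_ge\<close> with the
    sizes up to \<open>1 / u\<close>; by \<open>u \<le> 1 / 2\<close> the floor is at least
    \<open>1 / (2 * u)\<close>.\<close>
  define k where "k = nat \<lfloor>1 / u\<rfloor>"
  have k: "real k \<le> 1 / u" "1 / u - 1 < k" using u0 by (auto simp: k_def)
  have ku: "k * u \<le> 1" using k(1) u0 by (simp add: field_simps)
  have kn: "k \<le> n"
  proof (rule ccontr)
    assume "\<not> k \<le> n"
    then have "real n * u \<le> k * u" using u0 by (intro mult_right_mono) auto
    then have nu: "n * u \<le> 1" using ku by linarith
    have "n / (2 * u) \<le> n" using mean_ge[OF u0 order_refl nu] u(3) by simp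
    then have "1 \<le> 2 * u" using u0 n by (simp add: field_simps)
    moreover have "8 * u \<le> n * u" using n u0 by (intro mult_right_mono) auto
    ultimately show False using nu by linarith
  qed
  have "1 / u / 2 \<le> 1 / u - 1" using uh u0 by (simp add: field_simps)
  then have "1 / u / 2 / (2 * u) \<le> k / (2 * u)" using k u0 by (intro divide_right_mono) auto
  also have "\<dots> \<le> n" using mean_ge[OF u0 kn ku] u(3) by simp
  finally have "1 / (4 * n) \<le> u\<^sup>2" using u0 n by (simp add: field_simps power2_eq_square)
  with that u0 u(3) u2 uh show ?thesis by blast
qed

text \<open>The variance is at most \<open>8 / u ^ 3\<close> and
  \<open>W\<^sup>2 \<ge> 36 / u ^ 3\<close>, so Chebyshev's inequality leaves a failure probability
  of at most 2/9.\<close>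

lemma weight_concentrated:
  assumes u: "0 < u" and mean: "mean n u = n" and W: "6 / (u * sqrt u) \<le> W"
  shows "3 / 4 \<le> measure_pmf.prob (geo (exp (- u)) ({1..n} \<times> {b})) {f. \<bar>real (weight ({1..n} \<times> {b}) f) - n\<bar> < W}"
proof -
  let ?A = "{1..n} \<times> {b}" and ?q = "exp (- u)"
  have W0: "0 < W" using W u by (meson divide_pos_pos mult_pos_pos order_less_le_trans real_sqrt_gt_zero zero_less_numeral)
  have "(\<Sum>i\<in>?A. real (fst i) * (?q ^ fst i / (1 - ?q ^ fst i))) = (\<Sum>s\<in>{1..n}. real s * (?q ^ s / (1 - ?q ^ s)))"
    by (rule sum_times_singleton)
  also have "\<dots> = mean n u"
    unfolding mean_def
  proof (intro sum.cong refl)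
    fix s assume "s \<in> {1..n}"
    then have "0 < s * u" using u by simp
    then have "exp (- (s * u)) / (1 - exp (- (s * u))) = 1 / (exp (s * u) - 1)"
      by (simp add: exp_minus field_simps)
    then show "real s * (?q ^ s / (1 - ?q ^ s)) = s / (exp (s * u) - 1)"
      by (simp add: exp_of_nat_mult[symmetric] times_divide_eq_right)
  qed
  finally have m: "(\<Sum>i\<in>?A. real (fst i) * (?q ^ fst i / (1 - ?q ^ fst i))) = n" using mean by simp
  have v: "(\<Sum>i\<in>?A. (real (fst i))\<^sup>2 * geom_var ?q (fst i)) = (\<Sum>s\<in>{1..n}. (real s)\<^sup>2 * geom_var ?q s)"
    by (rule sum_times_singleton)
  have "measure_pmf.prob (geo ?q ?A) {f. W \<le> \<bar>real (weight ?A f) - n\<bar>} \<le> (\<Sum>s\<in>{1..n}. (real s)\<^sup>2 * geom_var ?q s) / W\<^sup>2"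
    using weight_chebyshev[of ?A ?q W, OF _ _ _ _ W0] u unfolding m v by auto
  also have "\<dots> \<le> (8 / u ^ 3) / W\<^sup>2" by (intro divide_right_mono sum_variance_le u) auto
  also have "\<dots> \<le> (8 / u ^ 3) / (6 / (u * sqrt u))\<^sup>2"
    using W W0 u by (intro divide_left_mono power_mono mult_pos_pos) auto
  also have "\<dots> \<le> 1 / 4"
    using u by (simp add: power_divide power_mult_distrib power3_eq_cube power2_eq_square field_simps)
  finally have "measure_pmf.prob (geo ?q ?A) {f. W \<le> \<bar>real (weight ?A f) - n\<bar>} \<le> 1 / 4" .
  moreover have "UNIV - {f. W \<le> \<bar>real (weight ?A f) - n\<bar>} = {f. \<bar>real (weight ?A f) - n\<bar> < W}" by auto
  ultimately show ?thesis
    using measure_pmf.prob_compl[of "{f. W \<le> \<bar>real (weight ?A f) - n\<bar>}" "geo ?q ?A"] by simp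
qed

section \<open>Combining the blocks\<close>

text \<open>\<open>min s t\<close> is \<open>s\<close> up to \<open>r\<close> and \<open>t\<close>
  beyond \<open>R\<close>, because \<open>r < t \<le> R\<close>.\<close>

lemma wdiff_min_split:
  assumes "r < t" "t \<le> R" "R \<le> n"
  shows "wdiff {1..n} (\<lambda>s. min s t) f =
    wdiff {1..n} (\<lambda>s. if s \<le> r then s else 0) f + wdiff {r<..R} (\<lambda>s. min s t) f +
    t * wdiff {1..n} (\<lambda>s. if R < s then 1 else 0) f"
proof -
  let ?d = "\<lambda>s. real (f (s, True)) - real (f (s, False))"
  have "wdiff {r<..R} (\<lambda>s. min s t) f =
      (\<Sum>s\<in>{1..n}. (if s \<in> {r<..R} then real (min s t) * ?d s else 0))"
    unfolding wdiff_def using assms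
    by (subst sum.inter_restrict[symmetric]) (auto intro!: sum.cong)
  then show ?thesis
    unfolding wdiff_def sum_distrib_left sum.distrib[symmetric]
    using assms by (simp only: sum.distrib[symmetric]) (intro sum.cong; auto)
qed

text \<open>The \<open>m\<close>-th block of sizes is \<open>{r<..R}\<close> with \<open>r = r0 G\<^sup>2\<^sup>m\<close> and \<open>R = r G\<^sup>2\<close>, and it is tested at
  \<open>t = r G\<close>. Its own contribution has standard deviation of order \<open>sqrt t / u\<close>, whereas the sizes up to
  \<open>r\<close> and those above \<open>R\<close> contribute only \<open>sqrt (H / G)\<close> times as much.\<close>

lemma Q_block_bound:
  fixes u H \<gamma> c :: real and r0 G M n J :: nat
  assumes u: "0 < u" and H: "1 \<le> H" "H \<le> r0" and G: "2 \<le> G" and J: "1 \<le> J"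
    and top: "real (r0 * G ^ (2 * M)) * u \<le> 1" "r0 * G ^ (2 * M) \<le> n"
    and \<gamma>: "1 / 2 + 1 / J + 256 * (real J)\<^sup>2 * H / (real G - 1) \<le> \<gamma>"
    and c: "\<And>b N. wprob (exp (- u)) (({1..n} - {r0<..r0 * G ^ (2 * M)}) \<times> {b}) N \<le> c"
  shows "Q n * (wprob (exp (- u)) ({1..n} \<times> {True}) n * wprob (exp (- u)) ({1..n} \<times> {False}) n)
     \<le> 2 * M * exp (- H) + \<gamma> ^ M * c\<^sup>2"
proof -
  define q where "q = exp (- u)"
  have q: "0 < q" "q < 1" using u by (auto simp: q_def)
  define r where "r = (\<lambda>m. r0 * G ^ (2 * m))"
  define t where "t = (\<lambda>m. r m * G)"
  define e where "e = (\<lambda>m. 8 * sqrt (r m * H) / u)"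
  have r0: "0 < r0" using H by linarith
  have rpos: "0 < r m" for m using r0 G by (simp add: r_def)
  have rS: "r (Suc m) = r m * G * G" for m by (simp add: r_def power2_eq_square power_add)
  have mono: "mono r" unfolding r_def using G by (intro monoI mult_left_mono power_increasing) auto
  have rt: "r m < t m" for m using rpos[of m] G by (simp add: t_def)
  have tR: "t m \<le> r (Suc m)" for m unfolding rS t_def using G by simp
  have Hr: "H \<le> r m" for m
  proof -
    have "r 0 \<le> r m" by (rule monoD[OF mono]) simp
    moreover have "r 0 = r0" by (simp add: r_def)
    ultimately show ?thesis using H by linarith
  qed
  have top': "real (r M) * u \<le> 1" "r M \<le> n" using top unfolding r_def by auto
  have le: "r (Suc m) \<le> n" "r (Suc m) * u \<le> 1" if "m < M" for m
  proof -
    have "r (Suc m) \<le> r M" using that by (intro monoD[OF mono]) auto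
    moreover from this have "r (Suc m) * u \<le> r M * u" using u by (intro mult_right_mono) auto
    ultimately show "r (Suc m) \<le> n" "r (Suc m) * u \<le> 1" using top' by linarith+
  qed
  have sq: "u * sqrt (real x * H) \<le> 1" if "H \<le> x" "x * u \<le> 1" for x :: nat
  proof -
    have "sqrt (real x * H) \<le> sqrt (real x * real x)" using that H by (intro real_sqrt_le_mono mult_left_mono) auto
    then have "u * sqrt (real x * H) \<le> u * x" using u by (intro mult_left_mono) auto
    then show ?thesis using that by (simp add: mult.commute)
  qed
  define low where "low = (\<lambda>m. {f. wdiff {1..n} (\<lambda>s. if s \<le> r m then s else 0) f \<le> - (4 * sqrt (r m * H) / u)})"
  define high where "high = (\<lambda>m. {f. wdiff {1..n} (\<lambda>s. if r (Suc m) < s then 1 else 0) f \<le> - (4 * sqrt (H / r (Suc m)) / u)})"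
  have bad: "measure_pmf.prob (geo q ({1..n} \<times> UNIV)) (low m \<union> high m) \<le> 2 * exp (- H)" if m: "m < M" for m
  proof -
    have "r m * u \<le> 1" using rt[of m] tR[of m] le(2)[OF m] u
      by (meson less_imp_le mult_right_mono of_nat_le_iff order_trans)
    then have "measure_pmf.prob (geo q ({1..n} \<times> UNIV)) (low m) \<le> exp (- H)"
      unfolding low_def q_def using sq[OF Hr[of m]] by (intro low_tail u Hr) (use H in auto)
    moreover have "measure_pmf.prob (geo q ({1..n} \<times> UNIV)) (high m) \<le> exp (- H)"
      unfolding high_def q_def using sq[OF Hr[of "Suc m"] le(2)[OF m]] by (intro high_tail u Hr) (use H in auto)
    ultimately show ?thesis
      using measure_Un_le[of "low m" "geo q ({1..n} \<times> UNIV)" "high m"] by simp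
  qed
  define B where "B = (\<lambda>f. \<forall>m<M. wdiff {r m<..r (Suc m)} (\<lambda>s. min s (t m)) f \<le> e m)"
  have PB: "f \<in> (\<Union>m\<in>{..<M}. low m \<union> high m) \<or> B f"
    if f: "\<forall>m<M. wdiff {1..n} (\<lambda>s. min s (t m)) f \<le> 0" for f
  proof (rule disjCI)
    assume nB: "\<not> B f"
    then obtain m where m: "m < M" "e m < wdiff {r m<..r (Suc m)} (\<lambda>s. min s (t m)) f"
      by (auto simp: B_def not_le)
    \<comment> \<open>The scale \<open>t\<close> is the geometric mean of \<open>r\<close> and
      \<open>R\<close>, so that both outer ranges have the same deviation; \<open>e\<close> is their
      sum.\<close>
    have "t m * (4 * sqrt (H / r (Suc m)) / u) = 4 * sqrt (r m * H) / u"
    proof -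
      have "t m * sqrt (H / r (Suc m)) = sqrt ((real (t m))\<^sup>2 * (H / r (Suc m)))"
        unfolding real_sqrt_mult by simp
      also have "(real (t m))\<^sup>2 * (H / r (Suc m)) = r m * H"
        using rpos[of m] G unfolding rS t_def by (simp add: field_simps power2_eq_square)
      finally show ?thesis by (metis mult.left_commute times_divide_eq_right)
    qed
    then have em: "e m = 4 * sqrt (r m * H) / u + t m * (4 * sqrt (H / r (Suc m)) / u)"
      unfolding e_def by linarith
    have "f \<in> low m \<union> high m"
    proof (rule ccontr)
      assume "f \<notin> low m \<union> high m"
      then have l: "- (4 * sqrt (r m * H) / u) < wdiff {1..n} (\<lambda>s. if s \<le> r m then s else 0) f"
        and h: "- (4 * sqrt (H / r (Suc m)) / u) < wdiff {1..n} (\<lambda>s. if r (Suc m) < s then 1 else 0) f"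
        by (auto simp: low_def high_def)
      have "t m * (- (4 * sqrt (H / r (Suc m)) / u)) \<le> t m * wdiff {1..n} (\<lambda>s. if r (Suc m) < s then 1 else 0) f"
        using h by (intro mult_left_mono) auto
      moreover have "wdiff {1..n} (\<lambda>s. min s (t m)) f \<le> 0" using f m by simp
      ultimately show False
        using l m(2) em wdiff_min_split[OF rt tR le(1)[OF m(1)], of f] by simp
    qed
    then show "f \<in> (\<Union>m\<in>{..<M}. low m \<union> high m)" using m(1) by blast
  qed
  have "Q n * (wprob q ({1..n} \<times> {True}) n * wprob q ({1..n} \<times> {False}) n) \<le>
      measure_pmf.prob (geo q ({1..n} \<times> UNIV))
      {f. (\<forall>m<M. wdiff {1..n} (\<lambda>s. min s (t m)) f \<le> 0) \<and> weight ({1..n} \<times> {True}) f = n \<and> weight ({1..n} \<times> {False}) f = n}"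
    by (rule Q_le_prob[OF q]) auto
  also have "\<dots> \<le> measure_pmf.prob (geo q ({1..n} \<times> UNIV)) ((\<Union>m\<in>{..<M}. low m \<union> high m) \<union>
      {f. B f \<and> weight ({1..n} \<times> {True}) f = n \<and> weight ({1..n} \<times> {False}) f = n})"
    using PB by (intro measure_pmf.finite_measure_mono) auto
  also have "\<dots> \<le> measure_pmf.prob (geo q ({1..n} \<times> UNIV)) (\<Union>m\<in>{..<M}. low m \<union> high m) +
      measure_pmf.prob (geo q ({1..n} \<times> UNIV)) {f. B f \<and> weight ({1..n} \<times> {True}) f = n \<and> weight ({1..n} \<times> {False}) f = n}"
    by (intro measure_Un_le) auto
  also have "\<dots> \<le> 2 * M * exp (- H) + \<gamma> ^ M * c\<^sup>2"
  proof (rule add_mono)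
    have "measure_pmf.prob (geo q ({1..n} \<times> UNIV)) (\<Union>m\<in>{..<M}. low m \<union> high m) \<le>
        (\<Sum>m\<in>{..<M}. measure_pmf.prob (geo q ({1..n} \<times> UNIV)) (low m \<union> high m))"
      by (intro measure_UNION_le) auto
    also have "\<dots> \<le> (\<Sum>m\<in>{..<M}. 2 * exp (- H))" by (intro sum_mono bad) auto
    finally show "measure_pmf.prob (geo q ({1..n} \<times> UNIV)) (\<Union>m\<in>{..<M}. low m \<union> high m) \<le> 2 * M * exp (- H)"
      by simp
    have "0 \<le> 1 / 2 + 1 / J + 256 * (real J)\<^sup>2 * H / (real G - 1)" using H G by simp
    then have \<gamma>0: "0 \<le> \<gamma>" using \<gamma> by linarith
    have K: "{r 0<..r M} = {r0<..r0 * G ^ (2 * M)}" by (simp add: r_def)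
    have "measure_pmf.prob (geo q ({1..n} \<times> UNIV)) {f. B f \<and> weight ({1..n} \<times> {True}) f = n \<and> weight ({1..n} \<times> {False}) f = n}
        \<le> measure_pmf.prob (geo q ({r 0<..r M} \<times> UNIV)) {f. B f} * c\<^sup>2"
    proof (rule prob_blocks_and_weights)
      show "{r 0<..r M} \<subseteq> {1..n}" using top by (auto simp: r_def)
      fix f g :: "nat \<times> bool \<Rightarrow> nat" assume fg: "\<And>i. i \<in> {r 0<..r M} \<times> UNIV \<Longrightarrow> f i = g i"
      have "wdiff {r m<..r (Suc m)} (\<lambda>s. min s (t m)) f = wdiff {r m<..r (Suc m)} (\<lambda>s. min s (t m)) g" if "m < M" for m
      proof (rule wdiff_cong)
        fix s b assume "s \<in> {r m<..r (Suc m)}"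
        moreover have "r 0 \<le> r m" "r (Suc m) \<le> r M" using that by (auto intro!: monoD[OF mono])
        ultimately show "f (s, b) = g (s, b)" by (intro fg) auto
      qed
      then show "B f \<longleftrightarrow> B g" by (simp add: B_def)
    qed (use c in \<open>simp add: K q_def\<close>)
    also have "measure_pmf.prob (geo q ({r 0<..r M} \<times> UNIV)) {f. B f} \<le> \<gamma> ^ M"
      unfolding B_def
    proof (rule prob_blocks[OF mono \<gamma>0])
      fix m assume m: "m < M"
      have tu: "t m * u \<le> 1"
        using tR[of m] le(2)[OF m] u by (meson less_imp_le mult_right_mono of_nat_le_iff order_trans)
      have te: "t m \<le> e m"
      proof -
        have "1 * 1 \<le> r m * H" using rpos[of m] H by (intro mult_mono) auto
        then have "1 \<le> sqrt (r m * H)" by simp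
        then have "t m * u \<le> 8 * sqrt (r m * H)" using tu by linarith
        then show ?thesis using u by (simp add: e_def field_simps)
      qed
      have "measure_pmf.prob (geo q ({r m<..r (Suc m)} \<times> UNIV))
          {f. wdiff {r m<..r (Suc m)} (\<lambda>s. min s (t m)) f \<le> e m}
         \<le> 1 / 2 + 1 / J + 4 * (u * J * e m)\<^sup>2 / (real (t m) - real (r m))"
        unfolding q_def by (rule block_half[OF u rt tR tu te J])
      \<comment> \<open>\<open>256 = 4 * 8\<^sup>2\<close>, and the length
        \<open>t - r = r * (G - 1)\<close> cancels the \<open>r\<close> in
        \<open>(e m)\<^sup>2\<close>: the bound is the same at all scales.\<close>
      also have "4 * (u * J * e m)\<^sup>2 / (real (t m) - real (r m)) = 256 * (real J)\<^sup>2 * H / (real G - 1)"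
      proof -
        have "4 * (u * J * e m)\<^sup>2 = r m * (256 * (real J)\<^sup>2 * H)"
          using u H by (simp add: e_def power_mult_distrib power_divide)
        moreover have "real (t m) - real (r m) = r m * (real G - 1)" by (simp add: t_def algebra_simps)
        ultimately show ?thesis using rpos[of m] by simp
      qed
      finally show "measure_pmf.prob (geo q ({r m<..r (Suc m)} \<times> UNIV))
          {f. wdiff {r m<..r (Suc m)} (\<lambda>s. min s (t m)) f \<le> e m} \<le> \<gamma>"
        using \<gamma> by linarith
    qed
    finally show "measure_pmf.prob (geo q ({1..n} \<times> UNIV))
        {f. B f \<and> weight ({1..n} \<times> {True}) f = n \<and> weight ({1..n} \<times> {False}) f = n} \<le> \<gamma> ^ M * c\<^sup>2"
      by (simp add: mult_right_mono)
  qed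
  finally show ?thesis by (simp add: q_def)
qed

section \<open>Local limit bounds\<close>

lemma nat_ceiling_less: "0 \<le> y \<Longrightarrow> real (nat \<lceil>y\<rceil>) < y + 1"
  by linarith

text \<open>\<open>1568 = 8 * 14\<^sup>2\<close> gives \<open>k * h \<le> n\<close>,
  \<open>4251528 = 2 * 1458\<^sup>2\<close> gives \<open>x \<le> 1 / 2\<close>, and
  \<open>large3\<close> absorbs the additive loss in \<open>lower_bound\<close>.\<close>

locale tuned =
  fixes n :: nat and u :: real
  assumes u: "0 < u" "u \<le> 1 / 2" and mean: "mean n u = n"
    and un: "u\<^sup>2 \<le> 2 / n" "1 / (4 * n) \<le> u\<^sup>2"
    and large1: "1568 \<le> sqrt n" and large2: "4251528 * ln n \<le> sqrt n"
    and large3: "1524096 / real n ^ 3 \<le> exp (- (10206 * sqrt (ln n)))"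
begin

text \<open>A step of about \<open>1 / u\<close> keeps \<open>q ^ h\<close> bounded below,
  \<open>k\<close> steps reach the width required by \<open>weight_concentrated\<close>, and
  \<open>z\<close> makes the Hoeffding error \<open>1 / n ^ 4\<close>.\<close>

definition h :: nat where "h = nat \<lceil>1 / u\<rceil>"
definition k :: nat where "k = nat \<lceil>6 / sqrt u\<rceil>"
definition z :: real where "z = sqrt (2 * h * ln n)"

lemma n_pos: "0 < n" "1 \<le> ln n"
proof -
  show n: "0 < n" using large1 by (cases n) auto
  have "1568 * 1568 \<le> sqrt n * sqrt n" using large1 by (intro mult_mono) auto
  then have "exp 1 \<le> real n" using exp_le by simp
  then show "1 \<le> ln n" using n by (simp add: ln_ge_iff)
qed

lemma h_bounds: "1 / u \<le> h" "h \<le> 2 / u" "h * u \<le> 3 / 2"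
proof -
  show h1: "1 / u \<le> h" unfolding h_def by (rule real_nat_ceiling_ge)
  have "h < 1 / u + 1" unfolding h_def by (rule nat_ceiling_less) (use u in simp)
  then have "h * u \<le> (1 / u + 1) * u" using u by (intro mult_right_mono) auto
  also have "\<dots> = 1 + u" using u by (simp add: algebra_simps)
  finally have "h * u \<le> 1 + u" .
  then show hu: "h * u \<le> 3 / 2" using u by linarith
  then show "h \<le> 2 / u" using u by (simp add: field_simps)
qed

lemma k_bounds: "6 / sqrt u \<le> k" "k \<le> 7 / sqrt u"
proof -
  show "6 / sqrt u \<le> k" unfolding k_def by (rule real_nat_ceiling_ge)
  have "k < 6 / sqrt u + 1"
    unfolding k_def by (rule nat_ceiling_less) (use u in simp)
  moreover have "1 \<le> 1 / sqrt u" using u by simp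
  ultimately show "k \<le> 7 / sqrt u" by (simp add: field_simps)
qed

lemma k_pos: "1 \<le> k"
proof -
  have "0 < 6 / sqrt u" using u by simp
  then show ?thesis using k_bounds(1) by linarith
qed

lemma sqrt_u: "sqrt u * sqrt u = u" "0 < sqrt u" using u by auto

lemma kh_bounds: "6 / (u * sqrt u) \<le> real (k * h)" "real (k * h) \<le> 14 / (u * sqrt u)"
proof -
  have "6 / sqrt u * (1 / u) \<le> real k * h" using k_bounds h_bounds u by (intro mult_mono) auto
  then show "6 / (u * sqrt u) \<le> real (k * h)" by (simp add: mult.commute)
  have "real k * h \<le> 7 / sqrt u * (2 / u)" using k_bounds h_bounds u by (intro mult_mono) auto
  then show "real (k * h) \<le> 14 / (u * sqrt u)" by (simp add: mult.commute)
qed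

lemma u_le: "u \<le> 2 / sqrt n" and u_ge: "1 / (2 * sqrt n) \<le> u"
proof -
  have "2 / real n \<le> (2 / sqrt n)\<^sup>2" using n_pos by (simp add: power_divide divide_right_mono)
  then have "u\<^sup>2 \<le> (2 / sqrt n)\<^sup>2" using un by linarith
  then show "u \<le> 2 / sqrt n" by (rule power2_le_imp_le) simp
  have "(1 / (2 * sqrt n))\<^sup>2 \<le> u\<^sup>2" using un by (simp add: power_divide power_mult_distrib)
  then show "1 / (2 * sqrt n) \<le> u" by (rule power2_le_imp_le) (use u in simp)
qed

lemma sqrt_n: "sqrt n * sqrt n = real n" "0 < sqrt n" using n_pos by auto

lemma kh_le: "k * h \<le> n"
proof -
  define s where "s = sqrt n"
  have s: "0 < s" "real n = s * s" using sqrt_n by (auto simp: s_def)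
  have "real n * real n / (4 * real n) * (1 / (2 * s)) = s / 8"
    unfolding s(2) using s(1) by (simp add: field_simps)
  then have "196 \<le> real n * real n / (4 * n) * (1 / (2 * sqrt n))"
    using large1 by (simp add: s_def)
  also have "\<dots> = (real n * real n) * (1 / (4 * n) * (1 / (2 * sqrt n)))" by simp
  also have "\<dots> \<le> (real n * real n) * (u\<^sup>2 * u)"
    using un u_ge u by (intro mult_left_mono mult_mono) auto
  also have "\<dots> = (real n * (u * sqrt u))\<^sup>2"
    using u by (simp add: power2_eq_square power_mult_distrib mult_ac)
  finally have "14\<^sup>2 \<le> (real n * (u * sqrt u))\<^sup>2" by simp
  then have "14 \<le> real n * (u * sqrt u)" by (rule power2_le_imp_le) (use u in simp)
  then have "14 / (u * sqrt u) \<le> n" using u by (simp add: field_simps)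
  then have "real (k * h) \<le> n" using kh_bounds(2) by linarith
  then show ?thesis by (rule of_nat_le_iff[THEN iffD1])
qed

lemma h3_le: "3 * h \<le> n"
proof -
  have "real h \<le> 2 / (1 / (2 * sqrt n))"
    using h_bounds(2) u_ge u sqrt_n by (meson divide_left_mono divide_pos_pos mult_pos_pos order_trans zero_less_numeral zero_less_one zero_le_numeral)
  then have "real h \<le> 4 * sqrt n" by simp
  moreover have "1568 * sqrt n \<le> sqrt n * sqrt n" using large1 by (intro mult_right_mono) auto
  ultimately have "3 * real h \<le> n" using sqrt_n by linarith
  then show ?thesis by linarith
qed

lemma h_pos: "1 \<le> h"
proof -
  have "0 < 1 / u" using u by simp
  then show ?thesis using h_bounds(1) by linarith
qed

text \<open>From \<open>h * u \<le> 3 / 2\<close> the exponents are at most 5 and 2;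
  \<open>243 = 3 ^ 5\<close> and \<open>9 = 3 ^ 2\<close> come from
  \<open>exp 1 \<le> 3\<close>.\<close>

lemma q3h: "1 / 243 \<le> exp (- u) ^ (3 * h)" and qh: "1 / 9 \<le> exp (- u) ^ h"
proof -
  have "exp (5::real) = exp 1 ^ 5" by (simp flip: exp_of_nat_mult)
  also have "\<dots> \<le> 3 ^ 5" using exp_le by (intro power_mono) auto
  finally have "1 / 243 \<le> exp (- 5 :: real)" by (simp add: exp_minus field_simps)
  also have "\<dots> \<le> exp (- (3 * h * u))" using h_bounds(3) by simp
  finally show "1 / 243 \<le> exp (- u) ^ (3 * h)" by (simp flip: exp_of_nat_mult)
  have "exp (2::real) = exp 1 ^ 2" by (simp flip: exp_of_nat_mult)
  also have "\<dots> \<le> 3 ^ 2" using exp_le by (intro power_mono) auto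
  finally have "1 / 9 \<le> exp (- 2 :: real)" by (simp add: exp_minus field_simps)
  also have "\<dots> \<le> exp (- (h * u))" using h_bounds(3) by simp
  finally show "1 / 9 \<le> exp (- u) ^ h" by (simp flip: exp_of_nat_mult)
qed

text \<open>Bounds the relative loss per step: \<open>2 * z \<le> x * m\<close>, as
  \<open>m \<ge> h / 243\<close> and \<open>729 = 486 * 3 / 2\<close>. Over \<open>k\<close> steps
  the exponents \<open>2 * x\<close> add up to at most \<open>10206 * sqrt (ln n)\<close>, where
  \<open>10206 = 7 * 2 * 729\<close>.\<close>

definition x :: real where "x = 729 * sqrt (ln n * u)"

lemma x_le: "0 \<le> x" "x \<le> 1 / 2"
proof -
  show "0 \<le> x" using n_pos u by (simp add: x_def)
  have "ln n * u \<le> ln n * (2 / sqrt n)" using u_le n_pos by (intro mult_left_mono) auto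
  also have "\<dots> \<le> (1 / 1458)\<^sup>2" using large2 sqrt_n by (simp add: field_simps power2_eq_square)
  finally have "sqrt (ln n * u) \<le> 1 / 1458" by (intro real_le_lsqrt) auto
  then show "x \<le> 1 / 2" by (simp add: x_def)
qed

lemma z_le: "486 * z \<le> x * h"
proof -
  have "z = sqrt (2 * (ln n * (1 / h))) * h"
  proof -
    have "z = sqrt (2 * (ln n * (1 / h)) * (real h)\<^sup>2)"
      unfolding z_def using h_pos by (simp add: power2_eq_square)
    then show ?thesis unfolding real_sqrt_mult by simp
  qed
  also have "sqrt (2 * (ln n * (1 / h))) \<le> sqrt ((3 / 2)\<^sup>2 * (ln n * u))"
  proof (intro real_sqrt_le_mono mult_mono)
    show "1 / real h \<le> u" using h_bounds(1) u h_pos by (simp add: field_simps)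
  qed (use n_pos u in \<open>auto simp: power2_eq_square\<close>)
  also have "\<dots> = 3 / 2 * sqrt (ln n * u)" unfolding real_sqrt_mult by simp
  finally have "z \<le> 3 / 2 * sqrt (ln n * u) * h" by (simp add: mult_right_mono)
  then show ?thesis by (simp add: x_def mult_ac)
qed

text \<open>The removed sizes lie in \<open>{2..h}\<close>, so the size 1 and both exchange windows
  remain available.\<close>

lemma smooth:
  assumes "A = ({1..n} - K) \<times> {b}" "K \<subseteq> {2..h}"
  shows "smooth_family (exp (- u)) A b h z"
proof
  show "(1, b) \<in> A" "{h<..3 * h} \<times> {b} \<subseteq> A"
    unfolding assms(1) using assms(2) h3_le n_pos(1) by auto
  show "finite A" unfolding assms(1) by simp
  fix j assume "j \<in> A"
  then show "1 \<le> fst j" unfolding assms(1) by auto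
next
  show "0 \<le> z" using n_pos by (simp add: z_def)
  have "486 * z \<le> 1 / 2 * h" using z_le x_le mult_right_mono[of x "1/2" "real h"] by linarith
  also have "1 / 2 * real h \<le> 486 * (h * (1 / 243))" by simp
  finally have "z \<le> h * (1 / 243)" by simp
  also have "\<dots> \<le> h * exp (- u) ^ (3 * h)" using q3h by (intro mult_left_mono) auto
  finally show "z \<le> h * exp (- u) ^ (3 * h)" .
qed (use u h_pos in auto)

lemma rho_delta:
  assumes "smooth_family (exp (- u)) A b h z"
  shows "exp (- (10206 * sqrt (ln n))) \<le> smooth_family.\<rho> (exp (- u)) h z ^ k"
    and "smooth_family.\<delta> (exp (- u)) h z \<le> 486 / real n ^ 4"
proof -
  interpret smooth_family "exp (- u)" A b h z by fact
  have "h * (1 / 243) \<le> h * exp (- u) ^ (3 * h)" using q3h by (intro mult_left_mono) auto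
  then have mh: "h / 243 \<le> m" using m_bounds(1) by simp
  have zm: "2 * z \<le> x * m"
  proof -
    have "2 * z \<le> x * (h / 243)" using z_le by simp
    also have "\<dots> \<le> x * m" using mh x_le by (intro mult_left_mono) auto
    finally show ?thesis .
  qed
  have "1 - x \<le> \<rho>"
  proof -
    have "(1 - x) * (m + z) \<le> m - z"
    proof -
      have "0 \<le> x * z" using x_le z(1) by simp
      then show ?thesis using zm by (simp add: algebra_simps)
    qed
    then show ?thesis unfolding \<rho>_def using m_pos z(1) by (simp add: pos_le_divide_eq)
  qed
  moreover have "exp (- (2 * x)) \<le> 1 - x"
    using inverse_le_exp[OF x_le] x_le by (simp add: exp_minus field_simps)
  ultimately have "exp (- (2 * x)) ^ k \<le> \<rho> ^ k" by (intro power_mono) auto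
  moreover have "exp (- (10206 * sqrt (ln n))) \<le> exp (- (2 * x)) ^ k"
  proof -
    have "k * sqrt (ln n * u) \<le> 7 / sqrt u * (sqrt (ln n) * sqrt u)"
      unfolding real_sqrt_mult using k_bounds u n_pos by (intro mult_right_mono) auto
    also have "\<dots> = 7 * sqrt (ln n)" using u by simp
    finally have "k * (2 * x) \<le> 10206 * sqrt (ln n)" by (simp add: x_def)
    then show ?thesis by (simp flip: exp_of_nat_mult)
  qed
  ultimately show "exp (- (10206 * sqrt (ln n))) \<le> \<rho> ^ k" by linarith
  have "err = exp (- (4 * ln n))"
    unfolding err_def unfolding z_def using h_pos n_pos by simp
  also have "\<dots> = 1 / real n ^ 4"
  proof -
    have "exp (4 * ln n) = exp (ln n) ^ 4" using exp_of_nat_mult[of 4 "ln n"] by simp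
    then show ?thesis using n_pos by (simp add: exp_minus field_simps)
  qed
  finally have err: "err = 1 / real n ^ 4" .
  have "\<delta> \<le> 2 * h * err / (h / 243)"
  proof -
    have "h / 243 \<le> m + z" "0 < m + z" "0 < real h / 243" "0 \<le> 2 * h * err"
      using mh m_pos h_pos z(1) by (auto simp: err_def)
    then show ?thesis unfolding \<delta>_def by (intro divide_left_mono mult_pos_pos) auto
  qed
  also have "\<dots> = 486 / real n ^ 4" using h_pos by (simp add: err)
  finally show "\<delta> \<le> 486 / real n ^ 4" .
qed

lemma n_large: "1568 \<le> real n"
  using large1 sqrt_n mult_right_mono[OF large1, of "sqrt n"] by (smt (verit) mult_le_cancel_right1)

lemma sup_bound:
  assumes "K \<subseteq> {2..h}"
  shows "wprob (exp (- u)) (({1..n} - K) \<times> {b}) N \<le> 3 * (u * sqrt u) * exp (10206 * sqrt (ln n))"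
proof -
  define A where "A = ({1..n} - K) \<times> {b}"
  note S = smooth[OF A_def assms]
  note rd = rho_delta[OF S]
  interpret smooth_family "exp (- u)" A b h z by (rule S)
  let ?a = "10206 * sqrt (ln n)"
  have w0: "0 \<le> wprob (exp (- u)) A N" by (rule wprob_nonneg)
  have "exp (- ?a) * wprob (exp (- u)) A N \<le> \<rho> ^ k * wprob (exp (- u)) A N"
    using rd(1) w0 by (intro mult_right_mono) auto
  also have "\<dots> \<le> 1 / (k * h * exp (- u) ^ h) + k * \<delta>"
    by (rule wprob_sup_bound[OF k_pos])
  also have "\<dots> \<le> 2 * (u * sqrt u) + u * sqrt u"
  proof (rule add_mono)
    have "6 / (u * sqrt u) * (1 / 9) \<le> k * h * exp (- u) ^ h"
      using kh_bounds(1) qh u by (intro mult_mono) auto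
    then have "1 / (k * h * exp (- u) ^ h) \<le> 1 / (6 / (u * sqrt u) * (1 / 9))"
      using u h_pos k_pos by (intro divide_left_mono mult_pos_pos) auto
    also have "\<dots> \<le> 2 * (u * sqrt u)" using u by (simp add: field_simps)
    finally show "1 / (k * h * exp (- u) ^ h) \<le> 2 * (u * sqrt u)" .
    have "k * \<delta> \<le> 7 / sqrt u * (486 / real n ^ 4)"
      using k_bounds rd(2) delta u by (intro mult_mono) auto
    also have "\<dots> \<le> 1 / sqrt u * u\<^sup>2"
    proof -
      have "13608 \<le> real n ^ 3"
        using power_mono[OF n_large, of 3] by simp
      then have "13608 * real n \<le> real n ^ 3 * n" using n_pos by (intro mult_right_mono) auto
      then have "3402 / real n ^ 4 \<le> 1 / (4 * n)"
        using n_pos by (simp add: field_simps eval_nat_numeral)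
      then have "3402 / real n ^ 4 \<le> u\<^sup>2" using un by linarith
      then have "1 / sqrt u * (3402 / real n ^ 4) \<le> 1 / sqrt u * u\<^sup>2" using u by (intro mult_left_mono) auto
      then show ?thesis by simp
    qed
    also have "\<dots> = u * sqrt u"
      using sqrt_u by (simp add: field_simps power2_eq_square)
    finally show "k * \<delta> \<le> u * sqrt u" .
  qed
  finally have "exp ?a * (exp (- ?a) * wprob (exp (- u)) A N) \<le> exp ?a * (3 * (u * sqrt u))"
    by (intro mult_left_mono) auto
  moreover have "exp ?a * (exp (- ?a) * w) = w" for w
    by (simp add: exp_minus)
  ultimately have "wprob (exp (- u)) A N \<le> exp ?a * (3 * (u * sqrt u))" by metis
  then show ?thesis by (simp add: A_def mult.commute)
qed

text \<open>Matches \<open>sup_bound\<close> up to the factor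
  \<open>1512 * exp (2 * 10206 * sqrt (ln n))\<close>, which is the price of conditioning for each
  of the two partitions.\<close>

lemma lower_bound:
  "exp (- (10206 * sqrt (ln n))) * (u * sqrt u) / 504 \<le> wprob (exp (- u)) ({1..n} \<times> {b}) n"
proof -
  define A where "A = {1..n} \<times> {b}"
  have "smooth_family (exp (- u)) A b h z" using smooth[of A "{}" b] by (simp add: A_def)
  note S = this
  note rd = rho_delta[OF S]
  interpret smooth_family "exp (- u)" A b h z by (rule S)
  let ?a = "10206 * sqrt (ln n)"
  let ?p = "measure_pmf.prob (geo (exp (- u)) A) {f. \<bar>real (weight A f) - real n\<bar> < k * h}"
  have p: "3 / 4 \<le> ?p"
    using weight_concentrated[OF u(1) mean kh_bounds(1), of b] by (simp add: A_def)
  have e: "2 * real k ^ 2 * h * \<delta> \<le> exp (- ?a) / 4"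
  proof -
    have "2 * real k ^ 2 * h * \<delta> \<le> 2 * (7 / sqrt u) ^ 2 * (2 / u) * (486 / real n ^ 4)"
      using k_bounds h_bounds rd(2) delta u by (intro mult_mono power_mono) auto
    also have "\<dots> = 95256 / real n ^ 4 / u\<^sup>2"
      using u by (simp add: power_divide power2_eq_square)
    also have "\<dots> \<le> 95256 / real n ^ 4 / (1 / (4 * n))"
      using un u n_pos by (intro divide_left_mono mult_pos_pos) auto
    also have "\<dots> = 381024 / real n ^ 3" using n_pos by (simp add: field_simps eval_nat_numeral)
    also have "\<dots> \<le> exp (- ?a) / 4" using large3 by simp
    finally show ?thesis .
  qed
  have "exp (- ?a) * (3 / 4) \<le> \<rho> ^ k * ?p" using rd(1) p rho by (intro mult_mono) auto
  then have "exp (- ?a) / 2 \<le> \<rho> ^ k * ?p - 2 * real k ^ 2 * h * \<delta>" using e by linarith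
  then have "1 / 9 * (exp (- ?a) / 2) \<le> exp (- u) ^ h * (\<rho> ^ k * ?p - 2 * real k ^ 2 * h * \<delta>)"
    using qh by (intro mult_mono) auto
  also have "\<dots> \<le> 2 * k * h * wprob (exp (- u)) A n"
    by (rule wprob_lower_bound[OF kh_le k_pos])
  also have "\<dots> \<le> 2 * (14 / (u * sqrt u)) * wprob (exp (- u)) A n"
    using kh_bounds(2) wprob_nonneg by (intro mult_right_mono) auto
  finally show ?thesis using u by (simp add: A_def field_simps)
qed

end

section \<open>Asymptotics\<close>

text \<open>\<open>2560000 = 256 * 50\<^sup>2 * 4\<close>, for \<open>J = 50\<close> and
  \<open>H = 4 * L\<close>. The exponent must exceed 1 for the ratio to vanish; keeping it close to
  1 yields more blocks.\<close>

lemma asymp_block_ratio: "\<forall>\<^sub>F L :: real in at_top. 2560000 * L / (L powr 1.1 - 1) \<le> 0.03"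
  by real_asymp

lemma asymp_large:
  "\<forall>\<^sub>F L :: real in at_top. 1568 \<le> exp (L / 2)"
  "\<forall>\<^sub>F L :: real in at_top. 4251528 * L \<le> exp (L / 2)"
  "\<forall>\<^sub>F L :: real in at_top. 1524096 * exp (- 3 * L) \<le> exp (- (10206 * sqrt L))"
  "\<forall>\<^sub>F L :: real in at_top. 2 * (4 * L + 1) * exp (- (0.05 * L)) \<le> 1"
  "\<forall>\<^sub>F L :: real in at_top. 2 \<le> L powr 1.1"
  by real_asymp+

text \<open>With \<open>L = ln n\<close> there are about \<open>0.45 L / (2.2 ln L)\<close> blocks, each costing a factor \<open>0.55\<close>,
  and \<open>0.56 * 0.45 / 2.22 > 0.11\<close>.\<close>

lemma asymp_first:
  "\<forall>\<^sub>F L :: real in at_top. 4064256 * exp (2 * 10206 * sqrt L) * exp (- L) \<le> exp (- (0.11 * L / ln L)) / 2"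
  by real_asymp

text \<open>Rounding \<open>G\<close> up is paid for by passing from 1.1 to 1.11, whence
  \<open>2.22 = 2 * 1.11\<close>.\<close>

lemma asymp_ln: "\<forall>\<^sub>F L :: real in at_top. ln (L powr 1.1 + 1) \<le> 1.11 * ln L"
  by real_asymp

text \<open>The summand 30 pays for the constant prefactor in \<open>asymp_second\<close>, and
  \<open>sqrt L\<close> is of lower order than \<open>L / ln L\<close>.\<close>

lemma asymp_exponent: "\<forall>\<^sub>F L :: real in at_top.
    30 + 4 * 10206 * sqrt L + 0.11 * L / ln L \<le> 0.56 * (0.45 * L / (2.22 * ln L) - 1)"
  by real_asymp

lemma asymp_second:
  "\<forall>\<^sub>F L :: real in at_top. 2286144 * exp (4 * 10206 * sqrt L) *
     exp (- (0.56 * (0.45 * L / (2.22 * ln L) - 1))) \<le> exp (- (0.11 * L / ln L)) / 2"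
  using asymp_exponent
proof eventually_elim
  case (elim L)
  have "(2::real) ^ 30 \<le> exp 1 ^ 30"
    using exp_ge_add_one_self[of 1] by (intro power_mono) auto
  also have "exp (1::real) ^ 30 = exp 30" by (simp flip: exp_of_nat_mult)
  finally have "(4572288::real) \<le> exp 30" by simp
  then have "4572288 * exp (4 * 10206 * sqrt L - 0.56 * (0.45 * L / (2.22 * ln L) - 1)) \<le>
      exp 30 * exp (4 * 10206 * sqrt L - 0.56 * (0.45 * L / (2.22 * ln L) - 1))"
    by (intro mult_right_mono) auto
  also have "\<dots> \<le> exp (- (0.11 * L / ln L))"
    unfolding exp_add[symmetric] exp_le_cancel_iff using elim by linarith
  finally show ?case unfolding exp_diff exp_minus by (simp add: field_simps)
qed

lemma ln_055: "ln (0.55 :: real) \<le> - 0.56"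
proof -
  have "exp (0.56::real) = exp 0.14 ^ 4" by (simp flip: exp_of_nat_mult)
  also have "\<dots> \<le> (1 + 0.14 + 0.14\<^sup>2) ^ 4"
    by (intro power_mono exp_bound) auto
  also have "\<dots> \<le> 1 / 0.55" by (simp add: power2_eq_square eval_nat_numeral)
  finally have "0.55 \<le> exp (- 0.56 :: real)" by (simp add: exp_minus field_simps)
  then have "ln 0.55 \<le> ln (exp (- 0.56 :: real))" by (subst ln_le_cancel_iff) auto
  then show ?thesis by simp
qed

text \<open>Both terms of \<open>Q_block_bound\<close> are divided by \<open>lo * lo\<close>. The
  failures, \<open>2 * M / n ^ 4\<close>, still leave \<open>exp (- L)\<close> because
  \<open>M \<le> n\<close> and \<open>u ^ 3 \<ge> 1 / (8 * n\<^sup>2)\<close>. The constants are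
  \<open>4064256 = 2 * 8 * 504\<^sup>2\<close> and
  \<open>2286144 = (3 * 504)\<^sup>2\<close>.\<close>

lemma (in tuned) Q_bound:
  fixes L :: real and G M :: nat
  defines "L \<equiv> ln n"
  assumes G: "2 \<le> G" "256 * 50\<^sup>2 * (4 * L) / (real G - 1) \<le> 0.03"
    and M: "real M \<le> n" and top: "real (nat \<lceil>4 * L\<rceil> * G ^ (2 * M)) * u \<le> 1"
  shows "Q n \<le> 4064256 * exp (2 * 10206 * sqrt L) * exp (- L) +
     2286144 * exp (4 * 10206 * sqrt L) * 0.55 ^ M"
proof -
  define a where "a = 10206 * sqrt L"
  define c where "c = 3 * (u * sqrt u) * exp a"
  define lo where "lo = exp (- a) * (u * sqrt u) / 504"
  have L: "1 \<le> L" using n_pos by (simp add: L_def)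
  have eL: "exp L = n" using n_pos by (simp add: L_def)
  define r0 where "r0 = nat \<lceil>4 * L\<rceil>"
  have r0: "4 * L \<le> r0" unfolding r0_def by (rule real_nat_ceiling_ge)
  have rh: "r0 * G ^ (2 * M) \<le> h"
  proof -
    have "real (r0 * G ^ (2 * M)) \<le> 1 / u" using top u by (simp add: field_simps r0_def)
    then have "real (r0 * G ^ (2 * M)) \<le> h" using h_bounds by linarith
    then show ?thesis by (rule of_nat_le_iff[THEN iffD1])
  qed
  have "1 \<le> real r0" using r0 L by linarith
  then have K: "{r0<..r0 * G ^ (2 * M)} \<subseteq> {2..h}" using rh by auto
  have lo0: "0 < lo" using u by (simp add: lo_def)
  have lo: "lo \<le> wprob (exp (- u)) ({1..n} \<times> {b}) n" for b
    using lower_bound by (simp add: lo_def a_def L_def)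
  have "Q n * (lo * lo) \<le> Q n * (wprob (exp (- u)) ({1..n} \<times> {True}) n * wprob (exp (- u)) ({1..n} \<times> {False}) n)"
    using lo lo0 by (intro mult_left_mono mult_mono) (auto simp: Q_def wprob_nonneg)
  also have "\<dots> \<le> 2 * M * exp (- (4 * L)) + 0.55 ^ M * c\<^sup>2"
  proof (rule Q_block_bound[where ?r0.0 = r0 and G = G and J = 50])
    show "r0 * G ^ (2 * M) \<le> n" using rh h3_le by linarith
    show "real (r0 * G ^ (2 * M)) * u \<le> 1" using top by (simp add: r0_def)
    show "1 / 2 + 1 / real 50 + 256 * (real 50)\<^sup>2 * (4 * L) / (real G - 1) \<le> 0.55"
      using G(2) by simp
    show "wprob (exp (- u)) (({1..n} - {r0<..r0 * G ^ (2 * M)}) \<times> {b}) N \<le> c" for b N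
      unfolding c_def a_def L_def by (rule sup_bound[OF K])
  qed (use u L r0 G in auto)
  finally have "Q n \<le> (2 * M * exp (- (4 * L)) + 0.55 ^ M * c\<^sup>2) / (lo * lo)"
    using lo0 by (simp add: pos_le_divide_eq)
  also have "\<dots> = 2 * M * exp (- (4 * L)) / (lo * lo) + 0.55 ^ M * (c\<^sup>2 / (lo * lo))"
    by (simp add: add_divide_distrib)
  also have "\<dots> \<le> 4064256 * exp (2 * a) * exp (- L) + 0.55 ^ M * (2286144 * exp (4 * a))"
  proof (rule add_mono)
    have u3: "1 / (8 * (real n)\<^sup>2) \<le> u\<^sup>2 * u"
    proof -
      have "sqrt n \<le> n" using n_large sqrt_n large1 mult_right_mono[of 1 "sqrt n" "sqrt n"] by linarith
      then have "1 / (2 * real n) \<le> 1 / (2 * sqrt n)" using sqrt_n by (intro divide_left_mono) auto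
      then have "1 / (2 * real n) \<le> u" using u_ge by linarith
      then have "1 / (4 * real n) * (1 / (2 * real n)) \<le> u\<^sup>2 * u" using un u by (intro mult_mono) auto
      then show ?thesis by (simp add: power2_eq_square)
    qed
    have ll: "lo * lo = exp (- (2 * a)) * (u\<^sup>2 * u) / 254016"
    proof -
      have "lo * lo = (exp (- a) * exp (- a)) * (u * u * (sqrt u * sqrt u)) / 254016"
        unfolding lo_def by simp
      then show ?thesis using sqrt_u by (simp add: power2_eq_square flip: exp_add)
    qed
    have "exp (- (2 * a)) * (1 / (8 * (real n)\<^sup>2)) / 254016 \<le> lo * lo"
      unfolding ll using u3 by (intro divide_right_mono mult_left_mono) auto
    then have "2 * M * exp (- (4 * L)) / (lo * lo) \<le>
        2 * M * exp (- (4 * L)) / (exp (- (2 * a)) * (1 / (8 * (real n)\<^sup>2)) / 254016)"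
      using n_pos lo0 by (intro divide_left_mono mult_pos_pos) auto
    also have "\<dots> = 4064256 * exp (2 * a) * (M * (real n)\<^sup>2 * exp (- (4 * L)))"
      using n_pos by (simp add: exp_minus field_simps)
    also have "\<dots> \<le> 4064256 * exp (2 * a) * exp (- L)"
    proof (intro mult_left_mono)
      have "M * (real n)\<^sup>2 * exp (- (4 * L)) \<le> n * (real n)\<^sup>2 * exp (- (4 * L))"
        using M by (intro mult_right_mono) auto
      also have "\<dots> = exp (L + (L + L) - 4 * L)"
        unfolding eL[symmetric] power2_eq_square by (simp only: exp_add exp_diff exp_minus divide_inverse)
      finally show "M * (real n)\<^sup>2 * exp (- (4 * L)) \<le> exp (- L)" by simp
    qed simp
    finally show "2 * M * exp (- (4 * L)) / (lo * lo) \<le> 4064256 * exp (2 * a) * exp (- L)" .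
    have "c = 1512 * exp (2 * a) * lo"
    proof -
      have "exp (2 * a) * exp (- a) = exp a" by (simp flip: exp_add)
      moreover have "1512 * exp (2 * a) * lo = 3 * (exp (2 * a) * exp (- a)) * (u * sqrt u)"
        unfolding lo_def by simp
      ultimately show ?thesis by (simp add: c_def)
    qed
    then have "c\<^sup>2 / (lo * lo) = 2286144 * exp (2 * a) ^ 2"
      using lo0 by (simp add: power_mult_distrib power2_eq_square)
    also have "exp (2 * a) ^ 2 = exp (4 * a)" by (simp add: power2_eq_square flip: exp_add)
    finally show "0.55 ^ M * (c\<^sup>2 / (lo * lo)) \<le> 0.55 ^ M * (2286144 * exp (4 * a))" by simp
  qed
  finally show ?thesis by (simp add: a_def mult_ac)
qed

lemma Q_bound_log:
  fixes n :: nat and L :: real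
  defines "L \<equiv> ln (real n)"
  assumes n8: "8 \<le> n" and L1: "1 < L"
    and ratio: "2560000 * L / (L powr 1.1 - 1) \<le> 0.03"
    and large1: "1568 \<le> exp (L / 2)" and large2: "4251528 * L \<le> exp (L / 2)"
    and large3: "1524096 * exp (- 3 * L) \<le> exp (- (10206 * sqrt L))"
    and large4: "2 * (4 * L + 1) * exp (- (0.05 * L)) \<le> 1" and large5: "2 \<le> L powr 1.1"
    and ln_le: "ln (L powr 1.1 + 1) \<le> 1.11 * ln L"
  shows "Q n \<le> 4064256 * exp (2 * 10206 * sqrt L) * exp (- L) +
    2286144 * exp (4 * 10206 * sqrt L) * exp (- (0.56 * (0.45 * L / (2.22 * ln L) - 1)))"
proof -
  have n: "0 < real n" "exp L = n" using n8 by (auto simp: L_def)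
  have sqn: "sqrt n = exp (L / 2)"
  proof -
    have "sqrt n = sqrt ((exp (L / 2))\<^sup>2)" unfolding n(2)[symmetric] by (simp add: power2_eq_square flip: exp_add)
    then show ?thesis by simp
  qed
  obtain u where u: "0 < u" "mean n u = n" "u\<^sup>2 \<le> 2 / n" "1 / (4 * n) \<le> u\<^sup>2" "u \<le> 1 / 2"
    using exists_mean n8 by blast
  have "exp (- 3 * L) = 1 / real n ^ 3"
    unfolding n(2)[symmetric] by (simp add: exp_minus divide_inverse flip: exp_of_nat_mult)
  then have large3': "1524096 / real n ^ 3 \<le> exp (- (10206 * sqrt (ln (real n))))"
    using large3 by (simp add: L_def)
  interpret tuned n u
    by unfold_locales (fact u large3' large1[folded sqn] large2[folded sqn, unfolded L_def])+
  define G where "G = nat \<lceil>L powr 1.1\<rceil>"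
  have G: "L powr 1.1 \<le> G" unfolding G_def by (rule real_nat_ceiling_ge)
  have G': "G \<le> L powr 1.1 + 1" unfolding G_def by (rule less_imp_le[OF nat_ceiling_less]) simp
  have G2: "2 \<le> real G" using G large5 by linarith
  have lnG0: "0 < ln G" using G2 by simp
  have "ln G \<le> ln (L powr 1.1 + 1)" using G' G2 by simp
  then have lnG: "ln G \<le> 1.11 * ln L" using ln_le by linarith
  \<comment> \<open>This makes \<open>G ^ (2 * M)\<close> at most \<open>exp (0.45 * L)\<close>;
    since \<open>u\<close> is at most \<open>2 * exp (- (L / 2))\<close>, a factor
    \<open>exp (- (0.05 * L))\<close> remains to absorb \<open>4 * L + 1\<close>.\<close>
  define y where "y = 0.45 * L / (2 * ln G)"
  define M where "M = nat \<lfloor>y\<rfloor>"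
  have y0: "0 \<le> y" using lnG0 L1 by (simp add: y_def)
  have M: "real M \<le> y" "y - 1 \<le> M"
    using y0 unfolding M_def by (simp_all add: of_nat_nat)
  have Mn: "real M \<le> n"
  proof -
    have "1 / 2 \<le> ln (2::real)" using ln2_ge_two_thirds by simp
    also have "\<dots> \<le> ln G" using G2 by simp
    finally have "y \<le> 0.45 * L / 1" unfolding y_def using L1 by (intro divide_left_mono) auto
    also have "\<dots> \<le> 1 * L" using L1 by simp
    also have "\<dots> \<le> exp L" using exp_ge_add_one_self[of L] by linarith
    finally show ?thesis using M n by linarith
  qed
  have top: "real (nat \<lceil>4 * L\<rceil> * G ^ (2 * M)) * u \<le> 1"
  proof -
    have "real (G ^ (2 * M)) = exp (ln G) ^ (2 * M)" using G2 by simp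
    also have "\<dots> = exp (real (2 * M) * ln G)" by (rule exp_of_nat_mult[symmetric])
    also have "\<dots> \<le> exp (2 * y * ln G)" using M lnG0 by (simp add: mult_right_mono)
    also have "2 * y * ln G = 0.45 * L" using lnG0 by (simp add: y_def)
    finally have 1: "real (G ^ (2 * M)) \<le> exp (0.45 * L)" .
    have 2: "real (nat \<lceil>4 * L\<rceil>) \<le> 4 * L + 1" using L1 by (intro less_imp_le[OF nat_ceiling_less]) auto
    have 3: "u \<le> 2 * exp (- (L / 2))" using u_le unfolding sqn by (simp add: exp_minus field_simps)
    have "real (nat \<lceil>4 * L\<rceil>) * real (G ^ (2 * M)) * u \<le> (4 * L + 1) * exp (0.45 * L) * (2 * exp (- (L / 2)))"
    proof (rule mult_mono[OF mult_mono[OF 2 1] 3])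
      show "0 \<le> 4 * L + 1" "0 \<le> u" using L1 u(1) by linarith+
      then show "0 \<le> (4 * L + 1) * exp (0.45 * L)" by (intro mult_nonneg_nonneg) auto
    qed (rule of_nat_0_le_iff)
    also have "\<dots> = 2 * (4 * L + 1) * (exp (0.45 * L) * exp (- (L / 2)))"
      by (simp only: mult_ac)
    also have "exp (0.45 * L) * exp (- (L / 2)) = exp (- (0.05 * L))"
      unfolding exp_add[symmetric] exp_inj_iff by (simp add: field_simps)
    also have "2 * (4 * L + 1) * exp (- (0.05 * L)) \<le> 1" by (rule large4)
    finally show ?thesis unfolding of_nat_mult .
  qed
  have ratio': "256 * 50\<^sup>2 * (4 * L) / (real G - 1) \<le> 0.03"
  proof -
    have "256 * 50\<^sup>2 * (4 * L) / (real G - 1) \<le> 2560000 * L / (L powr 1.1 - 1)"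
      using G large5 L1 by (intro frac_le) auto
    then show ?thesis using ratio by linarith
  qed
  have "2 \<le> G" using G2 by simp
  from Q_bound[folded L_def, OF this ratio' Mn top]
  have "Q n \<le> 4064256 * exp (2 * 10206 * sqrt L) * exp (- L) +
      2286144 * exp (4 * 10206 * sqrt L) * 0.55 ^ M" .
  moreover have "0.55 ^ M \<le> exp (- (0.56 * (0.45 * L / (2.22 * ln L) - 1)))"
  proof -
    have "(0.55::real) ^ M = exp (ln 0.55) ^ M" by simp
    also have "\<dots> = exp (M * ln 0.55)" by (rule exp_of_nat_mult[symmetric])
    finally have p: "(0.55::real) ^ M = exp (M * ln 0.55)" .
    have "M * ln (0.55::real) \<le> M * (- 0.56)" by (rule mult_left_mono[OF ln_055]) simp
    also have "\<dots> \<le> - (0.56 * (y - 1))" using M(2) by simp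
    finally have "M * ln (0.55::real) \<le> - (0.56 * (y - 1))" .
    moreover have "0.45 * L / (2.22 * ln L) \<le> y"
      unfolding y_def using lnG lnG0 L1 by (intro divide_left_mono mult_pos_pos) auto
    then have "- (0.56 * (y - 1)) \<le> - (0.56 * (0.45 * L / (2.22 * ln L) - 1))"
      by simp
    ultimately have "M * ln (0.55::real) \<le> - (0.56 * (0.45 * L / (2.22 * ln L) - 1))"
      by (rule order_trans)
    then show ?thesis unfolding p by (rule exp_le_cancel_iff[THEN iffD2])
  qed
  then have "2286144 * exp (4 * 10206 * sqrt L) * 0.55 ^ M \<le>
    2286144 * exp (4 * 10206 * sqrt L) * exp (- (0.56 * (0.45 * L / (2.22 * ln L) - 1)))"
    by (rule mult_left_mono) simp
  ultimately show ?thesis by linarith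
qed

theorem theorem4p1:
  shows "\<forall>\<^sub>F n :: nat in sequentially.
    Q n \<le> exp (- (0.11 * ln (real n) / ln (ln (real n))))"
proof -
  have lim: "filterlim (\<lambda>n::nat. ln (real n)) at_top sequentially" by real_asymp
  note ev = eventually_compose_filterlim[OF _ lim]
  show ?thesis
    using ev[OF asymp_block_ratio] ev[OF asymp_large(1)] ev[OF asymp_large(2)] ev[OF asymp_large(3)]
      ev[OF asymp_large(4)] ev[OF asymp_large(5)] ev[OF asymp_first] ev[OF asymp_second] ev[OF asymp_ln]
      ev[OF eventually_gt_at_top[of 1]] eventually_ge_at_top[of 8]
  proof eventually_elim
    case (elim n)
    show ?case
      using Q_bound_log[OF elim(11,10,1-6,9)] elim(7,8) by linarith
  qed
qed

end
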